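(* Consider two preference relations $\succeq$ and $\succeq^*$ on $\tilde V_0$, each satisfying Axioms A1-A8. Then $\succeq$ is more ambiguity averse than $\succeq^*$ if, and only if, $\succeq^*$ and $\succeq$ may be identified with (i.e., are represented in the sense of $( * )$ in the context by) triples $(\phi^*,\psi^*,c^* )$ and $(\phi,\psi,c)$, respectively, such that $\phi^*=\phi$, $\psi^*=\psi$ and $c^*\ge c$.
   Context: Setup. $(W,\Sigma')$ is a measurable space (states of the world). $(S,\Sigma,P)$ is a non-atomic probability space, supporting a uniform random variable on $[0,1]$. $\tilde V$ is the space of all bounded $\Sigma'\otimes\Sigma$-measurable $\tilde v:W\times S\to\mathbb{R}$; $\tilde V_0\subset\tilde V$ consists of those taking finitely many values. For $w\in W$, $\tilde v^w:S\to\mathbb{R}$ is $s\mapsto\tilde v(w,s)$, and $F_{\tilde v}(w,t)=P[\tilde v^w\le t]$. $V$ (resp. $V_0$) is the set of $v\in\tilde V$ (resp. $\tilde V_0$) for which $F_v(w,\cdot)$ does not depend on $w$; write $F_v(t)$. $V'$ (resp. $V'_0$) is the set of elements of $\tilde V$ (resp. $\tilde V_0$) not depending on $s\in S$. Real numbers are identified with constant random variables. $\Delta(W,\Sigma')$ is the set of finitely additive measures on $(W,\Sigma')$ with mass one, with the weak* topology. $c$ is grounded if $\min_{Q\in\Delta(W,\Sigma')}c(Q)=0$. "Increasing" means strictly increasing. $\tilde v,\tilde u\in\tilde V$ are comonotonic if $(\tilde v^w(s')-\tilde v^w(s))(\tilde u^w(s')-\tilde u^w(s))\ge0$ for all $w\in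 W$, $s,s'\in S$; "pc" means (pairwise) comonotonic. For $v\in V$, $\int v\,\mathrm{d}\nu_\psi:=\int_{-\infty}^0(\psi(1-F_v(t))-1)\,\mathrm{d}t+\int_0^\infty\psi(1-F_v(t))\,\mathrm{d}t$; $\int\phi(\tilde v^{\cdot})\,\mathrm{d}\nu_\psi$ is the function of $w$ obtained by applying this to $s\mapsto\phi(\tilde v^w(s))$ for each $w$. Comparative ambiguity aversion: $\succeq$ is more ambiguity averse than $\succeq^*$ if, for all $\tilde v\in\tilde V_0$ and $v\in V_0$, $\tilde v\succeq v\Rightarrow\tilde v\succeq^*v$. Representation. A relation $\succeq$ is represented by $(\phi,\psi,c)$, where $\phi:\mathbb{R}\to\mathbb{R}$ is increasing and continuous, $\psi:[0,1]\to[0,1]$ is non-constant, non-decreasing and continuous with $\psi(0)=0,\psi(1)=1$, and $c:\Delta(W,\Sigma')\to[0,\infty]$ is grounded, convex and lower-semicontinuous, if for all $\tilde v,\tilde u\in\tilde V_0$: $( * )$ $\tilde v\succeq\tilde u\iff U(\tilde v)\ge U(\tilde u)$ with $U(\tilde v)=\min_{Q\in\Delta(W,\Sigma')}\{\mathbb{E}_Q[\int\phi(\tilde v^{\cdot})\,\mathrm{d}\nu_\psi]+c(Q)\}$. (The paper's main theorem asserts that every relation satisfying A1-A8 admits such a representation.) Preferences. For a binary relation $\succeq$ on $\tilde V_0$, $\succ$ and $\sim$ are its strict part and indifference. It induces a relation on sections: $\tilde v^w\succeq\tilde u^w$ iff $v\succeq u$ for $v,u\in V_0$ with $F_v=F_{\tilde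 v}(w,\cdot)$, $F_u=F_{\tilde u}(w,\cdot)$. The certainty equivalent of $\tilde v$ is the $m_{\tilde v}\in\mathbb{R}$ with $m_{\tilde v}\sim\tilde v$. For $A\in\Sigma$, $t,x\in\mathbb{R}$, $tAx:=tI_A+xI_{A^c}\in V_0$. $E\in\Sigma$ is essential if $t\succ tEx\succ x$ for some $t>x$. For $v,u\in V_0$ and $B\in\Sigma$, $\mathrm{sub}(vBu)(s)=m_{v(s)Bu(s)}$. Axioms. A1: $\succeq$ is complete and transitive on $\tilde V_0$. A2: if $F_{\tilde v}=F_{\tilde u}$ then $\tilde v\sim\tilde u$. A3: if $v,u\in V_0$, $v\succ u$, and $v_n,u_n$ are uniformly bounded sequences in $V_0$ converging in distribution to $v,u$, then from some $n$ onwards $v_n\succ u$ and $v\succ u_n$; moreover for every $\tilde v\in\tilde V_0$ the sets $\{m\in\mathbb{R}:m\succ\tilde v\}$ and $\{m\in\mathbb{R}:\tilde v\succ m\}$ are open. A4: for $v,u\in V_0$, if $F_v(t)\le F_u(t)$ for all $t$ then $v\succeq u$; if in addition the inequality is strict for some $t$ then $v\succ u$. A5: if $\tilde v^w\succeq\tilde u^w$ for every $w\in W$ then $\tilde v\succeq\tilde u$. A6: if $v',u'\in V'_0$, $\alpha\in(0,1)$ and $v'\sim u'$, then $\alpha v'\oplus(1-\alpha)u'\succeq v'$. A7: if $\tilde v,\tilde u\in\tilde V_0$, $r\in V_0$, and $\tilde v,r$ and $\tilde u,r$ are pc, then $\tilde v\succeq\tilde u\Rightarrow\tilde v\oplus r\succeq\tilde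 u\oplus r$ (whenever both subjective sums exist). A8: for every essential $A\in\Sigma$, every $B\in\Sigma$, and all $v=xAy$, $u=x'Ay'$, $r=x''Ay''$ that are pairwise comonotonic with $x,x'\ge x''$ and $y,y'\ge y''$ (or $x''\ge x,x'$ and $y''\ge y,y'$): $v\succeq u\Rightarrow\mathrm{sub}(vBr)\succeq\mathrm{sub}(uBr)$. The operation $\oplus$. Under A1-A4 and A8, $\succeq$ restricted to $V_0$ has a (biseparable) representation $\mathcal{U}:V_0\to\mathbb{R}$ and a function $\rho:[0,1]\to[0,1]$, not identically $0$ or $1$ on $(0,1)$, with $\mathcal{U}(tAx)=\phi(t)\rho(P(A))+\phi(x)(1-\rho(P(A)))$ for all $t\ge x$, $A\in\Sigma$, where $\phi(t)=\mathcal{U}(t)$ is increasing, continuous, and unique up to positive affine transformations. $\alpha\tilde v\oplus(1-\alpha)\tilde u$ is the $\tilde r$ with $\phi(\tilde r)=\alpha\phi(\tilde v)+(1-\alpha)\phi(\tilde u)$ pointwise; $\tilde v\oplus\tilde u$ is the $\tilde r$ (when it exists) with $\tfrac12\phi(\tilde r)+\tfrac12\phi(0)=\tfrac12\phi(\tilde v)+\tfrac12\phi(\tilde u)$ pointwise. *)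

theory Defs
  imports "HOL-Probability.Probability"
begin

text \<open>
  The measures \<open>W\<close> and \<open>P\<close> below stand for $(W,\Sigma')$, of which only \<open>space\<close> and \<open>sets\<close> are
  used, and for $(S,\Sigma,P)$.  An act is a function on \<open>'w \<times> 's\<close>; only its values on
  \<open>space (W \<Otimes>\<^sub>M P)\<close> matter, since by axiom \<open>A2\<close> acts that agree there are indifferent.
  A preference is a binary relation on acts, of which only the restriction to \<open>tV0\<close> is used.
\<close>

type_synonym ('w, 's) act = "'w \<times> 's \<Rightarrow> real"
type_synonym ('w, 's) pref = "('w, 's) act \<Rightarrow> ('w, 's) act \<Rightarrow> bool"

definition nonatomic :: "'s measure \<Rightarrow> bool" where
  "nonatomic P \<longleftrightarrow> (\<forall>A\<in>sets P. measure P A > 0 \<longrightarrow>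
     (\<exists>B\<in>sets P. B \<subseteq> A \<and> 0 < measure P B \<and> measure P B < measure P A))"

definition supports_uniform :: "'s measure \<Rightarrow> bool" where
  "supports_uniform P \<longleftrightarrow>
     (\<exists>X\<in>borel_measurable P. distr P borel X = uniform_measure lborel {0..1::real})"

subsection \<open>Spaces of acts\<close>

definition tV :: "'w measure \<Rightarrow> 's measure \<Rightarrow> ('w, 's) act set" where
  "tV W P = {v \<in> borel_measurable (W \<Otimes>\<^sub>M P). bounded (v ` space (W \<Otimes>\<^sub>M P))}"

definition tV0 :: "'w measure \<Rightarrow> 's measure \<Rightarrow> ('w, 's) act set" where
  "tV0 W P = {v \<in> tV W P. finite (v ` space (W \<Otimes>\<^sub>M P))}"

definition rv_cdf :: "'s measure \<Rightarrow> ('s \<Rightarrow> real) \<Rightarrow> real \<Rightarrow> real" where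
  "rv_cdf P x t = measure P {s \<in> space P. x s \<le> t}"

definition F :: "'s measure \<Rightarrow> ('w, 's) act \<Rightarrow> 'w \<Rightarrow> real \<Rightarrow> real" where
  "F P v w = rv_cdf P (\<lambda>s. v (w, s))"

definition V0 :: "'w measure \<Rightarrow> 's measure \<Rightarrow> ('w, 's) act set" where
  "V0 W P = {v \<in> tV0 W P. \<forall>w\<in>space W. \<forall>w'\<in>space W. F P v w = F P v w'}"

text \<open>The common distribution function $F_v$ of an act \<open>v \<in> V0 W P\<close>.\<close>

definition FV :: "'w measure \<Rightarrow> 's measure \<Rightarrow> ('w, 's) act \<Rightarrow> real \<Rightarrow> real" where
  "FV W P v = (THE G. \<forall>w\<in>space W. F P v w = G)"

definition V0' :: "'w measure \<Rightarrow> 's measure \<Rightarrow> ('w, 's) act set" where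
  "V0' W P = {v \<in> tV0 W P. \<forall>w\<in>space W. \<forall>s\<in>space P. \<forall>s'\<in>space P. v (w, s) = v (w, s')}"

definition comonotonic :: "'w measure \<Rightarrow> 's measure \<Rightarrow> ('w, 's) act \<Rightarrow> ('w, 's) act \<Rightarrow> bool" where
  "comonotonic W P v u \<longleftrightarrow> (\<forall>w\<in>space W. \<forall>s\<in>space P. \<forall>s'\<in>space P.
     (v (w, s') - v (w, s)) * (u (w, s') - u (w, s)) \<ge> 0)"

abbreviation (input) const :: "real \<Rightarrow> ('w, 's) act" where
  "const x \<equiv> (\<lambda>_. x)"

definition bet :: "real \<Rightarrow> 's set \<Rightarrow> real \<Rightarrow> ('w, 's) act" where
  "bet t A x = (\<lambda>(w, s). if s \<in> A then t else x)"

subsection \<open>Notions derived from a preference\<close>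

definition strict :: "('w, 's) pref \<Rightarrow> ('w, 's) pref" where
  "strict R v u \<longleftrightarrow> R v u \<and> \<not> R u v"

definition indiff :: "('w, 's) pref \<Rightarrow> ('w, 's) pref" where
  "indiff R v u \<longleftrightarrow> R v u \<and> R u v"

text \<open>\<open>section_pref W P R v u w\<close> is $\tilde v^w \succeq \tilde u^w$.  Under \<open>A1\<close> and \<open>A2\<close> the choice
  of the representatives \<open>a\<close>, \<open>b\<close> is immaterial.\<close>

definition section_pref ::
  "'w measure \<Rightarrow> 's measure \<Rightarrow> ('w, 's) pref \<Rightarrow> ('w, 's) act \<Rightarrow> ('w, 's) act \<Rightarrow> 'w \<Rightarrow> bool" where
  "section_pref W P R v u w \<longleftrightarrow>
     (\<exists>a\<in>V0 W P. \<exists>b\<in>V0 W P. FV W P a = F P v w \<and> FV W P b = F P u w \<and> R a b)"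

definition ce :: "('w, 's) pref \<Rightarrow> ('w, 's) act \<Rightarrow> real" where
  "ce R v = (THE m. indiff R (const m) v)"

definition essential :: "'s measure \<Rightarrow> ('w, 's) pref \<Rightarrow> 's set \<Rightarrow> bool" where
  "essential P R E \<longleftrightarrow> E \<in> sets P \<and>
     (\<exists>t x. t > x \<and> strict R (const t) (bet t E x) \<and> strict R (bet t E x) (const x))"

definition sub :: "('w, 's) pref \<Rightarrow> ('w, 's) act \<Rightarrow> 's set \<Rightarrow> ('w, 's) act \<Rightarrow> ('w, 's) act" where
  "sub R v B u = (\<lambda>z. ce R (bet (v z) B (u z)))"

definition is_utility :: "(real \<Rightarrow> real) \<Rightarrow> bool" where
  "is_utility \<phi> \<longleftrightarrow> strict_mono \<phi> \<and> continuous_on UNIV \<phi>"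

text \<open>\<open>\<phi>\<close> is the utility index $\phi(t) = \mathcal{U}(t)$ of some biseparable representation
  $\mathcal{U}$ of the preference on \<open>V0\<close>.\<close>

definition biseparable_utility ::
  "'w measure \<Rightarrow> 's measure \<Rightarrow> ('w, 's) pref \<Rightarrow> (real \<Rightarrow> real) \<Rightarrow> bool" where
  "biseparable_utility W P R \<phi> \<longleftrightarrow>
     is_utility \<phi> \<and>
     (\<exists>(U :: ('w, 's) act \<Rightarrow> real) (\<rho> :: real \<Rightarrow> real).
        (\<forall>v\<in>V0 W P. \<forall>u\<in>V0 W P. R v u \<longleftrightarrow> U v \<ge> U u) \<and>
        (\<forall>t. \<phi> t = U (const t)) \<and>
        \<rho> ` {0..1} \<subseteq> {0..1} \<and>
        \<not> (\<forall>p\<in>{0<..<1}. \<rho> p = 0) \<and> \<not> (\<forall>p\<in>{0<..<1}. \<rho> p = 1) \<and>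
        (\<forall>t x. \<forall>A\<in>sets P. t \<ge> x \<longrightarrow>
           U (bet t A x) = \<phi> t * \<rho> (measure P A) + \<phi> x * (1 - \<rho> (measure P A))))"

text \<open>\<open>is_mix W P \<phi> \<alpha> v u r\<close> and \<open>is_sum W P \<phi> v u r\<close> say that \<open>r\<close> is
  $\alpha v \oplus (1-\alpha) u$ and $v \oplus u$, respectively; the latter need not exist.\<close>

definition is_mix ::
  "'w measure \<Rightarrow> 's measure \<Rightarrow> (real \<Rightarrow> real) \<Rightarrow> real \<Rightarrow> ('w, 's) act \<Rightarrow> ('w, 's) act \<Rightarrow> ('w, 's) act \<Rightarrow> bool"
  where
  "is_mix W P \<phi> \<alpha> v u r \<longleftrightarrow> r \<in> tV0 W P \<and>
     (\<forall>z\<in>space (W \<Otimes>\<^sub>M P). \<phi> (r z) = \<alpha> * \<phi> (v z) + (1 - \<alpha>) * \<phi> (u z))"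

definition is_sum ::
  "'w measure \<Rightarrow> 's measure \<Rightarrow> (real \<Rightarrow> real) \<Rightarrow> ('w, 's) act \<Rightarrow> ('w, 's) act \<Rightarrow> ('w, 's) act \<Rightarrow> bool"
  where
  "is_sum W P \<phi> v u r \<longleftrightarrow> r \<in> tV0 W P \<and>
     (\<forall>z\<in>space (W \<Otimes>\<^sub>M P). 1/2 * \<phi> (r z) + 1/2 * \<phi> 0 = 1/2 * \<phi> (v z) + 1/2 * \<phi> (u z))"

subsection \<open>Axioms\<close>

definition A1 :: "'w measure \<Rightarrow> 's measure \<Rightarrow> ('w, 's) pref \<Rightarrow> bool" where
  "A1 W P R \<longleftrightarrow>
     (\<forall>v\<in>tV0 W P. \<forall>u\<in>tV0 W P. R v u \<or> R u v) \<and>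
     (\<forall>v\<in>tV0 W P. \<forall>u\<in>tV0 W P. \<forall>r\<in>tV0 W P. R v u \<longrightarrow> R u r \<longrightarrow> R v r)"

definition A2 :: "'w measure \<Rightarrow> 's measure \<Rightarrow> ('w, 's) pref \<Rightarrow> bool" where
  "A2 W P R \<longleftrightarrow>
     (\<forall>v\<in>tV0 W P. \<forall>u\<in>tV0 W P. (\<forall>w\<in>space W. F P v w = F P u w) \<longrightarrow> indiff R v u)"

definition uniformly_bounded ::
  "'w measure \<Rightarrow> 's measure \<Rightarrow> (nat \<Rightarrow> ('w, 's) act) \<Rightarrow> bool" where
  "uniformly_bounded W P X \<longleftrightarrow> (\<exists>b. \<forall>n. \<forall>z\<in>space (W \<Otimes>\<^sub>M P). \<bar>X n z\<bar> \<le> b)"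

definition conv_in_distr ::
  "'w measure \<Rightarrow> 's measure \<Rightarrow> (nat \<Rightarrow> ('w, 's) act) \<Rightarrow> ('w, 's) act \<Rightarrow> bool" where
  "conv_in_distr W P X v \<longleftrightarrow> weak_conv (\<lambda>n. FV W P (X n)) (FV W P v)"

definition A3 :: "'w measure \<Rightarrow> 's measure \<Rightarrow> ('w, 's) pref \<Rightarrow> bool" where
  "A3 W P R \<longleftrightarrow>
     (\<forall>v\<in>V0 W P. \<forall>u\<in>V0 W P. \<forall>vn un.
        strict R v u \<longrightarrow> range vn \<subseteq> V0 W P \<longrightarrow> range un \<subseteq> V0 W P \<longrightarrow>
        uniformly_bounded W P vn \<longrightarrow> uniformly_bounded W P un \<longrightarrow>
        conv_in_distr W P vn v \<longrightarrow> conv_in_distr W P un u \<longrightarrow>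
        (\<exists>N. \<forall>n\<ge>N. strict R (vn n) u \<and> strict R v (un n))) \<and>
     (\<forall>v\<in>tV0 W P. open {m. strict R (const m) v} \<and> open {m. strict R v (const m)})"

definition A4 :: "'w measure \<Rightarrow> 's measure \<Rightarrow> ('w, 's) pref \<Rightarrow> bool" where
  "A4 W P R \<longleftrightarrow>
     (\<forall>v\<in>V0 W P. \<forall>u\<in>V0 W P. (\<forall>t. FV W P v t \<le> FV W P u t) \<longrightarrow>
        R v u \<and> ((\<exists>t. FV W P v t < FV W P u t) \<longrightarrow> strict R v u))"

definition A5 :: "'w measure \<Rightarrow> 's measure \<Rightarrow> ('w, 's) pref \<Rightarrow> bool" where
  "A5 W P R \<longleftrightarrow>
     (\<forall>v\<in>tV0 W P. \<forall>u\<in>tV0 W P. (\<forall>w\<in>space W. section_pref W P R v u w) \<longrightarrow> R v u)"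

text \<open>Under \<open>A1\<close>--\<open>A4\<close> and \<open>A8\<close> a biseparable utility exists and is unique up to positive
  affine transformations.  The operation $\oplus$ does not change when \<open>\<phi>\<close> undergoes such a
  transformation, so that quantifying over all biseparable utilities in \<open>A6\<close> and \<open>A7\<close> amounts
  to fixing one.\<close>

definition A6 :: "'w measure \<Rightarrow> 's measure \<Rightarrow> ('w, 's) pref \<Rightarrow> bool" where
  "A6 W P R \<longleftrightarrow>
     (\<forall>\<phi>. biseparable_utility W P R \<phi> \<longrightarrow>
        (\<forall>v\<in>V0' W P. \<forall>u\<in>V0' W P. \<forall>\<alpha>\<in>{0<..<1}. \<forall>r.
           indiff R v u \<longrightarrow> is_mix W P \<phi> \<alpha> v u r \<longrightarrow> R r v))"

definition A7 :: "'w measure \<Rightarrow> 's measure \<Rightarrow> ('w, 's) pref \<Rightarrow> bool" where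
  "A7 W P R \<longleftrightarrow>
     (\<forall>\<phi>. biseparable_utility W P R \<phi> \<longrightarrow>
        (\<forall>v\<in>tV0 W P. \<forall>u\<in>tV0 W P. \<forall>r\<in>V0 W P. \<forall>vr ur.
           comonotonic W P v r \<longrightarrow> comonotonic W P u r \<longrightarrow> R v u \<longrightarrow>
           is_sum W P \<phi> v r vr \<longrightarrow> is_sum W P \<phi> u r ur \<longrightarrow> R vr ur))"

definition A8 :: "'w measure \<Rightarrow> 's measure \<Rightarrow> ('w, 's) pref \<Rightarrow> bool" where
  "A8 W P R \<longleftrightarrow>
     (\<forall>A B x y x' y' x'' y''. \<forall>v u r.
        essential P R A \<longrightarrow> B \<in> sets P \<longrightarrow>
        v = bet x A y \<longrightarrow> u = bet x' A y' \<longrightarrow> r = bet x'' A y'' \<longrightarrow>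
        comonotonic W P v u \<longrightarrow> comonotonic W P v r \<longrightarrow> comonotonic W P u r \<longrightarrow>
        (x \<ge> x'' \<and> x' \<ge> x'' \<and> y \<ge> y'' \<and> y' \<ge> y'') \<or>
        (x'' \<ge> x \<and> x'' \<ge> x' \<and> y'' \<ge> y \<and> y'' \<ge> y') \<longrightarrow>
        R v u \<longrightarrow> R (sub R v B r) (sub R u B r))"

definition satisfies_axioms :: "'w measure \<Rightarrow> 's measure \<Rightarrow> ('w, 's) pref \<Rightarrow> bool" where
  "satisfies_axioms W P R \<longleftrightarrow>
     A1 W P R \<and> A2 W P R \<and> A3 W P R \<and> A4 W P R \<and> A5 W P R \<and> A6 W P R \<and> A7 W P R \<and> A8 W P R"

definition more_ambiguity_averse ::
  "'w measure \<Rightarrow> 's measure \<Rightarrow> ('w, 's) pref \<Rightarrow> ('w, 's) pref \<Rightarrow> bool" where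
  "more_ambiguity_averse W P R R' \<longleftrightarrow> (\<forall>v\<in>tV0 W P. \<forall>u\<in>V0 W P. R v u \<longrightarrow> R' v u)"

subsection \<open>Finitely additive probabilities\<close>

text \<open>Set functions are normalised to vanish outside \<open>sets W\<close>, so that elements of \<open>\<Delta>\<close> are
  determined by their values on \<open>sets W\<close>.\<close>

definition \<Delta> :: "'w measure \<Rightarrow> ('w set \<Rightarrow> real) set" where
  "\<Delta> W = {Q. (\<forall>A. A \<notin> sets W \<longrightarrow> Q A = 0) \<and> (\<forall>A\<in>sets W. Q A \<ge> 0) \<and> Q (space W) = 1 \<and>
     (\<forall>A\<in>sets W. \<forall>B\<in>sets W. A \<inter> B = {} \<longrightarrow> Q (A \<union> B) = Q A + Q B)}"

definition fa_simple_integral :: "'w measure \<Rightarrow> ('w set \<Rightarrow> real) \<Rightarrow> ('w \<Rightarrow> real) \<Rightarrow> real" where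
  "fa_simple_integral W Q g = (\<Sum>y\<in>g ` space W. y * Q (g -` {y} \<inter> space W))"

text \<open>The integral $\mathbb{E}_Q[f]$ of a bounded measurable \<open>f\<close>; for such \<open>f\<close> the lower integral
  below equals the corresponding upper integral, by uniform approximation with simple functions.\<close>

definition fa_integral :: "'w measure \<Rightarrow> ('w set \<Rightarrow> real) \<Rightarrow> ('w \<Rightarrow> real) \<Rightarrow> real" where
  "fa_integral W Q f =
     (SUP g\<in>{g. simple_function W g \<and> (\<forall>w\<in>space W. g w \<le> f w)}. fa_simple_integral W Q g)"

definition weak_star :: "'w measure \<Rightarrow> ('w set \<Rightarrow> real) topology" where
  "weak_star W = topology_generated_by
     {{Q \<in> \<Delta> W. fa_integral W Q f \<in> T} | f T.
        f \<in> borel_measurable W \<and> bounded (f ` space W) \<and> open T}"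

subsection \<open>Representation\<close>

text \<open>\<open>choquet P \<psi> x\<close> is $\int x \,\mathrm{d}\nu_\psi$ for a bounded random variable \<open>x\<close> on \<open>P\<close>.\<close>

definition choquet :: "'s measure \<Rightarrow> (real \<Rightarrow> real) \<Rightarrow> ('s \<Rightarrow> real) \<Rightarrow> real" where
  "choquet P \<psi> x =
     (LINT t:{..0}|lborel. \<psi> (1 - rv_cdf P x t) - 1) + (LINT t:{0..}|lborel. \<psi> (1 - rv_cdf P x t))"

definition is_distortion :: "(real \<Rightarrow> real) \<Rightarrow> bool" where
  "is_distortion \<psi> \<longleftrightarrow> \<psi> ` {0..1} \<subseteq> {0..1} \<and> \<not> \<psi> constant_on {0..1} \<and> mono_on {0..1} \<psi> \<and>
     continuous_on {0..1} \<psi> \<and> \<psi> 0 = 0 \<and> \<psi> 1 = 1"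

definition grounded :: "'w measure \<Rightarrow> (('w set \<Rightarrow> real) \<Rightarrow> ereal) \<Rightarrow> bool" where
  "grounded W c \<longleftrightarrow> (\<forall>Q\<in>\<Delta> W. c Q \<ge> 0) \<and> (\<exists>Q\<in>\<Delta> W. c Q = 0)"

definition is_penalty :: "'w measure \<Rightarrow> (('w set \<Rightarrow> real) \<Rightarrow> ereal) \<Rightarrow> bool" where
  "is_penalty W c \<longleftrightarrow>
     grounded W c \<and>
     (\<forall>Q\<in>\<Delta> W. \<forall>Q'\<in>\<Delta> W. \<forall>\<alpha>\<in>{0..1::real}.
        c (\<lambda>A. \<alpha> * Q A + (1 - \<alpha>) * Q' A) \<le> ereal \<alpha> * c Q + ereal (1 - \<alpha>) * c Q') \<and>
     (\<forall>a. closedin (weak_star W) {Q \<in> \<Delta> W. c Q \<le> a})"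

definition objective ::
  "'w measure \<Rightarrow> 's measure \<Rightarrow> (real \<Rightarrow> real) \<Rightarrow> (real \<Rightarrow> real) \<Rightarrow> (('w set \<Rightarrow> real) \<Rightarrow> ereal) \<Rightarrow>
   ('w, 's) act \<Rightarrow> ('w set \<Rightarrow> real) \<Rightarrow> ereal" where
  "objective W P \<phi> \<psi> c v Q =
     ereal (fa_integral W Q (\<lambda>w. choquet P \<psi> (\<lambda>s. \<phi> (v (w, s))))) + c Q"

text \<open>\<open>U v\<close> is the minimum of \<open>objective W P \<phi> \<psi> c v\<close> over \<open>\<Delta> W\<close>, and in particular attained.\<close>

definition represented_by ::
  "'w measure \<Rightarrow> 's measure \<Rightarrow> ('w, 's) pref \<Rightarrow>
   (real \<Rightarrow> real) \<Rightarrow> (real \<Rightarrow> real) \<Rightarrow> (('w set \<Rightarrow> real) \<Rightarrow> ereal) \<Rightarrow> bool" where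
  "represented_by W P R \<phi> \<psi> c \<longleftrightarrow>
     is_utility \<phi> \<and> is_distortion \<psi> \<and> is_penalty W c \<and>
     (\<exists>U :: ('w, 's) act \<Rightarrow> ereal.
        (\<forall>v\<in>tV0 W P. (\<exists>Q\<in>\<Delta> W. U v = objective W P \<phi> \<psi> c v Q) \<and>
                       (\<forall>Q\<in>\<Delta> W. U v \<le> objective W P \<phi> \<psi> c v Q)) \<and>
        (\<forall>v\<in>tV0 W P. \<forall>u\<in>tV0 W P. R v u \<longleftrightarrow> U v \<ge> U u))"

end

theory Submission
  imports Defs
begin

text \<open>
  Both relations are represented by the same construction, so the point is to carry it out.  On
  two-valued risky acts, axiom \<open>A8\<close> makes the certainty equivalents $M_p(x,y)$, $x \ge y$, bisymmetric
  jointly in all winning probabilities.  For fixed \<open>q\<close> the compound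
  $M_q(M_q(1,u),M_q(v,0))$ is then symmetric in \<open>u\<close> and \<open>v\<close>; the mean it induces is
  one of the $M_p$, satisfies full bisymmetry, and Aczel's dyadic construction gives a
  utility that turns every $M_p$ into a weighted average.  In utility units, \<open>A7\<close> makes the certainty equivalent
  additive on comonotonic risky acts, hence a Choquet integral, and translation invariant on
  ambiguous acts, while \<open>A6\<close> makes it quasi-concave there, hence concave by a local argument.
  A Hahn--Banach supergradient yields the finitely additive measures, and
  $c(Q) = \sup_f (I(f) - E_Q f)$.

  If one relation is more ambiguity averse than the other, they agree on risk, so that
  \<open>\<phi>\<close> and \<open>\<psi>\<close> coincide, and $I \le I^*$ gives $c \le c^*$.  Conversely, groundedness
  makes the value of a risky act independent of the penalty.
\<close>

section \<open>Bisymmetric families of means\<close>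

text \<open>Three obstacles shape the proof. Axiom \<open>A8\<close> concerns comonotonic bets only,
  so bisymmetry is available just for \<open>y \<le> x\<close>, and the classical theory of
  bisymmetric means, which works with a two-sided operation, does not apply directly. The range of
  the utility may be a bounded interval, so a sum of utilities need not be a utility: additivity is
  therefore obtained for halves, f/2 + g/2, and a translation that is too large is cut into small
  ones. Finally, an act with finitely many values can still have sections with infinitely many
  different laws, so its state-wise value is bounded and measurable but in general not simple; the
  functional on ambiguous acts, which lives on simple functions, has to be extended before it can be
  compared with the value of a general act.

  For the comparison it matters that the construction is canonical: the events depend on
  \<open>P\<close> only, and utility and weights only on the certainty equivalents of bets.
  Relations that agree on bets therefore share them literally, and no affine normalisation has to be
  matched.\<close>

definition dyadic :: "nat \<Rightarrow> nat \<Rightarrow> real" where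
  "dyadic n j = real j / 2 ^ n"

lemma dyadic_between:
  assumes "0 \<le> a" "a < b" "b \<le> 1"
  obtains n j where "j \<le> 2 ^ n" "a < dyadic n j" "dyadic n j < b"
proof -
  obtain n where n: "(1/2) ^ n < b - a"
    using real_arch_pow_inv[of "b - a" "1/2"] assms by auto
  define j where "j = nat \<lfloor>a * 2 ^ n\<rfloor> + 1"
  have j: "real j = of_int \<lfloor>a * 2 ^ n\<rfloor> + 1" unfolding j_def using assms by simp
  have "a * 2 ^ n < real j" "real j \<le> a * 2 ^ n + 1" unfolding j by linarith+
  moreover have "a * 2 ^ n + 1 < b * 2 ^ n" using n by (simp add: field_simps)
  ultimately have *: "a * 2 ^ n < real j" "real j < b * 2 ^ n" by simp_all
  have "b * 2 ^ n \<le> 2 ^ n" using assms by simp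
  then have "real j \<le> 2 ^ n" using * by linarith
  then have "j \<le> 2 ^ n" by simp
  moreover have "a < dyadic n j" "dyadic n j < b"
    unfolding dyadic_def using * by (simp_all add: field_simps)
  ultimately show ?thesis using that by blast
qed

lemma eqI_dyadic_bound:
  assumes "\<And>n. \<bar>a - b\<bar> \<le> C / 2 ^ n"
  shows "a = (b::real)"
proof (rule ccontr)
  assume "a \<noteq> b"
  have "(\<lambda>n. C * (1/2) ^ n) \<longlonglongrightarrow> C * 0" by (intro tendsto_intros LIMSEQ_realpow_zero) auto
  then have "(\<lambda>n. C / 2 ^ n) \<longlonglongrightarrow> 0" by (simp add: power_one_over field_simps)
  then have "\<bar>a - b\<bar> \<le> 0" using assms by (intro LIMSEQ_le_const) auto
  then show False using \<open>a \<noteq> b\<close> by simp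
qed

text \<open>\<open>M p x y\<close> stands for the certainty equivalent of winning \<open>x\<close>
  with probability \<open>p\<close> and \<open>y\<close> otherwise; it is controlled only where
  \<open>y \<le> x\<close>. The order hypotheses of \<open>bisym_interior\<close> place all six
  means occurring there in this half plane. Allowing two different probabilities ties the whole
  family to a single utility.\<close>

locale bisymmetric_family =
  fixes M :: "real \<Rightarrow> real \<Rightarrow> real \<Rightarrow> real"
  assumes idem: "p \<in> {0..1} \<Longrightarrow> M p x x = x"
    and strict_left: "0 < p \<Longrightarrow> p < 1 \<Longrightarrow> y \<le> x \<Longrightarrow> x < x' \<Longrightarrow> M p x y < M p x' y"
    and strict_right: "0 < p \<Longrightarrow> p < 1 \<Longrightarrow> y < y' \<Longrightarrow> y' \<le> x \<Longrightarrow> M p x y < M p x y'"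
    and strict_prob: "y < x \<Longrightarrow> 0 \<le> p \<Longrightarrow> p < q \<Longrightarrow> q \<le> 1 \<Longrightarrow> M p x y < M q x y"
    and prob_0: "y \<le> x \<Longrightarrow> M 0 x y = y"
    and prob_1: "y \<le> x \<Longrightarrow> M 1 x y = x"
    and cont_prob: "y \<le> x \<Longrightarrow> continuous_on {0..1} (\<lambda>p. M p x y)"
    and bisym_interior: "0 < p \<Longrightarrow> p < 1 \<Longrightarrow> 0 < q \<Longrightarrow> q < 1 \<Longrightarrow>
      z \<le> y \<Longrightarrow> y \<le> x \<Longrightarrow> z \<le> u \<Longrightarrow> u \<le> x \<Longrightarrow>
      M p (M q x u) (M q y z) = M q (M p x y) (M p u z)"
begin

lemma mono:
  assumes "p \<in> {0..1}" "y \<le> x" "x \<le> x'" "y \<le> y'" "y' \<le> x'"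
  shows "M p x y \<le> M p x' y'"
proof (cases "p = 0 \<or> p = 1")
  case True
  then show ?thesis using assms prob_0 prob_1 by auto
next
  case False
  then have p: "0 < p" "p < 1" using assms by auto
  \<comment> \<open>Raising the better prize first keeps the pair in the half plane;
    \<open>M p x y'\<close> might leave it.\<close>
  have "M p x y \<le> M p x' y"
    using strict_left[OF p, of y x x'] assms by (cases "x = x'") auto
  also have "\<dots> \<le> M p x' y'"
    using strict_right[OF p, of y y' x'] assms by (cases "y = y'") auto
  finally show ?thesis .
qed

lemma le_left: "p \<in> {0..1} \<Longrightarrow> y \<le> x \<Longrightarrow> M p x y \<le> x"
  using mono[of p y x x x] idem by simp

lemma ge_right: "p \<in> {0..1} \<Longrightarrow> y \<le> x \<Longrightarrow> y \<le> M p x y"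
  using mono[of p y y x y] idem by simp

lemma bisym:
  assumes "p \<in> {0..1}" "q \<in> {0..1}" "z \<le> y" "y \<le> x" "z \<le> u" "u \<le> x"
  shows "M p (M q x u) (M q y z) = M q (M p x y) (M p u z)"
proof (cases "p = 0 \<or> p = 1 \<or> q = 0 \<or> q = 1")
  case True
  have "M q y z \<le> M q x u" "M p u z \<le> M p x y"
    using assms mono by auto
  with True show ?thesis using assms prob_0 prob_1 by auto
next
  case False
  then show ?thesis using assms bisym_interior[of p q z y x u] by auto
qed

text \<open>Solvability in the probability takes the place of continuity in the prizes, which is not
  assumed and only emerges for the finished utility.\<close>

lemma attains:
  assumes "y \<le> c" "c \<le> x"
  obtains p where "p \<in> {0..1}" "M p x y = c"
proof -
  have "y \<le> x" using assms by simp
  then have "\<exists>p\<ge>0. p \<le> 1 \<and> M p x y = c"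
    using assms prob_0 prob_1 cont_prob by (intro IVT') auto
  then show ?thesis using that by auto
qed

lemma attains_interior:
  assumes "y < c" "c < x"
  obtains p where "0 < p" "p < 1" "M p x y = c"
proof -
  obtain p where p: "p \<in> {0..1}" "M p x y = c"
    using attains[of y c x] assms by auto
  have "p \<noteq> 0" "p \<noteq> 1" using p assms prob_0[of y x] prob_1[of y x] by auto
  then show ?thesis using that[of p] p by auto
qed

text \<open>By bisymmetry the following is symmetric in \<open>u\<close> and \<open>v\<close> although the family \<open>M\<close> itself is
  only considered on the half plane \<open>y \<le> x\<close>; this makes a genuine mean out of one-sided data.\<close>

definition cross :: "real \<Rightarrow> real \<Rightarrow> real" where
  "cross u v = M (1/2) (M (1/2) 1 u) (M (1/2) v 0)"

lemma cross_commute: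
  "u \<in> {0..1} \<Longrightarrow> v \<in> {0..1} \<Longrightarrow> cross u v = cross v u"
  unfolding cross_def by (rule bisym) auto

lemma cross_strict:
  assumes "u \<in> {0..1}" "v \<in> {0..1}" "u' \<in> {0..1}" "u < u'"
  shows "cross u v < cross u' v"
proof -
  have "M (1/2) 1 u < M (1/2) 1 u'" using assms by (intro strict_right) auto
  moreover have "M (1/2) v 0 \<le> M (1/2) 1 u" using assms by (intro mono) auto
  ultimately show ?thesis unfolding cross_def by (intro strict_left) auto
qed

lemma cross_strict2:
  "u \<in> {0..1} \<Longrightarrow> v \<in> {0..1} \<Longrightarrow> v' \<in> {0..1} \<Longrightarrow> v < v' \<Longrightarrow> cross u v < cross u v'"
  using cross_strict[of v u v'] cross_commute by metis

lemma cross_diag_strict: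
  "u \<in> {0..1} \<Longrightarrow> v \<in> {0..1} \<Longrightarrow> u < v \<Longrightarrow> cross u u < cross v v"
  using cross_strict[of u u v] cross_strict2[of v u v] by fastforce

lemma cross_diag_inj:
  "u \<in> {0..1} \<Longrightarrow> v \<in> {0..1} \<Longrightarrow> cross u u = cross v v \<Longrightarrow> u = v"
  using cross_diag_strict[of u v] cross_diag_strict[of v u] by (cases u v rule: linorder_cases) auto

lemma cross_mono:
  assumes "u \<in> {0..1}" "v \<in> {0..1}" "u' \<in> {0..1}" "v' \<in> {0..1}" "u \<le> u'" "v \<le> v'"
  shows "cross u v \<le> cross u' v'"
  using cross_strict[of u v u'] cross_strict2[of u' v v'] assms
  by (cases "u = u'"; cases "v = v'") auto

text \<open>Three uses of bisymmetry: in both inner means the constants 1 and 0 are carried along by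
  idempotence, and the outer mean then has four arguments in the required order.\<close>

lemma cross_hom:
  assumes "u \<in> {0..1}" "v \<in> {0..1}" "u' \<in> {0..1}" "v' \<in> {0..1}" "u' \<le> u" "v' \<le> v" "r \<in> {0..1}"
  shows "cross (M r u u') (M r v v') = M r (cross u v) (cross u' v')"
proof -
  let ?h = "1/2 :: real"
  have h: "?h \<in> {0..1}" by simp
  have 1: "M ?h 1 (M r u u') = M r (M ?h 1 u) (M ?h 1 u')"
    using bisym[OF h assms(7), of u' u 1 1] idem assms by simp
  have 2: "M ?h (M r v v') 0 = M r (M ?h v 0) (M ?h v' 0)"
    using bisym[OF h assms(7), of 0 0 v v'] idem assms by simp
  have "M ?h v' 0 \<le> M ?h v 0" "M ?h v 0 \<le> M ?h 1 u" "M ?h v' 0 \<le> M ?h 1 u'"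
    "M ?h 1 u' \<le> M ?h 1 u"
    using assms by (auto intro!: mono)
  then have "M ?h (M r (M ?h 1 u) (M ?h 1 u')) (M r (M ?h v 0) (M ?h v' 0))
      = M r (M ?h (M ?h 1 u) (M ?h v 0)) (M ?h (M ?h 1 u') (M ?h v' 0))"
    by (rule bisym[OF h assms(7)])
  then show ?thesis unfolding cross_def 1 2 .
qed

lemma M_unit: "p \<in> {0..1} \<Longrightarrow> x \<in> {0..1} \<Longrightarrow> y \<in> {0..1} \<Longrightarrow> y \<le> x \<Longrightarrow> M p x y \<in> {0..1}"
  using le_left[of p y x] ge_right[of p y x] by auto

section \<open>A symmetric mean on the unit interval\<close>

definition mid :: "real \<Rightarrow> real \<Rightarrow> real" where
  "mid u v = (THE z. z \<in> {0..1} \<and> cross z z = cross u v)"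

text \<open>\<open>cross\<close> is symmetric but not idempotent. Its diagonal is strictly
  increasing, and inverting it turns \<open>cross\<close> into a mean.\<close>

lemma mid:
  assumes "u \<in> {0..1}" "v \<in> {0..1}"
  shows mid_unit: "mid u v \<in> {0..1}" and cross_mid: "cross (mid u v) (mid u v) = cross u v"
proof -
  have "cross 0 0 \<le> cross u v" "cross u v \<le> cross 1 1"
    using assms by (auto intro!: cross_mono)
  \<comment> \<open>The level is reached by varying the probability between the extreme diagonal
    values; \<open>cross_hom\<close> then moves \<open>r\<close> inside and shows that it is
    attained on the diagonal, at \<open>M r 1 0\<close>.\<close>
  then obtain r where r: "r \<in> {0..1}" "M r (cross 1 1) (cross 0 0) = cross u v"
    using attains by metis
  have "cross (M r 1 0) (M r 1 0) = cross u v"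
    using cross_hom[of 1 1 0 0 r] r by simp
  moreover have "M r 1 0 \<in> {0..1}" using r by (intro M_unit) auto
  ultimately have "\<exists>!z. z \<in> {0..1} \<and> cross z z = cross u v"
    using cross_diag_inj by metis
  from theI'[OF this] show "mid u v \<in> {0..1}" "cross (mid u v) (mid u v) = cross u v"
    unfolding mid_def by auto
qed

lemma mid_eqI: "u \<in> {0..1} \<Longrightarrow> v \<in> {0..1} \<Longrightarrow> z \<in> {0..1} \<Longrightarrow> cross z z = cross u v \<Longrightarrow> mid u v = z"
  using cross_diag_inj mid by metis

lemma mid_commute: "u \<in> {0..1} \<Longrightarrow> v \<in> {0..1} \<Longrightarrow> mid u v = mid v u"
  using cross_commute unfolding mid_def by simp

lemma mid_idem: "u \<in> {0..1} \<Longrightarrow> mid u u = u"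
  by (rule mid_eqI) auto

lemma mid_strict:
  assumes "u \<in> {0..1}" "v \<in> {0..1}" "u' \<in> {0..1}" "u < u'"
  shows "mid u v < mid u' v"
proof (rule ccontr)
  assume "\<not> ?thesis"
  then have "cross (mid u' v) (mid u' v) \<le> cross (mid u v) (mid u v)"
    using assms by (intro cross_mono mid_unit) auto
  then show False using cross_strict[OF assms] cross_mid assms by simp
qed

lemma mid_mono:
  assumes "u \<in> {0..1}" "v \<in> {0..1}" "u' \<in> {0..1}" "v' \<in> {0..1}" "u \<le> u'" "v \<le> v'"
  shows "mid u v \<le> mid u' v'"
  using mid_strict[of u v u'] mid_strict[of v u' v'] mid_commute[of u' v] mid_commute[of u' v'] assms
  by (cases "u = u'"; cases "v = v'") auto

lemma mid_hom:
  assumes "u \<in> {0..1}" "v \<in> {0..1}" "u' \<in> {0..1}" "v' \<in> {0..1}" "u' \<le> u" "v' \<le> v" "r \<in> {0..1}"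
  shows "mid (M r u u') (M r v v') = M r (mid u v) (mid u' v')"
proof (rule mid_eqI)
  have le: "mid u' v' \<le> mid u v" using assms by (intro mid_mono) auto
  show "M r (mid u v) (mid u' v') \<in> {0..1}" using assms le by (intro M_unit mid_unit) auto
  show "cross (M r (mid u v) (mid u' v')) (M r (mid u v) (mid u' v')) = cross (M r u u') (M r v v')"
    using cross_hom[of "mid u v" "mid u v" "mid u' v'" "mid u' v'" r] cross_hom[of u v u' v' r]
      assms mid_unit cross_mid le by simp
qed (use assms M_unit in auto)

lemma mid_between_strict: "0 \<le> v \<Longrightarrow> v < u \<Longrightarrow> u \<le> 1 \<Longrightarrow> v < mid u v \<and> mid u v < u"
  using mid_strict[of v v u] mid_strict[of v u u] mid_idem mid_commute[of u v] by simp

text \<open>Both \<open>mid\<close> and \<open>M p\<close> commute with every \<open>M r\<close>. If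
  \<open>p\<close> is chosen so that they agree at (1, 0), they agree at (u, 0) because
  \<open>u = M r 1 0\<close> for some \<open>r\<close>, and then at (u, v) because
  \<open>v = M r u 0\<close> for some \<open>r\<close>.\<close>

lemma mid_eq_M:
  obtains p where "0 < p" "p < 1" "\<And>u v. 0 \<le> v \<Longrightarrow> v \<le> u \<Longrightarrow> u \<le> 1 \<Longrightarrow> mid u v = M p u v"
proof -
  obtain p where p: "0 < p" "p < 1" "M p 1 0 = mid 1 0"
    using attains_interior[of 0 "mid 1 0" 1] mid_between_strict[of 0 1] by auto
  have p': "p \<in> {0..1}" using p by simp
  have 0: "mid u 0 = M p u 0" if u: "u \<in> {0..1}" for u
  proof -
    obtain r where r: "r \<in> {0..1}" "M r 1 0 = u" using attains[of 0 u 1] u by auto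
    have "M p (M r 1 0) (M r 0 0) = M r (M p 1 0) (M p 0 0)"
      using bisym[OF p' r(1), of 0 0 1 0] by simp
    also have "\<dots> = M r (mid 1 0) (mid 0 0)" using p p' idem mid_idem by simp
    also have "\<dots> = mid (M r 1 0) (M r 0 0)" using mid_hom[of 1 0 0 0 r] r by simp
    finally show ?thesis using r idem by simp
  qed
  have "mid u v = M p u v" if uv: "0 \<le> v" "v \<le> u" "u \<le> 1" for u v
  proof -
    obtain r where r: "r \<in> {0..1}" "M r u 0 = v" using attains[of 0 v u] uv by auto
    have "M p (M r u u) (M r u 0) = M r (M p u u) (M p u 0)"
      using bisym[OF p' r(1), of 0 u u u] uv by simp
    also have "\<dots> = M r (mid u u) (mid u 0)" using 0 p' idem mid_idem uv by simp
    also have "\<dots> = mid (M r u u) (M r u 0)" using mid_hom[of u u u 0 r] r uv by simp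
    finally show ?thesis using r idem by simp
  qed
  with p show ?thesis using that by metis
qed

text \<open>By \<open>mid_eq_M\<close>, \<open>mid_hom\<close> is already bisymmetry when both pairs
  are ordered the same way. Since \<open>mid\<close> commutes, the remaining orders reduce to this
  one by rearranging the four entries; which rearrangement works depends on how \<open>v\<close>
  compares with \<open>u\<close> and \<open>v'\<close> with \<open>u'\<close>.\<close>

lemma mid_bisym:
  assumes "u \<in> {0..1}" "v \<in> {0..1}" "u' \<in> {0..1}" "v' \<in> {0..1}"
  shows "mid (mid u u') (mid v v') = mid (mid u v) (mid u' v')"
proof -
  obtain p where p: "0 < p" "p < 1" "\<And>u v. 0 \<le> v \<Longrightarrow> v \<le> u \<Longrightarrow> u \<le> 1 \<Longrightarrow> mid u v = M p u v"
    using mid_eq_M by metis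
  have *: "mid (mid u u') (mid v v') = mid (mid u v) (mid u' v')"
    if "u \<in> {0..1}" "v \<in> {0..1}" "u' \<in> {0..1}" "v' \<in> {0..1}" "u' \<le> u" "v' \<le> v" for u v u' v'
  proof -
    have "mid u' v' \<le> mid u v" using that by (intro mid_mono) auto
    then show ?thesis using mid_hom[of u v u' v' p] that p mid_unit[of u v] mid_unit[of u' v'] by simp
  qed
  have **: "mid (mid u u') (mid v v') = mid (mid u v) (mid u' v')"
    if "u \<in> {0..1}" "v \<in> {0..1}" "u' \<in> {0..1}" "v' \<in> {0..1}" "u' \<le> u" for u v u' v'
  proof (cases "v' \<le> v")
    case True
    then show ?thesis using * that by blast
  next
    case False
    show ?thesis
    proof (cases "v \<le> u")
      case vu: True
      show ?thesis
      proof (cases "v' \<le> u'")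
        case True
        then show ?thesis using *[of u u' v v'] vu that by simp
      next
        case False
        have 1: "mid (mid u u') (mid v v') = mid (mid u u') (mid v' v)"
          using that mid_commute by simp
        have 2: "\<dots> = mid (mid u v') (mid u' v)" using *[of u v' u' v] that \<open>\<not> v' \<le> v\<close> by simp
        have 3: "mid (mid u v) (mid u' v') = mid (mid u v) (mid v' u')"
          using that mid_commute by simp
        have 4: "\<dots> = mid (mid u v') (mid v u')"
          using *[of u v' v u'] that vu False by simp
        show ?thesis using 1 2 3 4 that mid_commute by simp
      qed
    next
      case vu: False
      have 1: "mid (mid u u') (mid v v') = mid (mid u u') (mid v' v)"
        using that mid_commute by simp
      have 2: "\<dots> = mid (mid u v') (mid u' v)" using *[of u v' u' v] that \<open>\<not> v' \<le> v\<close> by simp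
      have 3: "mid (mid u v) (mid u' v') = mid (mid v u) (mid v' u')"
        using that mid_commute by simp
      have 4: "\<dots> = mid (mid v v') (mid u u')"
        using *[of v v' u u'] that vu False by simp
      have 5: "\<dots> = mid (mid u u') (mid v v')"
        using that mid_commute mid_unit by simp
      show ?thesis using 3 4 5 by simp
    qed
  qed
  show ?thesis
    using **[of u v u' v'] **[of u' v' u v] assms mid_commute mid_unit
    by (cases "u' \<le> u") auto
qed


section \<open>Dyadic iteration of the mean\<close>

fun grid :: "nat \<Rightarrow> nat \<Rightarrow> real" where
  "grid 0 j = (if j = 0 then 0 else 1)"
| "grid (Suc n) j = mid (grid n (j div 2)) (grid n (Suc j div 2))"

lemma grid_unit: "grid n j \<in> {0..1}"
proof (induction n arbitrary: j)
  case (Suc n)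
  then show ?case by (metis grid.simps(2) mid_unit)
qed simp

text \<open>For an even index the two arguments of the defining \<open>mid\<close> coincide, so
  refining the grid keeps the old points.\<close>

lemma grid_double: "grid (Suc n) (2 * j) = grid n j"
  using grid_unit mid_idem by simp

lemma grid_double_power: "grid (n + d) (2 ^ d * j) = grid n j"
proof (induction d)
  case (Suc d)
  then show ?case using grid_double[of "n + d" "2 ^ d * j"] by (simp add: mult.assoc del: grid.simps)
qed simp

lemma grid_0: "grid n 0 = 0"
  using grid_double_power[of 0 n 0] by simp

lemma grid_top: "grid n (2 ^ n) = 1"
  using grid_double_power[of 0 n 1] by simp

text \<open>Bisymmetry pairs the halves of \<open>i\<close> and \<open>j\<close> crosswise, rounded
  down with rounded up; the two index sums are then the two halves of \<open>i + j\<close>. Pairing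
  them straight would fail for two odd indices, where the sums would differ by 2.\<close>

lemma mid_grid: "i \<le> 2 ^ n \<Longrightarrow> j \<le> 2 ^ n \<Longrightarrow> mid (grid n i) (grid n j) = grid (Suc n) (i + j)"
proof (induction n arbitrary: i j)
  case 0
  then have "i = 0 \<or> i = 1" "j = 0 \<or> j = 1" by auto
  then show ?case using mid_commute[of 0 1] by auto
next
  case (Suc n)
  have le: "i div 2 \<le> 2 ^ n" "j div 2 \<le> 2 ^ n" "Suc i div 2 \<le> 2 ^ n" "Suc j div 2 \<le> 2 ^ n"
    using Suc.prems by auto
  have "mid (grid (Suc n) i) (grid (Suc n) j)
      = mid (mid (grid n (i div 2)) (grid n (Suc i div 2))) (mid (grid n (Suc j div 2)) (grid n (j div 2)))"
    using mid_commute grid_unit by simp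
  also have "\<dots> = mid (mid (grid n (i div 2)) (grid n (Suc j div 2))) (mid (grid n (Suc i div 2)) (grid n (j div 2)))"
    using mid_bisym grid_unit by simp
  also have "\<dots> = mid (grid (Suc n) (i div 2 + Suc j div 2)) (grid (Suc n) (Suc i div 2 + j div 2))"
    by (simp only: Suc.IH le)
  also have "\<dots> = mid (grid (Suc n) ((i + j) div 2)) (grid (Suc n) (Suc (i + j) div 2))"
  proof -
    have "i div 2 + Suc j div 2 = (i + j) div 2 \<and> Suc i div 2 + j div 2 = Suc (i + j) div 2 \<or>
      i div 2 + Suc j div 2 = Suc (i + j) div 2 \<and> Suc i div 2 + j div 2 = (i + j) div 2"
      by (cases "even i"; cases "even j") (auto elim!: evenE oddE)
    then show ?thesis by (elim disjE conjE) (simp_all only: mid_commute[OF grid_unit grid_unit])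
  qed
  finally show ?case by (simp only: grid.simps(2)[of "Suc n"])
qed

lemma grid_step: "j < 2 ^ n \<Longrightarrow> grid n j < grid n (Suc j)"
proof (induction n arbitrary: j)
  case (Suc n)
  show ?case
  proof (cases "even j")
    case True
    then obtain i where i: "j = 2 * i" by auto
    have "grid n i < grid n (Suc i)" using Suc i by simp
    then show ?thesis
      using mid_strict[of "grid n i" "grid n i" "grid n (Suc i)"] i grid_unit mid_idem mid_commute
      by simp
  next
    case False
    then obtain i where i: "j = 2 * i + 1" using oddE by blast
    have "grid n i < grid n (Suc i)" using Suc i by simp
    then show ?thesis
      using mid_strict[of "grid n i" "grid n (Suc i)" "grid n (Suc i)"] i grid_unit mid_idem
      by simp
  qed
qed simp

lemma grid_strict: "i < j \<Longrightarrow> j \<le> 2 ^ n \<Longrightarrow> grid n i < grid n j"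
proof (induction j)
  case (Suc j)
  then show ?case using grid_step[of j n] by (cases "i = j") auto
qed simp

lemma grid_less_iff:
  assumes "i \<le> 2 ^ n" "j \<le> 2 ^ m"
  shows "grid n i < grid m j \<longleftrightarrow> dyadic n i < dyadic m j"
proof -
  have 1: "grid n i = grid (n + m) (2 ^ m * i)" "grid m j = grid (n + m) (2 ^ n * j)"
    using grid_double_power[of n m i] grid_double_power[of m n j] by (auto simp: add.commute)
  have 2: "2 ^ m * i \<le> 2 ^ (n + m)" "2 ^ n * j \<le> 2 ^ (n + m)"
    using assms by (auto simp: power_add mult.commute)
  have "grid n i < grid m j \<longleftrightarrow> 2 ^ m * i < 2 ^ n * j"
    unfolding 1 using grid_strict[of "2 ^ m * i" "2 ^ n * j"] grid_strict[of "2 ^ n * j" "2 ^ m * i"] 2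
    by (metis less_asym linorder_neqE_nat)
  also have "\<dots> \<longleftrightarrow> real (2 ^ m * i) < real (2 ^ n * j)" by (rule of_nat_less_iff[symmetric])
  also have "\<dots> \<longleftrightarrow> dyadic n i < dyadic m j"
    unfolding dyadic_def by (simp add: field_simps)
  finally show ?thesis .
qed

lemma grid_le_iff:
  "i \<le> 2 ^ n \<Longrightarrow> j \<le> 2 ^ m \<Longrightarrow> grid n i \<le> grid m j \<longleftrightarrow> dyadic n i \<le> dyadic m j"
  using grid_less_iff[of j m i n] by (meson linorder_not_less)

section \<open>Density of the grid points\<close>

definition points :: "real set" where
  "points = {grid n j | n j. j \<le> 2 ^ n}"

lemma points_unit: "d \<in> points \<Longrightarrow> d \<in> {0..1}"
  unfolding points_def using grid_unit by auto

lemma points_mid: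
  assumes "d \<in> points" "e \<in> points"
  shows "mid d e \<in> points"
proof -
  obtain n i m j where *: "d = grid n i" "i \<le> 2 ^ n" "e = grid m j" "j \<le> 2 ^ m"
    using assms unfolding points_def by auto
  have 1: "d = grid (n + m) (2 ^ m * i)" "e = grid (n + m) (2 ^ n * j)"
    using grid_double_power[of n m i] grid_double_power[of m n j] * by (auto simp: add.commute)
  have 2: "2 ^ m * i \<le> 2 ^ (n + m)" "2 ^ n * j \<le> 2 ^ (n + m)"
    using * by (auto simp: power_add mult.commute)
  have "mid d e = grid (Suc (n + m)) (2 ^ m * i + 2 ^ n * j)"
    unfolding 1 using mid_grid 2 by blast
  moreover have "2 ^ m * i + 2 ^ n * j \<le> 2 ^ Suc (n + m)" using 2 by simp
  ultimately show ?thesis unfolding points_def by blast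
qed

text \<open>A substitute for continuity of \<open>mid\<close> in its second argument. A value
  \<open>e\<close> just below \<open>mid u v\<close> has the form \<open>M r u (M p u 0)\<close>,
  which bisymmetry rewrites as \<open>M p u (M r u 0)\<close>, that is, as a midpoint with
  \<open>u\<close>. The maximum in the definition of \<open>e\<close> puts it into the range where
  such an \<open>r\<close> exists.\<close>

lemma mid_approx_left:
  assumes "0 \<le> v" "v < u" "u \<le> 1" "0 < v"
  obtains y where "0 \<le> y" "y < v" "v < mid u y"
proof -
  obtain p where p: "0 < p" "p < 1" "\<And>u v. 0 \<le> v \<Longrightarrow> v \<le> u \<Longrightarrow> u \<le> 1 \<Longrightarrow> mid u v = M p u v"
    using mid_eq_M by metis
  define e where "e = (max v (mid u 0) + mid u v) / 2"
  have lt: "v < mid u v" "mid u 0 < mid u v"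
    using mid_between_strict[of v u] mid_strict[of 0 u v] mid_commute assms by auto
  then have e: "v < e" "mid u 0 < e" "e < mid u v" unfolding e_def by auto
  have p': "p \<in> {0..1}" using p by simp
  have "M p u 0 \<le> e" "e \<le> u" using e p(3)[of 0 u] mid_between_strict[of v u] assms by auto
  then obtain r where r: "r \<in> {0..1}" "M r u (M p u 0) = e" using attains by metis
  have "M p u (M r u 0) = M r u (M p u 0)"
    using bisym[OF p' r(1), of 0 u u u] idem[OF p'] idem[OF r(1)] assms by simp
  moreover have y: "0 \<le> M r u 0" "M r u 0 \<le> u" using r assms le_left ge_right by auto
  ultimately have me: "mid u (M r u 0) = e" using r p(3)[of "M r u 0" u] assms by simp
  have "M r u 0 < v"
  proof (rule ccontr)
    assume "\<not> ?thesis"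
    then have "mid u v \<le> mid u (M r u 0)" using y assms by (intro mid_mono) auto
    then show False using me e by simp
  qed
  then show ?thesis using that y me e by blast
qed

lemma mid_approx_right:
  assumes "0 \<le> v" "v < u" "u < 1"
  obtains x where "x \<le> 1" "u < x" "mid x v < u"
proof -
  obtain p where p: "0 < p" "p < 1" "\<And>u v. 0 \<le> v \<Longrightarrow> v \<le> u \<Longrightarrow> u \<le> 1 \<Longrightarrow> mid u v = M p u v"
    using mid_eq_M by metis
  define e where "e = (min u (mid 1 v) + mid u v) / 2"
  have lt: "mid u v < u" "mid u v < mid 1 v"
    using mid_between_strict[of v u] mid_strict[of u v 1] assms by auto
  then have e: "e < u" "e < mid 1 v" "mid u v < e" unfolding e_def by auto
  have p': "p \<in> {0..1}" using p by simp
  have "v \<le> e" "e \<le> M p 1 v" using e p(3)[of v 1] mid_between_strict[of v u] assms by auto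
  then obtain r where r: "r \<in> {0..1}" "M r (M p 1 v) v = e" using attains by metis
  have "M p (M r 1 v) v = M r (M p 1 v) v"
    using bisym[OF p' r(1), of v v 1 v] idem[OF p'] idem[OF r(1)] assms by simp
  moreover have x: "v \<le> M r 1 v" "M r 1 v \<le> 1" using r assms le_left ge_right by auto
  ultimately have me: "mid (M r 1 v) v = e" using r p(3)[of v "M r 1 v"] assms by simp
  have "u < M r 1 v"
  proof (rule ccontr)
    assume "\<not> ?thesis"
    then have "mid (M r 1 v) v \<le> mid u v" using x assms by (intro mid_mono) auto
    then show False using me e by simp
  qed
  then show ?thesis using that x me e by blast
qed

text \<open>A gap has end points \<open>l\<close> and \<open>u\<close>, which need not be grid
  points themselves. Grid points \<open>d\<close> and \<open>e\<close> close enough to them have a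
  midpoint strictly between \<open>l\<close> and \<open>u\<close>, and it is again a grid
  point.\<close>

lemma points_dense:
  assumes "0 \<le> x" "x < y" "y \<le> 1"
  obtains d where "d \<in> points" "x < d" "d < y"
proof -
  have "\<exists>d\<in>points. x < d \<and> d < y"
  proof (rule ccontr)
    assume no: "\<not> ?thesis"
    define l where "l = Sup {d \<in> points. d \<le> x}"
    define u where "u = Inf {d \<in> points. y \<le> d}"
    have "0 \<in> points" "1 \<in> points"
      unfolding points_def using grid_0[of 0] grid_top[of 0] by (force intro: exI[of _ "0::nat"])+
    then have ne: "{d \<in> points. d \<le> x} \<noteq> {}" "{d \<in> points. y \<le> d} \<noteq> {}" using assms by auto
    have bdd: "bdd_above {d \<in> points. d \<le> x}" "bdd_below {d \<in> points. y \<le> d}" by auto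
    have l: "d \<le> l" if "d \<in> points" "d \<le> x" for d
      unfolding l_def using that bdd by (intro cSup_upper) auto
    have u: "u \<le> d" if "d \<in> points" "y \<le> d" for d
      unfolding u_def using that bdd by (intro cInf_lower) auto
    have lx: "l \<le> x" unfolding l_def using ne by (intro cSup_least) auto
    have yu: "y \<le> u" unfolding u_def using ne by (intro cInf_greatest) auto
    have l0: "0 \<le> l" and u1: "u \<le> 1" using l[of 0] u[of 1] \<open>0 \<in> points\<close> \<open>1 \<in> points\<close> assms by auto
    have lu: "l < u" using lx yu assms by simp
    obtain d where d: "d \<in> points" "d \<le> x" "l < mid u d"
    proof (cases "l = 0")
      case True
      then show ?thesis using that[of 0] \<open>0 \<in> points\<close> assms mid_between_strict[of 0 u] lu u1 by auto
    next
      case False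
      then obtain z where z: "0 \<le> z" "z < l" "l < mid u z"
        using mid_approx_left[of l u] l0 lu u1 by auto
      then obtain d where d: "d \<in> points" "d \<le> x" "z < d"
        using less_cSupE[of z "{d \<in> points. d \<le> x}"] ne unfolding l_def by auto
      then have "mid u z \<le> mid u d" using z u1 lu l0 points_unit[OF d(1)] by (intro mid_mono) auto
      then show ?thesis using that[of d] d z by auto
    qed
    obtain e where e: "e \<in> points" "y \<le> e" "mid e l < u"
    proof (cases "u = 1")
      case True
      then show ?thesis using that[of 1] \<open>1 \<in> points\<close> assms mid_between_strict[of l 1] lu l0 by auto
    next
      case False
      then obtain z where z: "z \<le> 1" "u < z" "mid z l < u"
        using mid_approx_right[of l u] l0 lu u1 by auto
      then obtain e where e: "e \<in> points" "y \<le> e" "e < z"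
        using cInf_lessD[of "{d \<in> points. y \<le> d}" z] ne unfolding u_def by auto
      then have "mid e l \<le> mid z l" using z u1 lu l0 points_unit[OF e(1)] by (intro mid_mono) auto
      then show ?thesis using that[of e] e z by auto
    qed
    have "mid u d \<le> mid e d" "mid e d \<le> mid e l"
      using d e l[of d] u[of e] l0 u1 lu points_unit by (auto intro!: mid_mono)
    then have "l < mid e d" "mid e d < u" using d e by auto
    moreover have "mid e d \<in> points" using points_mid d e by blast
    ultimately show False using no l[of "mid e d"] u[of "mid e d"]
      by (meson leD le_less_linear)
  qed
  then show ?thesis using that by blast
qed

section \<open>A utility on the unit interval\<close>

definition util01 :: "real \<Rightarrow> real" where
  "util01 x = Sup {dyadic n j | n j. j \<le> 2 ^ n \<and> grid n j \<le> x}"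

lemma util01_bdd: "bdd_above {dyadic n j | n j. j \<le> 2 ^ n \<and> grid n j \<le> x}"
proof (rule bdd_aboveI[of _ 1])
  fix t assume "t \<in> {dyadic n j | n j. j \<le> 2 ^ n \<and> grid n j \<le> x}"
  then obtain n j where "t = dyadic n j" "j \<le> 2 ^ n" by auto
  moreover have "real j \<le> 2 ^ n" using \<open>j \<le> 2 ^ n\<close> by (metis of_nat_le_iff of_nat_numeral of_nat_power)
  ultimately show "t \<le> 1" unfolding dyadic_def by simp
qed

lemma util01_ne: "0 \<le> x \<Longrightarrow> {dyadic n j | n j. j \<le> 2 ^ n \<and> grid n j \<le> x} \<noteq> {}"
proof -
  assume "0 \<le> x"
  then have "dyadic 0 0 \<in> {dyadic n j | n j. j \<le> 2 ^ n \<and> grid n j \<le> x}"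
    by (intro CollectI exI[of _ "0::nat"]) simp
  then show ?thesis by blast
qed

lemma util01_ge: "j \<le> 2 ^ n \<Longrightarrow> grid n j \<le> x \<Longrightarrow> dyadic n j \<le> util01 x"
  unfolding util01_def using util01_bdd by (intro cSup_upper) auto

lemma util01_le:
  assumes "j \<le> 2 ^ n" "0 \<le> x" "x \<le> grid n j"
  shows "util01 x \<le> dyadic n j"
  unfolding util01_def
proof (rule cSup_least)
  show "{dyadic n j | n j. j \<le> 2 ^ n \<and> grid n j \<le> x} \<noteq> {}" using assms(2) by (rule util01_ne)
  fix t assume "t \<in> {dyadic n j | n j. j \<le> 2 ^ n \<and> grid n j \<le> x}"
  then obtain m i where "t = dyadic m i" "i \<le> 2 ^ m" "grid m i \<le> x" by auto
  then show "t \<le> dyadic n j" using grid_le_iff[of i m j n] assms by auto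
qed

lemma util01_grid: "j \<le> 2 ^ n \<Longrightarrow> util01 (grid n j) = dyadic n j"
  using util01_ge[of j n "grid n j"] util01_le[of j n "grid n j"] grid_unit[of n j] by auto

lemma util01_0: "util01 0 = 0" and util01_1: "util01 1 = 1"
  using util01_grid[of 0 0] util01_grid[of 1 0] by (auto simp: dyadic_def)

lemma util01_mono: "0 \<le> x \<Longrightarrow> x \<le> y \<Longrightarrow> util01 x \<le> util01 y"
  unfolding util01_def[of x]
proof (rule cSup_least)
  assume "0 \<le> x" "x \<le> y"
  show "{dyadic n j | n j. j \<le> 2 ^ n \<and> grid n j \<le> x} \<noteq> {}" using \<open>0 \<le> x\<close> by (rule util01_ne)
  fix t assume "t \<in> {dyadic n j | n j. j \<le> 2 ^ n \<and> grid n j \<le> x}"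
  then show "t \<le> util01 y" using util01_ge \<open>x \<le> y\<close> by auto
qed

lemma util01_strict:
  assumes "0 \<le> x" "x < y" "y \<le> 1"
  shows "util01 x < util01 y"
proof -
  obtain d where d: "d \<in> points" "x < d" "d < y" using points_dense assms by metis
  \<comment> \<open>One point would give only a weak inequality; two separate the values, since the
    grid is ordered like the dyadic numbers.\<close>
  obtain e where e: "e \<in> points" "d < e" "e < y" using points_dense[of d y] d assms by auto
  obtain n j m i where *: "d = grid n j" "j \<le> 2 ^ n" "e = grid m i" "i \<le> 2 ^ m"
    using d e unfolding points_def by auto
  have "util01 x \<le> util01 d" "util01 e \<le> util01 y" using d e assms by (auto intro: util01_mono)
  moreover have "util01 d < util01 e" using * e grid_less_iff[of j n i m] util01_grid by simp
  ultimately show ?thesis by simp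
qed

lemma util01_unit: "x \<in> {0..1} \<Longrightarrow> util01 x \<in> {0..1}"
  using util01_mono[of 0 x] util01_mono[of x 1] util01_0 util01_1 by auto

lemma util01_onto:
  assumes "t \<in> {0..1}"
  obtains x where "x \<in> {0..1}" "util01 x = t"
proof -
  define A where "A = {grid n j | n j. j \<le> 2 ^ n \<and> dyadic n j \<le> t}"
  define x where "x = Sup A"
  have A0: "0 \<in> A" unfolding A_def using assms by (intro CollectI exI[of _ "0::nat"]) (simp add: dyadic_def)
  have A1: "a \<le> 1" if "a \<in> A" for a using that grid_unit unfolding A_def by auto
  then have bdd: "bdd_above A" by (rule bdd_aboveI)
  have x: "x \<in> {0..1}" unfolding x_def
    using cSup_upper[OF A0 bdd] cSup_least[of A 1] A0 A1 by auto
  have "util01 x = t"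
  proof (rule antisym; rule ccontr)
    assume "\<not> util01 x \<le> t"
    then have lt: "0 \<le> t" "t < util01 x" "util01 x \<le> 1" using assms util01_unit[OF x] by auto
    obtain n j where nj: "j \<le> 2 ^ n" "t < dyadic n j" "dyadic n j < util01 x"
      using dyadic_between[OF lt] by blast
    have "a \<le> grid n j" if a: "a \<in> A" for a
    proof -
      obtain m i where "a = grid m i" "i \<le> 2 ^ m" "dyadic m i \<le> t" using a unfolding A_def by blast
      then show ?thesis using nj grid_le_iff[of i m j n] by simp
    qed
    then have "x \<le> grid n j" unfolding x_def using A0 by (intro cSup_least) auto
    then show False using util01_le[of j n x] nj x by simp
  next
    assume "\<not> t \<le> util01 x"
    then have lt: "0 \<le> util01 x" "util01 x < t" "t \<le> 1" using assms util01_unit[OF x] by auto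
    obtain n j where nj: "j \<le> 2 ^ n" "util01 x < dyadic n j" "dyadic n j < t"
      using dyadic_between[OF lt] by blast
    have "grid n j \<in> A" unfolding A_def using nj by (intro CollectI exI[of _ n] exI[of _ j]) simp
    then have "grid n j \<le> x" unfolding x_def using bdd by (rule cSup_upper)
    then show False using util01_ge[of j n x] nj by simp
  qed
  then show ?thesis using that x by blast
qed

lemma grid_bracket:
  assumes "x \<in> {0..1}"
  obtains j where "j < 2 ^ n" "grid n j \<le> x" "x \<le> grid n (Suc j)"
proof (cases "x = 1")
  case True
  then show ?thesis using that[of "2 ^ n - 1"] grid_top[of n] grid_unit[of n "2 ^ n - 1"] by auto
next
  case False
  have "\<exists>j<2 ^ n. (\<forall>i\<le>j. grid n i \<le> x) \<and> \<not> grid n (Suc j) \<le> x"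
    using ex_least_nat_less[of "\<lambda>j. \<not> grid n j \<le> x" "2 ^ n"] grid_0 grid_top assms False by auto
  then show ?thesis using that by (meson le_cases order_refl)
qed

text \<open>Neighbouring points of level \<open>n\<close> around \<open>u\<close> and around
  \<open>v\<close> enclose \<open>mid u v\<close> between points of level \<open>n + 1\<close> that
  are two steps apart, which leaves a defect of at most 1/2^n.\<close>

lemma util01_mid:
  assumes "u \<in> {0..1}" "v \<in> {0..1}"
  shows "util01 (mid u v) = (util01 u + util01 v) / 2"
proof (rule eqI_dyadic_bound[where C = 1])
  fix n
  obtain i where i: "i < 2 ^ n" "grid n i \<le> u" "u \<le> grid n (Suc i)" using grid_bracket assms by metis
  obtain j where j: "j < 2 ^ n" "grid n j \<le> v" "v \<le> grid n (Suc j)" using grid_bracket assms by metis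
  have "grid (Suc n) (i + j) \<le> mid u v"
    using mid_grid[of i n j] mid_mono[of "grid n i" "grid n j" u v] i j assms grid_unit by auto
  moreover have "mid u v \<le> grid (Suc n) (i + j + 2)"
    using mid_grid[of "Suc i" n "Suc j"] mid_mono[of u v "grid n (Suc i)" "grid n (Suc j)"]
      i j assms grid_unit by (auto simp del: grid.simps)
  ultimately have 1: "dyadic (Suc n) (i + j) \<le> util01 (mid u v)" "util01 (mid u v) \<le> dyadic (Suc n) (i + j + 2)"
    using i j mid_unit[OF assms] by (auto intro!: util01_ge util01_le simp del: grid.simps)
  have 2: "dyadic n i \<le> util01 u" "util01 u \<le> dyadic n (Suc i)"
    "dyadic n j \<le> util01 v" "util01 v \<le> dyadic n (Suc j)"
    using i j assms by (auto intro!: util01_ge util01_le simp del: grid.simps)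
  have 3: "dyadic (Suc n) (i + j) = (dyadic n i + dyadic n j) / 2"
    "dyadic (Suc n) (i + j + 2) = (dyadic n i + dyadic n j) / 2 + 1 / 2 ^ n"
    "dyadic n (Suc i) = dyadic n i + 1 / 2 ^ n" "dyadic n (Suc j) = dyadic n j + 1 / 2 ^ n"
    unfolding dyadic_def by (simp_all add: field_simps)
  show "\<bar>util01 (mid u v) - (util01 u + util01 v) / 2\<bar> \<le> 1 / 2 ^ n"
    using 1 2 unfolding 3 by (simp add: abs_le_iff add_divide_distrib diff_divide_distrib)
qed

section \<open>Weighted averages in utility units\<close>

definition weight :: "real \<Rightarrow> real" where
  "weight p = util01 (M p 1 0)"

text \<open>The map taking \<open>x\<close> to \<open>M p x 0\<close> commutes with
  \<open>mid\<close>, so in utility units it preserves midpoints and fixes 0. On the grid it is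
  therefore multiplication by its value at 1, and monotonicity carries this over to all
  points.\<close>

lemma util01_M_0:
  assumes p: "p \<in> {0..1}" and x: "x \<in> {0..1}"
  shows "util01 (M p x 0) = weight p * util01 x"
proof (rule eqI_dyadic_bound[where C = "1"])
  fix n
  have g: "util01 (M p (grid n j) 0) = weight p * dyadic n j" if "j \<le> 2 ^ n" for j n
    using that
  proof (induction n arbitrary: j)
    case 0
    then have "j = 0 \<or> j = 1" by auto
    then show ?case using idem[OF p] util01_0 by (auto simp: weight_def dyadic_def)
  next
    case (Suc n)
    have le: "grid n (j div 2) \<in> {0..1}" "grid n (Suc j div 2) \<in> {0..1}" by (rule grid_unit)+
    have j: "j div 2 \<le> 2 ^ n" "Suc j div 2 \<le> 2 ^ n" using Suc.prems by auto
    have "M p (grid (Suc n) j) 0 = mid (M p (grid n (j div 2)) 0) (M p (grid n (Suc j div 2)) 0)"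
      using mid_hom[of "grid n (j div 2)" "grid n (Suc j div 2)" 0 0 p] le p mid_idem[of 0] by simp
    then have "util01 (M p (grid (Suc n) j) 0) =
        (weight p * dyadic n (j div 2) + weight p * dyadic n (Suc j div 2)) / 2"
      using util01_mid M_unit[OF p] le Suc.IH[OF j(1)] Suc.IH[OF j(2)] by simp
    also have "\<dots> = weight p * ((dyadic n (j div 2) + dyadic n (Suc j div 2)) / 2)"
      by (simp add: algebra_simps)
    also have "(dyadic n (j div 2) + dyadic n (Suc j div 2)) / 2 = dyadic (Suc n) j"
    proof -
      have "real j = real (j div 2 + Suc j div 2)" by (rule arg_cong[of _ _ real]) presburger
      then show ?thesis unfolding dyadic_def by (simp add: field_simps)
    qed
    finally show ?case .
  qed
  obtain j where j: "j < 2 ^ n" "grid n j \<le> x" "x \<le> grid n (Suc j)" using grid_bracket x by metis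
  have "M p (grid n j) 0 \<le> M p x 0" "M p x 0 \<le> M p (grid n (Suc j)) 0"
    using j p x grid_unit[of n j] grid_unit[of n "Suc j"] by (auto intro!: mono)
  then have "weight p * dyadic n j \<le> util01 (M p x 0)" "util01 (M p x 0) \<le> weight p * dyadic n (Suc j)"
    using g[of j n] g[of "Suc j" n] j ge_right[OF p, of 0 x] ge_right[OF p, of 0 "grid n j"] x
      grid_unit[of n j] util01_mono by (metis Suc_leI atLeastAtMost_iff less_imp_le)+
  moreover have w: "weight p \<in> {0..1}" unfolding weight_def using p by (intro util01_unit M_unit) auto
  moreover have "dyadic n j \<le> util01 x" "util01 x \<le> dyadic n (Suc j)"
    using j x by (auto intro!: util01_ge util01_le simp del: grid.simps)
  then have "weight p * dyadic n j \<le> weight p * util01 x" "weight p * util01 x \<le> weight p * dyadic n (Suc j)"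
    using w by (auto intro!: mult_left_mono)
  moreover have "weight p * dyadic n (Suc j) \<le> weight p * dyadic n j + 1 / 2 ^ n"
    using w unfolding dyadic_def by (auto simp: field_simps)
  ultimately show "\<bar>util01 (M p x 0) - weight p * util01 x\<bar> \<le> 1 / 2 ^ n"
    by linarith
qed

lemma util01_inj: "x \<in> {0..1} \<Longrightarrow> y \<in> {0..1} \<Longrightarrow> util01 x = util01 y \<Longrightarrow> x = y"
  using util01_strict[of x y] util01_strict[of y x] by (cases x y rule: linorder_cases) auto

text \<open>The second prize is reduced to 0. The point \<open>z\<close>, whose utility is the
  difference of those of \<open>x\<close> and \<open>y\<close>, satisfies
  \<open>mid z y = mid x 0\<close>; applying \<open>mid_hom\<close> to both sides gives
  \<open>mid (M p x y) 0 = mid (M p z 0) y\<close>, and utilities turn this into an equation between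
  sums.\<close>

lemma util01_M:
  assumes p: "p \<in> {0..1}" and "0 \<le> y" "y \<le> x" "x \<le> 1"
  shows "util01 (M p x y) = weight p * util01 x + (1 - weight p) * util01 y"
proof -
  have u: "x \<in> {0..1}" "y \<in> {0..1}" "0 \<in> {0..1::real}" using assms by auto
  have "util01 x - util01 y \<in> {0..1}"
    using util01_mono[of y x] util01_unit[OF u(1)] util01_unit[OF u(2)] assms by auto
  then obtain z where z: "z \<in> {0..1}" "util01 z = util01 x - util01 y" using util01_onto by metis
  have "util01 (mid z y) = util01 (mid x 0)"
    using util01_mid[OF z(1) u(2)] util01_mid[OF u(1) u(3)] z(2) util01_0 by simp
  then have "mid z y = mid x 0" by (rule util01_inj[OF mid_unit[OF z(1) u(2)] mid_unit[OF u(1) u(3)]])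
  then have "mid (M p x y) (M p 0 0) = mid (M p z 0) (M p y y)"
    using mid_hom[of x 0 y 0 p] mid_hom[of z y 0 y p] u z p assms mid_commute[of y 0] by simp
  then have "util01 (mid (M p x y) 0) = util01 (mid (M p z 0) y)" using idem[OF p] by simp
  moreover have "M p x y \<in> {0..1}" "M p z 0 \<in> {0..1}"
    using M_unit[OF p u(1,2)] M_unit[OF p z(1) u(3)] assms z(1) by auto
  ultimately have "util01 (M p x y) = util01 (M p z 0) + util01 y"
    using util01_mid[of "M p x y" 0] util01_mid[of "M p z 0" y] u(2,3) util01_0 by simp
  then have "util01 (M p x y) = weight p * (util01 x - util01 y) + util01 y"
    using util01_M_0[OF p z(1)] z(2) by simp
  then show ?thesis by (simp add: algebra_simps)
qed

lemma weight_0: "weight 0 = 0" and weight_1: "weight 1 = 1"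
  unfolding weight_def using prob_0 prob_1 util01_0 util01_1 by auto

lemma weight_strict: "0 \<le> p \<Longrightarrow> p < q \<Longrightarrow> q \<le> 1 \<Longrightarrow> weight p < weight q"
  unfolding weight_def using M_unit[of p 1 0] M_unit[of q 1 0] by (intro util01_strict strict_prob) auto

lemma weight_onto:
  assumes "t \<in> {0..1}"
  obtains p where "p \<in> {0..1}" "weight p = t"
proof -
  obtain x where "x \<in> {0..1}" "util01 x = t" using util01_onto assms by metis
  moreover obtain p where "p \<in> {0..1}" "M p 1 0 = x" using attains[of 0 x 1] calculation by auto
  ultimately show ?thesis using that unfolding weight_def by auto
qed

lemma weight_continuous: "continuous_on {0..1} weight"
proof -
  \<comment> \<open>Continuing \<open>weight\<close> by the identity gives a monotone map of the
    line onto itself, and such a map is continuous.\<close>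
  define g where "g p = (if p \<in> {0..1} then weight p else p)" for p
  have w: "weight p \<in> {0..1}" if "p \<in> {0..1}" for p
    unfolding weight_def using that by (intro util01_unit M_unit) auto
  have "y \<in> range g" for y
  proof (cases "y \<in> {0..1}")
    case True
    then obtain p where "p \<in> {0..1}" "weight p = y" using weight_onto by metis
    then show ?thesis using rangeI[of g p] by (simp add: g_def)
  next
    case False
    then show ?thesis using rangeI[of g y] by (auto simp: g_def)
  qed
  then have "range g = UNIV" by auto
  moreover have "g x \<le> g y" if "x \<le> y" for x y
    using that w[of x] w[of y] weight_strict[of x y] unfolding g_def by (cases "x = y") auto
  ultimately have "continuous_on UNIV g" by (intro continuous_onI_mono) auto
  then have "continuous_on {0..1} g" by (rule continuous_on_subset) simp
  then show ?thesis by (rule continuous_on_cong[THEN iffD1, rotated 2]) (auto simp: g_def)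
qed

section \<open>Extension from the unit interval to the whole line\<close>

lemma squeeze:
  assumes "0 < N"
  obtains \<theta> where "\<And>x. x \<in> {-N..N} \<Longrightarrow> \<theta> x \<in> {0..1}"
    "\<And>x y. x \<in> {-N..N} \<Longrightarrow> y \<in> {-N..N} \<Longrightarrow> x < y \<Longrightarrow> \<theta> x < \<theta> y"
    "\<And>x y p. x \<in> {-N..N} \<Longrightarrow> y \<in> {-N..N} \<Longrightarrow> y \<le> x \<Longrightarrow> p \<in> {0..1} \<Longrightarrow> \<theta> (M p x y) = M p (\<theta> x) (\<theta> y)"
proof -
  obtain r where r: "0 < r" "r < 1" "M r N (-N) = 0" using attains_interior[of "-N" 0 N] assms by auto
  obtain s where s: "0 < s" "s < 1" "M s 1 (-N) = 0" using attains_interior[of "-N" 0 1] assms by auto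
  \<comment> \<open>Mixing with \<open>-N\<close> pushes the interval below 0, mixing the result
    with 1 lifts it above 0. The choice of \<open>r\<close> and \<open>s\<close> makes this exact:
    \<open>N\<close> goes to 0 in the first stage, and \<open>-N\<close>, which the first stage
    fixes, goes to 0 in the second. By bisymmetry and idempotence both stages commute with every
    \<open>M p\<close>.\<close>
  define \<theta> where "\<theta> x = M s 1 (M r x (-N))" for x
  have rs: "r \<in> {0..1}" "s \<in> {0..1}" using r s by auto
  have M0: "M r x (-N) \<le> 0" "-N \<le> M r x (-N)" if "x \<in> {-N..N}" for x
    using that mono[OF rs(1), of "-N" x N "-N"] r ge_right[OF rs(1), of "-N" x] by auto
  show ?thesis
  proof (rule that[of \<theta>])
    fix x assume x: "x \<in> {-N..N}"
    then show "\<theta> x \<in> {0..1}" unfolding \<theta>_def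
      using M0[OF x] mono[OF rs(2), of "-N" 1 1 "M r x (-N)"] s le_left[OF rs(2), of "M r x (-N)" 1] by auto
    fix y assume y: "y \<in> {-N..N}"
    then show "\<theta> x < \<theta> y" if "x < y" unfolding \<theta>_def
      using that r s x M0[OF x] M0[OF y] by (intro strict_right strict_left) auto
    fix p :: real assume yx: "y \<le> x" and p: "p \<in> {0..1}"
    have "M r (M p x y) (-N) = M p (M r x (-N)) (M r y (-N))"
      using bisym[OF rs(1) p, of "-N" "-N" x y] idem[OF p] x y yx by simp
    moreover have "M r y (-N) \<le> M r x (-N)" using x y yx rs by (auto intro!: mono)
    then have "M s 1 (M p (M r x (-N)) (M r y (-N))) = M p (M s 1 (M r x (-N))) (M s 1 (M r y (-N)))"
      using bisym[OF rs(2) p, of "M r y (-N)" "M r x (-N)" 1 1] idem[OF p] M0[OF x] M0[OF y] by simp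
    ultimately show "\<theta> (M p x y) = M p (\<theta> x) (\<theta> y)" unfolding \<theta>_def by simp
  qed
qed

definition is_scale :: "real \<Rightarrow> (real \<Rightarrow> real) \<Rightarrow> bool" where
  "is_scale N f \<longleftrightarrow> f 0 = 0 \<and> f 1 = 1 \<and>
     (\<forall>x\<in>{-N..N}. \<forall>y\<in>{-N..N}. x < y \<longrightarrow> f x < f y) \<and>
     (\<forall>p\<in>{0..1}. \<forall>x\<in>{-N..N}. \<forall>y\<in>{-N..N}. y \<le> x \<longrightarrow>
        f (M p x y) = weight p * f x + (1 - weight p) * f y)"

lemma is_scale_exists:
  assumes "1 \<le> N"
  shows "\<exists>f. is_scale N f"
proof -
  obtain \<theta> where th: "\<And>x. x \<in> {-N..N} \<Longrightarrow> \<theta> x \<in> {0..1}"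
    "\<And>x y. x \<in> {-N..N} \<Longrightarrow> y \<in> {-N..N} \<Longrightarrow> x < y \<Longrightarrow> \<theta> x < \<theta> y"
    "\<And>x y p. x \<in> {-N..N} \<Longrightarrow> y \<in> {-N..N} \<Longrightarrow> y \<le> x \<Longrightarrow> p \<in> {0..1} \<Longrightarrow> \<theta> (M p x y) = M p (\<theta> x) (\<theta> y)"
    using squeeze[of N] assms by auto
  define g where "g x = util01 (\<theta> x)" for x
  have g: "g x < g y" if "x \<in> {-N..N}" "y \<in> {-N..N}" "x < y" for x y
    unfolding g_def using th that by (intro util01_strict) fastforce+
  have gM: "g (M p x y) = weight p * g x + (1 - weight p) * g y"
    if "p \<in> {0..1}" "x \<in> {-N..N}" "y \<in> {-N..N}" "y \<le> x" for p x y
  proof -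
    have "\<theta> y \<le> \<theta> x" using th(2)[of y x] that by (cases "y = x") auto
    then show ?thesis unfolding g_def using th(3) util01_M[of p "\<theta> y" "\<theta> x"] that th(1)[of x] th(1)[of y] by auto
  qed
  define f where "f x = (g x - g 0) / (g 1 - g 0)" for x
  have 01: "g 0 < g 1" using g[of 0 1] assms by auto
  have "is_scale N f" unfolding is_scale_def
  proof (intro conjI ballI impI)
    show "f 0 = 0" "f 1 = 1" using 01 by (auto simp: f_def)
    show "f x < f y" if "x \<in> {-N..N}" "y \<in> {-N..N}" "x < y" for x y
      unfolding f_def using g[OF that] 01 by (simp add: divide_strict_right_mono)
    show "f (M p x y) = weight p * f x + (1 - weight p) * f y"
      if "p \<in> {0..1}" "x \<in> {-N..N}" "y \<in> {-N..N}" "y \<le> x" for p x y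
    proof -
      have "weight p * g x + (1 - weight p) * g y - g 0 = weight p * (g x - g 0) + (1 - weight p) * (g y - g 0)"
        by (simp add: algebra_simps)
      then show ?thesis unfolding f_def gM[OF that] by (simp add: add_divide_distrib)
    qed
  qed
  then show ?thesis by blast
qed

text \<open>The normalisation at 0 and 1 and the weights determine the scale, so scales on larger and
  larger intervals extend each other.\<close>

lemma is_scale_unique:
  assumes "is_scale N f" "is_scale N' g" "1 \<le> N" "1 \<le> N'" "x \<in> {-N..N}" "x \<in> {-N'..N'}"
  shows "f x = g x"
proof -
  have M: "f (M p x y) = weight p * f x + (1 - weight p) * f y"
     "g (M p x y) = weight p * g x + (1 - weight p) * g y"
    if "p \<in> {0..1}" "x \<in> {-N..N}" "x \<in> {-N'..N'}" "y \<in> {-N..N}" "y \<in> {-N'..N'}" "y \<le> x" for p x y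
    using assms that unfolding is_scale_def by blast+
  have 01: "f 0 = 0" "f 1 = 1" "g 0 = 0" "g 1 = 1" using assms unfolding is_scale_def by auto
  consider "0 \<le> x \<and> x \<le> 1" | "1 < x" | "x < 0" by linarith
  then show ?thesis
  proof cases
    case 1
    then obtain p where "p \<in> {0..1}" "M p 1 0 = x" using attains[of 0 x 1] by auto
    then show ?thesis using M[of p 1 0] assms 01 by auto
  next
    case 2
    then obtain p where "p \<in> {0..1}" "M p x 0 = 1" using attains[of 0 1 x] by auto
    then have "1 = weight p * f x" "1 = weight p * g x" using M[of p x 0] assms 01 2 by auto
    then show ?thesis by (metis mult_left_cancel mult_zero_left zero_neq_one)
  next
    case 3
    then obtain p where "p \<in> {0..1}" "M p 1 x = 0" using attains[of x 0 1] by auto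
    then have "0 = weight p + (1 - weight p) * f x" "0 = weight p + (1 - weight p) * g x"
      using M[of p 1 x] assms 01 3 by auto
    moreover from this have "1 - weight p \<noteq> 0" by auto
    moreover have "(1 - weight p) * f x = (1 - weight p) * g x" using calculation by linarith
    ultimately show ?thesis by simp
  qed
qed

text \<open>Any scale whose interval contains \<open>x\<close> gives the same value, by
  \<open>is_scale_unique\<close>. The choice depends on \<open>M\<close> alone, so equal families
  have the same \<open>util\<close>.\<close>

definition util :: "real \<Rightarrow> real" where
  "util x = (SOME f. is_scale (\<bar>x\<bar> + 1) f) x"

lemma util_eq:
  assumes "is_scale N f" "1 \<le> N" "x \<in> {-N..N}"
  shows "util x = f x"
proof -
  define g where "g = (SOME f. is_scale (\<bar>x\<bar> + 1) f)"
  have "is_scale (\<bar>x\<bar> + 1) g"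
    unfolding g_def by (rule someI_ex[OF is_scale_exists]) simp
  moreover have "x \<in> {- (\<bar>x\<bar> + 1)..\<bar>x\<bar> + 1}" by (simp add: abs_real_def)
  ultimately have "g x = f x" using is_scale_unique[of _ g N f x] assms by auto
  then show ?thesis unfolding util_def g_def .
qed

lemma util_0: "util 0 = 0"
  using is_scale_exists[of 1] util_eq[of 1 _ 0] by (auto simp: is_scale_def)

lemma util_strict_mono: "strict_mono util"
proof (rule strict_monoI)
  fix x y :: real assume xy: "x < y"
  define N where "N = 1 + \<bar>x\<bar> + \<bar>y\<bar>"
  obtain f where f: "is_scale N f" using is_scale_exists[of N] unfolding N_def by auto
  have "util x = f x" "util y = f y" using f by (auto intro!: util_eq[OF f] simp: N_def)
  moreover have "x \<in> {-N..N}" "y \<in> {-N..N}" unfolding N_def by auto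
  ultimately show "util x < util y" using f xy unfolding is_scale_def by metis
qed

lemma util_M:
  assumes "p \<in> {0..1}" "y \<le> x"
  shows "util (M p x y) = weight p * util x + (1 - weight p) * util y"
proof -
  define N where "N = 1 + \<bar>x\<bar> + \<bar>y\<bar>"
  have N: "x \<in> {-N..N}" "y \<in> {-N..N}" "1 \<le> N" unfolding N_def by auto
  moreover have "M p x y \<in> {-N..N}" using N le_left[OF assms] ge_right[OF assms] by auto
  moreover obtain f where f: "is_scale N f" using is_scale_exists[of N] N by auto
  ultimately have "util x = f x" "util y = f y" "util (M p x y) = f (M p x y)"
    using util_eq[OF f N(3)] by blast+
  then show ?thesis using f assms N unfolding is_scale_def by metis
qed

text \<open>Every number between \<open>util (x - 1)\<close> and \<open>util (x + 1)\<close> is the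
  utility of a bet on these two prizes, because \<open>weight\<close> is onto. A monotone function
  with open range is continuous.\<close>

lemma open_range_util: "open (range util)"
proof (subst open_subopen, rule ballI)
  fix t assume "t \<in> range util"
  then obtain x where x: "t = util x" by auto
  have lt: "util (x - 1) < t" "t < util (x + 1)" using x util_strict_mono by (auto simp: strict_mono_less)
  have "s \<in> range util" if s: "util (x - 1) < s" "s < util (x + 1)" for s
  proof -
    define w where "w = (s - util (x - 1)) / (util (x + 1) - util (x - 1))"
    have w: "w \<in> {0..1}" unfolding w_def using s by auto
    obtain p where p: "p \<in> {0..1}" "weight p = w" using weight_onto w by metis
    have "util (M p (x + 1) (x - 1)) = util (x - 1) + w * (util (x + 1) - util (x - 1))"
      using util_M[of p "x - 1" "x + 1"] p by (simp add: algebra_simps)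
    also have "\<dots> = s" unfolding w_def using s by simp
    finally show ?thesis by (metis rangeI)
  qed
  then have "{util (x - 1)<..<util (x + 1)} \<subseteq> range util" by auto
  then show "\<exists>T. open T \<and> t \<in> T \<and> T \<subseteq> range util"
    using lt by (intro exI[of _ "{util (x - 1)<..<util (x + 1)}"]) auto
qed

lemma util_continuous: "continuous_on UNIV util"
  by (rule continuous_onI_mono[OF open_range_util]) (use util_strict_mono in \<open>auto simp: strict_mono_less_eq\<close>)

end

section \<open>Finitely additive integrals\<close>

lemma local_midpoint_concave:
  fixes h :: "real \<Rightarrow> real"
  assumes cont: "continuous_on {0..1} h" and "\<delta> > 0"
    and mid: "\<And>t e. 0 \<le> e \<Longrightarrow> e \<le> \<delta> \<Longrightarrow> 0 \<le> t - e \<Longrightarrow> t + e \<le> 1 \<Longrightarrow> (h (t - e) + h (t + e)) / 2 \<le> h t"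
    and t: "t \<in> {0..1}"
  shows "(1 - t) * h 0 + t * h 1 \<le> h t"
proof (rule ccontr)
  assume neg: "\<not> ?thesis"
  define g where "g t = h t - ((1 - t) * h 0 + t * h 1)" for t
  have cg: "continuous_on {0..1} g" unfolding g_def by (intro continuous_intros cont)
  obtain m where m: "m \<in> {0..1}" "\<And>x. x \<in> {0..1} \<Longrightarrow> g m \<le> g x"
    using continuous_attains_inf[OF compact_Icc _ cg] by auto
  \<comment> \<open>The leftmost point \<open>s\<close> at which \<open>h\<close> falls furthest
    below its chord is interior. At both neighbours \<open>s - e\<close> and \<open>s + e\<close>
    the function \<open>g\<close> is at least the minimum, and at the left one it is strictly
    larger, which contradicts the midpoint inequality at \<open>s\<close>.\<close>
  define S where "S = {x \<in> {0..1}. g x = g m}"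
  define s where "s = Inf S"
  have "closed S" unfolding S_def
    using continuous_closed_preimage_constant[OF cg closed_atLeastAtMost] by simp
  moreover have "S \<noteq> {}" "bdd_below S" using m unfolding S_def by auto
  ultimately have sS: "s \<in> S" unfolding s_def by (intro closed_contains_Inf)
  have low: "s \<le> x" if "x \<in> S" for x
    unfolding s_def using that \<open>bdd_below S\<close> by (rule cInf_lower)
  have gs: "g s = g m" "s \<in> {0..1}" using sS by (auto simp: S_def)
  have "g m < 0" using neg m(2)[OF t] unfolding g_def by auto
  then have s: "0 < s" "s < 1" using gs by (auto simp: g_def less_le)
  define e where "e = Min {\<delta>, s, 1 - s}"
  have e: "0 < e" "e \<le> \<delta>" "e \<le> s" "e \<le> 1 - s" unfolding e_def using s \<open>\<delta> > 0\<close> by auto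
  have "(g (s - e) + g (s + e)) / 2 \<le> g s"
    using mid[of e s] e unfolding g_def by (simp add: field_simps)
  moreover have "g m \<le> g (s + e)" "g m \<le> g (s - e)" using m(2) e s by auto
  moreover have "g (s - e) \<noteq> g m" using low[of "s - e"] e s unfolding S_def by auto
  ultimately show False using gs by auto
qed

text \<open>Partial functionals are represented by linear subspaces of graph pairs below
  \<open>p\<close>, ordered by inclusion. Being single-valued is not built in: it follows from
  domination by \<open>p\<close> at the zero function.\<close>

lemma hahn_banach_convex:
  fixes X :: "('a \<Rightarrow> real) set" and p :: "('a \<Rightarrow> real) \<Rightarrow> real"
  assumes zero: "(\<lambda>_. 0) \<in> X"
    and lin: "\<And>f g a b. f \<in> X \<Longrightarrow> g \<in> X \<Longrightarrow> (\<lambda>x. a * f x + b * g x) \<in> X"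
    and convex: "\<And>f g t. f \<in> X \<Longrightarrow> g \<in> X \<Longrightarrow> 0 \<le> t \<Longrightarrow> t \<le> 1 \<Longrightarrow>
      p (\<lambda>x. (1 - t) * f x + t * g x) \<le> (1 - t) * p f + t * p g"
    and p0: "0 \<le> p (\<lambda>_. 0)"
  obtains L where "\<And>f. f \<in> X \<Longrightarrow> L f \<le> p f"
    "\<And>f g a b. f \<in> X \<Longrightarrow> g \<in> X \<Longrightarrow> L (\<lambda>x. a * f x + b * g x) = a * L f + b * L g"
proof -
  define GG where "GG = {G. G \<subseteq> X \<times> UNIV \<and> ((\<lambda>_. 0), 0) \<in> G \<and>
     (\<forall>f r g s a b. (f, r) \<in> G \<longrightarrow> (g, s) \<in> G \<longrightarrow> ((\<lambda>x. a * f x + b * g x), a * r + b * s) \<in> G) \<and>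
     (\<forall>f r. (f, r) \<in> G \<longrightarrow> r \<le> p f)}"
  have "\<exists>M\<in>GG. \<forall>G\<in>GG. M \<subseteq> G \<longrightarrow> G = M"
  proof (rule subset_Zorn_nonempty)
    have "{((\<lambda>_. 0), 0)} \<in> GG" unfolding GG_def using zero p0 by auto
    then show "GG \<noteq> {}" by blast
    fix C assume C: "C \<noteq> {}" "subset.chain GG C"
    then have CG: "C \<subseteq> GG" unfolding subset.chain_def by blast
    show "\<Union> C \<in> GG" unfolding GG_def
    proof (intro CollectI conjI allI impI)
      show "\<Union> C \<subseteq> X \<times> UNIV" using CG unfolding GG_def by blast
      show "((\<lambda>_. 0), 0) \<in> \<Union> C" using CG C unfolding GG_def by blast
      show "r \<le> p f" if "(f, r) \<in> \<Union> C" for f r using that CG unfolding GG_def by blast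
      fix f r g s and a b :: real assume "(f, r) \<in> \<Union> C" "(g, s) \<in> \<Union> C"
      then obtain G where "G \<in> C" "(f, r) \<in> G" "(g, s) \<in> G"
        using C(2) unfolding subset.chain_def by blast
      then show "((\<lambda>x. a * f x + b * g x), a * r + b * s) \<in> \<Union> C"
        using CG unfolding GG_def by blast
    qed
  qed
  then obtain G where G: "G \<in> GG" and max: "\<And>G'. G' \<in> GG \<Longrightarrow> G \<subseteq> G' \<Longrightarrow> G' = G" by blast
  have GX: "f \<in> X" if "(f, r) \<in> G" for f r using G that unfolding GG_def by blast
  have G0: "((\<lambda>_. 0), 0) \<in> G" using G unfolding GG_def by blast
  have Glin: "((\<lambda>x. a * f x + b * g x), a * r + b * s) \<in> G" if "(f, r) \<in> G" "(g, s) \<in> G" for f r g s a b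
    using G that unfolding GG_def by blast
  have Gp: "r \<le> p f" if "(f, r) \<in> G" for f r using G that unfolding GG_def by blast
  have unique: "r = s" if fr: "(f, r) \<in> G" and fs: "(f, s) \<in> G" for f r s
  proof (rule ccontr)
    assume "r \<noteq> s"
    \<comment> \<open>Two values at one function would place arbitrarily large numbers over the zero
      function; this factor just exceeds the bound \<open>p (\<lambda>_. 0)\<close>.\<close>
    define c where "c = (p (\<lambda>_. 0) + 1) / (r - s)"
    have "((\<lambda>x. c * f x + (- c) * f x), c * r + (- c) * s) \<in> G" by (rule Glin[OF fr fs])
    then have "c * r + (- c) * s \<le> p (\<lambda>_. 0)" using Gp by fastforce
    moreover have "c * (r - s) = p (\<lambda>_. 0) + 1" unfolding c_def using \<open>r \<noteq> s\<close> by simp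
    ultimately show False by (simp add: algebra_simps)
  qed
  have total: "\<exists>r. (f0, r) \<in> G" if f0: "f0 \<in> X" for f0
  proof -
    define A where "A = {(b - p (\<lambda>x. y x - s * f0 x)) / s | y b s. (y, b) \<in> G \<and> s > 0}"
    define \<alpha> where "\<alpha> = Sup A"
    have sep: "(b' - p (\<lambda>x. y' x - s' * f0 x)) / s' \<le> (p (\<lambda>x. y x + s * f0 x) - b) / s"
      if y: "(y, b) \<in> G" "s > 0" and y': "(y', b') \<in> G" "s' > 0" for y b s y' b' s'
    proof -
      \<comment> \<open>The weight that cancels the multiples of \<open>f0\<close> in the convex
        combination. Since the step lengths \<open>s\<close> and \<open>s'\<close> are independent,
        convexity of \<open>p\<close> suffices where the usual argument uses sublinearity.\<close>
      define t where "t = s' / (s + s')"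
      have t: "0 \<le> t" "t \<le> 1" "1 - t = s / (s + s')" unfolding t_def using y y' by (auto simp: field_simps)
      have X: "(\<lambda>x. y' x - s' * f0 x) \<in> X" "(\<lambda>x. y x + s * f0 x) \<in> X"
        using lin[OF GX[OF y'(1)] f0, of 1 "- s'"] lin[OF GX[OF y(1)] f0, of 1 s] by auto
      have "(1 - t) * s' = t * s" unfolding t(3) unfolding t_def by simp
      then have "(1 - t) * (s' * c) = t * (s * c)" for c by (simp only: mult.assoc[symmetric])
      then have eq: "(\<lambda>x. (1 - t) * (y' x - s' * f0 x) + t * (y x + s * f0 x)) = (\<lambda>x. (1 - t) * y' x + t * y x)"
        by (simp only: right_diff_distrib[of "1 - t"] distrib_left[of t]) simp
      have "(1 - t) * b' + t * b \<le> p (\<lambda>x. (1 - t) * y' x + t * y x)"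
        by (rule Gp[OF Glin[OF y'(1) y(1)]])
      also have "\<dots> \<le> (1 - t) * p (\<lambda>x. y' x - s' * f0 x) + t * p (\<lambda>x. y x + s * f0 x)"
        unfolding eq[symmetric] by (rule convex[OF X t(1,2)])
      finally have "(s * b' + s' * b) / (s + s')
          \<le> (s * p (\<lambda>x. y' x - s' * f0 x) + s' * p (\<lambda>x. y x + s * f0 x)) / (s + s')"
        unfolding t(3) unfolding t_def by (simp add: add_divide_distrib)
      then have "s * (b' - p (\<lambda>x. y' x - s' * f0 x)) \<le> s' * (p (\<lambda>x. y x + s * f0 x) - b)"
        using y y' by (simp add: divide_le_cancel algebra_simps)
      then show ?thesis using y y' by (simp add: field_simps)
    qed
    have ne: "A \<noteq> {}" unfolding A_def using G0 zero_less_one[where 'a = real] by blast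
    have bdd: "bdd_above A"
      using sep[OF G0, of 1] unfolding A_def by (intro bdd_aboveI) auto
    have up: "b - s * \<alpha> \<le> p (\<lambda>x. y x - s * f0 x)" if "(y, b) \<in> G" "s > 0" for y b s
    proof -
      have "(b - p (\<lambda>x. y x - s * f0 x)) / s \<le> \<alpha>"
        unfolding \<alpha>_def using that bdd by (intro cSup_upper) (auto simp: A_def)
      then show ?thesis using that by (simp add: field_simps)
    qed
    have lo: "b + s * \<alpha> \<le> p (\<lambda>x. y x + s * f0 x)" if "(y, b) \<in> G" "s > 0" for y b s
    proof -
      have "\<alpha> \<le> (p (\<lambda>x. y x + s * f0 x) - b) / s"
        unfolding \<alpha>_def using ne sep[OF that] by (intro cSup_least) (auto simp: A_def)
      then show ?thesis using that by (simp add: field_simps)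
    qed
    define G' where "G' = {((\<lambda>x. y x + s * f0 x), b + s * \<alpha>) | y b s. (y, b) \<in> G}"
    have G'I: "((\<lambda>x. y x + s * f0 x), b + s * \<alpha>) \<in> G'" if "(y, b) \<in> G" for y b s
      unfolding G'_def using that by blast
    have sub: "G \<subseteq> G'"
    proof
      fix z assume "z \<in> G"
      then show "z \<in> G'" using G'I[of "fst z" "snd z" 0] by simp
    qed
    have "G' \<in> GG" unfolding GG_def
    proof (intro CollectI conjI allI impI)
      show "G' \<subseteq> X \<times> UNIV" unfolding G'_def using lin[OF GX f0, where a = 1] by auto
      show "((\<lambda>_. 0), 0) \<in> G'" using sub G0 by blast
    next
      fix f r assume "(f, r) \<in> G'"
      then obtain y b s where *: "(y, b) \<in> G" "f = (\<lambda>x. y x + s * f0 x)" "r = b + s * \<alpha>"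
        unfolding G'_def by auto
      show "r \<le> p f"
        using up[OF *(1), of "- s"] lo[OF *(1), of s] Gp[OF *(1)] unfolding *(2,3)
        by (cases s "0::real" rule: linorder_cases) auto
    next
      fix f r g s' and a c :: real assume "(f, r) \<in> G'" "(g, s') \<in> G'"
      then obtain y b s y' b' u where *: "(y, b) \<in> G" "f = (\<lambda>x. y x + s * f0 x)" "r = b + s * \<alpha>"
        "(y', b') \<in> G" "g = (\<lambda>x. y' x + u * f0 x)" "s' = b' + u * \<alpha>"
        unfolding G'_def by auto
      have "((\<lambda>x. (a * y x + c * y' x) + (a * s + c * u) * f0 x), (a * b + c * b') + (a * s + c * u) * \<alpha>) \<in> G'"
        by (rule G'I[OF Glin[OF *(1,4)]])
      then show "((\<lambda>x. a * f x + c * g x), a * r + c * s') \<in> G'"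
        unfolding * by (simp add: algebra_simps)
    qed
    then have "G' = G" using max sub by blast
    moreover have "((\<lambda>x. 0 + 1 * f0 x), 0 + 1 * \<alpha>) \<in> G'" by (rule G'I[OF G0])
    ultimately show ?thesis by auto
  qed
  define L where "L f = (THE r. (f, r) \<in> G)" for f
  have L: "(f, L f) \<in> G" if "f \<in> X" for f
    unfolding L_def using total[OF that] unique by (metis theI)
  show ?thesis
  proof (rule that[of L])
    show "L f \<le> p f" if "f \<in> X" for f using Gp L that by blast
    show "L (\<lambda>x. a * f x + b * g x) = a * L f + b * L g" if "f \<in> X" "g \<in> X" for f g a b
      using unique[OF L[OF lin[OF that]] Glin[OF L L]] that by blast
  qed
qed

section \<open>Finitely additive integration\<close>

definition bounded_measurable :: "'w measure \<Rightarrow> ('w \<Rightarrow> real) set" where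
  "bounded_measurable W = {f \<in> borel_measurable W. bounded (f ` space W)}"

lemma bounded_measurable_lin:
  assumes "f \<in> bounded_measurable W" "g \<in> bounded_measurable W"
  shows "(\<lambda>w. a * f w + b * g w) \<in> bounded_measurable W"
proof -
  obtain B C where B: "\<And>w. w \<in> space W \<Longrightarrow> \<bar>f w\<bar> \<le> B" "\<And>w. w \<in> space W \<Longrightarrow> \<bar>g w\<bar> \<le> C"
    using assms unfolding bounded_measurable_def bounded_iff by auto
  have "\<bar>a * f w + b * g w\<bar> \<le> \<bar>a\<bar> * B + \<bar>b\<bar> * C" if "w \<in> space W" for w
  proof -
    have "\<bar>a * f w + b * g w\<bar> \<le> \<bar>a\<bar> * \<bar>f w\<bar> + \<bar>b\<bar> * \<bar>g w\<bar>"
      using abs_triangle_ineq[of "a * f w" "b * g w"] by (simp add: abs_mult)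
    also have "\<dots> \<le> \<bar>a\<bar> * B + \<bar>b\<bar> * C" using B[OF that] by (intro add_mono mult_left_mono) auto
    finally show ?thesis .
  qed
  then have "bounded ((\<lambda>w. a * f w + b * g w) ` space W)" unfolding bounded_iff by auto
  then show ?thesis using assms unfolding bounded_measurable_def by auto
qed

lemma bounded_measurable_const: "(\<lambda>_. k) \<in> bounded_measurable W"
  unfolding bounded_measurable_def bounded_iff by auto

lemma bounded_measurable_add_const: "f \<in> bounded_measurable W \<Longrightarrow> (\<lambda>w. f w + k) \<in> bounded_measurable W"
  using bounded_measurable_lin[OF _ bounded_measurable_const, of f W 1 1 k] by simp

lemma bounded_measurable_simple: "simple_function W f \<Longrightarrow> f \<in> bounded_measurable W"
  unfolding bounded_measurable_def
  by (auto simp: borel_measurable_simple_function simple_functionD(1) finite_imp_bounded)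

lemma bounded_measurable_bound:
  assumes "f \<in> bounded_measurable W"
  obtains B where "\<And>w. w \<in> space W \<Longrightarrow> \<bar>f w\<bar> \<le> B"
  using assms unfolding bounded_measurable_def bounded_iff by auto

text \<open>Rounding down starts from \<open>lo\<close>, not from 0, so that the approximation
  respects the same lower bound and its values do not leave an interval containing those of
  \<open>h\<close>.\<close>

lemma simple_approx_below:
  fixes h :: "'w \<Rightarrow> real"
  assumes h: "h \<in> borel_measurable W" and "0 < \<epsilon>"
    and bnd: "\<And>w. w \<in> space W \<Longrightarrow> lo \<le> h w \<and> h w \<le> hi"
  obtains g where "simple_function W g"
    "\<And>w. w \<in> space W \<Longrightarrow> lo \<le> g w \<and> g w \<le> h w \<and> h w \<le> g w + \<epsilon>"
proof -
  define g where "g w = lo + \<epsilon> * of_int \<lfloor>(h w - lo) / \<epsilon>\<rfloor>" for w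
  have fin: "finite (g ` space W)"
  proof (rule finite_subset)
    show "g ` space W \<subseteq> (\<lambda>i. lo + \<epsilon> * of_int i) ` {0..\<lfloor>(hi - lo) / \<epsilon>\<rfloor>}"
    proof safe
      fix w assume "w \<in> space W"
      then have "\<lfloor>(h w - lo) / \<epsilon>\<rfloor> \<in> {0..\<lfloor>(hi - lo) / \<epsilon>\<rfloor>}"
        using bnd[of w] \<open>0 < \<epsilon>\<close> by (auto intro!: floor_mono divide_right_mono)
      then show "g w \<in> (\<lambda>i. lo + \<epsilon> * of_int i) ` {0..\<lfloor>(hi - lo) / \<epsilon>\<rfloor>}"
        unfolding g_def by blast
    qed
  qed auto
  have meas: "g \<in> borel_measurable W" unfolding g_def using h by measurable
  have "lo \<le> g w \<and> g w \<le> h w \<and> h w \<le> g w + \<epsilon>" if "w \<in> space W" for w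
  proof -
    have "0 \<le> \<lfloor>(h w - lo) / \<epsilon>\<rfloor>" using bnd[OF that] \<open>0 < \<epsilon>\<close> by simp
    then have 1: "lo \<le> g w" unfolding g_def using \<open>0 < \<epsilon>\<close> by simp
    have 2: "of_int \<lfloor>(h w - lo) / \<epsilon>\<rfloor> \<le> (h w - lo) / \<epsilon>" "(h w - lo) / \<epsilon> \<le> of_int \<lfloor>(h w - lo) / \<epsilon>\<rfloor> + 1"
      by linarith+
    then have "\<epsilon> * of_int \<lfloor>(h w - lo) / \<epsilon>\<rfloor> \<le> h w - lo" "h w - lo \<le> \<epsilon> * of_int \<lfloor>(h w - lo) / \<epsilon>\<rfloor> + \<epsilon>"
      using mult_left_mono[OF 2(1), of \<epsilon>] mult_left_mono[OF 2(2), of \<epsilon>] \<open>0 < \<epsilon>\<close> by (simp_all add: distrib_left)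
    with 1 show ?thesis unfolding g_def by linarith
  qed
  then show ?thesis using that simple_function_borel_measurable[OF meas fin] by blast
qed

lemma \<Delta>_empty: "Q \<in> \<Delta> W \<Longrightarrow> Q {} = 0"
  unfolding \<Delta>_def by (fastforce dest!: bspec[of _ _ "{}"])

lemma \<Delta>_Union:
  assumes Q: "Q \<in> \<Delta> W" and "finite Z" "\<And>z. z \<in> Z \<Longrightarrow> A z \<in> sets W" "disjoint_family_on A Z"
  shows "Q (\<Union>z\<in>Z. A z) = (\<Sum>z\<in>Z. Q (A z))"
  using assms(2-)
proof (induction Z)
  case empty
  then show ?case using \<Delta>_empty[OF Q] by simp
next
  case (insert z Z)
  have "A z \<inter> (\<Union>z\<in>Z. A z) = {}"
    using insert.prems(2) insert.hyps(2) unfolding disjoint_family_on_def by fastforce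
  moreover have "A z \<in> sets W" "(\<Union>z\<in>Z. A z) \<in> sets W" using insert by auto
  ultimately have "Q (A z \<union> (\<Union>z\<in>Z. A z)) = Q (A z) + Q (\<Union>z\<in>Z. A z)"
    using Q unfolding \<Delta>_def by blast
  then show ?case using insert by (simp add: disjoint_family_on_mono[OF subset_insertI])
qed

text \<open>Makes integrals of different simple functions comparable: both are functions of their
  pair and can be summed over its common partition.\<close>

lemma fa_simple_integral_comp:
  assumes Q: "Q \<in> \<Delta> W" and k: "simple_function W k"
  shows "fa_simple_integral W Q (\<lambda>w. \<phi> (k w)) = (\<Sum>z\<in>k ` space W. \<phi> z * Q (k -` {z} \<inter> space W))"
proof -
  have fin: "finite (k ` space W)" using k by (rule simple_functionD)
  have Qk: "Q ((\<lambda>w. \<phi> (k w)) -` {y} \<inter> space W) = (\<Sum>z\<in>{z\<in>k ` space W. \<phi> z = y}. Q (k -` {z} \<inter> space W))" for y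
  proof -
    have "(\<lambda>w. \<phi> (k w)) -` {y} \<inter> space W = (\<Union>z\<in>{z\<in>k ` space W. \<phi> z = y}. k -` {z} \<inter> space W)" by auto
    moreover have "Q (\<Union>z\<in>{z\<in>k ` space W. \<phi> z = y}. k -` {z} \<inter> space W)
        = (\<Sum>z\<in>{z\<in>k ` space W. \<phi> z = y}. Q (k -` {z} \<inter> space W))"
      using fin k by (intro \<Delta>_Union[OF Q]) (auto simp: simple_functionD(2) disjoint_family_on_def)
    ultimately show ?thesis by simp
  qed
  have "fa_simple_integral W Q (\<lambda>w. \<phi> (k w)) =
      (\<Sum>y\<in>\<phi> ` k ` space W. y * (\<Sum>z\<in>{z\<in>k ` space W. \<phi> z = y}. Q (k -` {z} \<inter> space W)))"
    unfolding fa_simple_integral_def Qk image_image ..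
  also have "\<dots> = (\<Sum>y\<in>\<phi> ` k ` space W. \<Sum>z\<in>{z\<in>k ` space W. \<phi> z = y}. \<phi> z * Q (k -` {z} \<inter> space W))"
    by (simp add: sum_distrib_left)
  also have "\<dots> = (\<Sum>z\<in>k ` space W. \<phi> z * Q (k -` {z} \<inter> space W))"
    by (rule sum.image_gen[OF fin, symmetric])
  finally show ?thesis .
qed

lemma \<Delta>_nonneg: "Q \<in> \<Delta> W \<Longrightarrow> 0 \<le> Q A"
  unfolding \<Delta>_def by (cases "A \<in> sets W") auto

lemma fa_simple_integral_mono:
  assumes Q: "Q \<in> \<Delta> W" and f: "simple_function W f" and g: "simple_function W g"
    and le: "\<And>w. w \<in> space W \<Longrightarrow> f w \<le> g w"
  shows "fa_simple_integral W Q f \<le> fa_simple_integral W Q g"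
proof -
  define k where "k w = (f w, g w)" for w
  have k: "simple_function W k" unfolding k_def by (rule simple_function_Pair[OF f g])
  have "fa_simple_integral W Q f = (\<Sum>z\<in>k ` space W. fst z * Q (k -` {z} \<inter> space W))"
    using fa_simple_integral_comp[OF Q k, of fst] by (simp add: k_def)
  also have "\<dots> \<le> (\<Sum>z\<in>k ` space W. snd z * Q (k -` {z} \<inter> space W))"
    using le \<Delta>_nonneg[OF Q] by (intro sum_mono mult_right_mono) (auto simp: k_def)
  also have "\<dots> = fa_simple_integral W Q g"
    using fa_simple_integral_comp[OF Q k, of snd] by (simp add: k_def)
  finally show ?thesis .
qed

lemma \<Delta>_total: "Q \<in> \<Delta> W \<Longrightarrow> simple_function W f \<Longrightarrow>
    (\<Sum>z\<in>f ` space W. Q (f -` {z} \<inter> space W)) = 1"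
proof -
  assume Q: "Q \<in> \<Delta> W" and f: "simple_function W f"
  have "space W = (\<Union>z\<in>f ` space W. f -` {z} \<inter> space W)" by auto
  then have "Q (space W) = Q (\<Union>z\<in>f ` space W. f -` {z} \<inter> space W)" by (rule arg_cong)
  also have "\<dots> = (\<Sum>z\<in>f ` space W. Q (f -` {z} \<inter> space W))"
    using f by (intro \<Delta>_Union[OF Q]) (auto simp: simple_functionD disjoint_family_on_def)
  finally show ?thesis using Q unfolding \<Delta>_def by auto
qed

lemma fa_simple_integral_add_const:
  assumes Q: "Q \<in> \<Delta> W" and f: "simple_function W f"
  shows "fa_simple_integral W Q (\<lambda>w. f w + k) = fa_simple_integral W Q f + k"
proof -
  have "fa_simple_integral W Q (\<lambda>w. f w + k) =
      (\<Sum>z\<in>f ` space W. z * Q (f -` {z} \<inter> space W)) + k * (\<Sum>z\<in>f ` space W. Q (f -` {z} \<inter> space W))"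
    unfolding fa_simple_integral_comp[OF Q f, of "\<lambda>x. x + k"]
    by (simp add: algebra_simps sum.distrib sum_distrib_left)
  then show ?thesis
    using \<Delta>_total[OF Q f] by (simp add: fa_simple_integral_def)
qed

lemma fa_simple_integral_const: "Q \<in> \<Delta> W \<Longrightarrow> space W \<noteq> {} \<Longrightarrow> fa_simple_integral W Q (\<lambda>_. k) = k"
  unfolding fa_simple_integral_def by (auto simp: image_constant_conv \<Delta>_def)

lemma fa_simple_integral_le:
  assumes "Q \<in> \<Delta> W" "space W \<noteq> {}" "simple_function W f" "\<And>w. w \<in> space W \<Longrightarrow> f w \<le> B"
  shows "fa_simple_integral W Q f \<le> B"
  using fa_simple_integral_mono[OF assms(1,3) simple_function_const assms(4)]
    fa_simple_integral_const[OF assms(1,2)] by simp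

lemma fa_simple_integral_le_fa_integral:
  assumes "Q \<in> \<Delta> W" "space W \<noteq> {}" "f \<in> bounded_measurable W"
    and g: "simple_function W g" "\<And>w. w \<in> space W \<Longrightarrow> g w \<le> f w"
  shows "fa_simple_integral W Q g \<le> fa_integral W Q f"
proof -
  obtain B where B: "\<And>w. w \<in> space W \<Longrightarrow> \<bar>f w\<bar> \<le> B" using bounded_measurable_bound[OF assms(3)] by blast
  have "fa_simple_integral W Q g \<le> B" if "simple_function W g" "\<forall>w\<in>space W. g w \<le> f w" for g
    using that B by (intro fa_simple_integral_le[OF assms(1,2)]) force+
  then show ?thesis unfolding fa_integral_def
    using g by (intro cSUP_upper) (auto intro!: bdd_aboveI2)
qed

lemma fa_integral_simple:
  assumes "Q \<in> \<Delta> W" "space W \<noteq> {}" "simple_function W f"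
  shows "fa_integral W Q f = fa_simple_integral W Q f"
proof (rule antisym)
  show "fa_integral W Q f \<le> fa_simple_integral W Q f"
    unfolding fa_integral_def using assms
    by (intro cSUP_least) (auto intro: fa_simple_integral_mono)
  show "fa_simple_integral W Q f \<le> fa_integral W Q f"
    using assms by (intro fa_simple_integral_le_fa_integral bounded_measurable_simple) auto
qed

lemma fa_integral_const: "Q \<in> \<Delta> W \<Longrightarrow> space W \<noteq> {} \<Longrightarrow> fa_integral W Q (\<lambda>_. k) = k"
  by (simp add: fa_integral_simple fa_simple_integral_const)

text \<open>\<open>Q\<close> is \<open>L\<close> on indicators. Simple integrals agree with
  \<open>L\<close> by finite linearity, all others because a simple approximation from below loses
  at most \<epsilon>. Both integrals are recorded, as the penalty is written with simple ones and
  the objective with general ones.\<close>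

lemma positive_functional_representation:
  assumes lin: "\<And>f g a b. f \<in> bounded_measurable W \<Longrightarrow> g \<in> bounded_measurable W \<Longrightarrow>
        L (\<lambda>w. a * f w + b * g w) = a * L f + b * L g"
    and pos: "\<And>f. f \<in> bounded_measurable W \<Longrightarrow> (\<And>w. w \<in> space W \<Longrightarrow> 0 \<le> f w) \<Longrightarrow> 0 \<le> L f"
    and one: "L (\<lambda>_. 1) = 1" and ne: "space W \<noteq> {}"
  obtains Q where "Q \<in> \<Delta> W" "\<And>f. f \<in> bounded_measurable W \<Longrightarrow> fa_integral W Q f = L f"
    "\<And>f. simple_function W f \<Longrightarrow> fa_simple_integral W Q f = L f"
proof -
  have mono: "L f \<le> L g"
    if "f \<in> bounded_measurable W" "g \<in> bounded_measurable W" "\<And>w. w \<in> space W \<Longrightarrow> f w \<le> g w" for f g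
    using pos[OF bounded_measurable_lin[OF that(2,1), of 1 "- 1"]] lin[OF that(2,1), of 1 "- 1"] that(3) by auto
  have cong: "L f = L g"
    if "f \<in> bounded_measurable W" "g \<in> bounded_measurable W" "\<And>w. w \<in> space W \<Longrightarrow> f w = g w" for f g
    using mono[of f g] mono[of g f] that by force
  have ind: "indicat_real A \<in> bounded_measurable W" if "A \<in> sets W" for A
    using that by (intro bounded_measurable_simple) auto
  have L0: "L (\<lambda>_. 0) = 0"
    using lin[OF bounded_measurable_const[of 0] bounded_measurable_const[of 0], of 0 0] by simp
  define Q where "Q A = (if A \<in> sets W then L (indicat_real A) else 0)" for A
  have Q: "Q \<in> \<Delta> W" unfolding \<Delta>_def
  proof (intro CollectI conjI allI ballI impI)
    show "Q A = 0" if "A \<notin> sets W" for A using that by (simp add: Q_def)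
    show "0 \<le> Q A" if "A \<in> sets W" for A using that pos[OF ind] by (simp add: Q_def)
    show "Q (space W) = 1"
      using cong[OF ind[OF sets.top] bounded_measurable_const[of 1]] one by (simp add: Q_def)
    show "Q (A \<union> B) = Q A + Q B" if "A \<in> sets W" "B \<in> sets W" "A \<inter> B = {}" for A B
    proof -
      have "indicat_real (A \<union> B) = (\<lambda>w. indicat_real A w + indicat_real B w)"
        using that(3) by (auto simp: fun_eq_iff indicator_def)
      then show ?thesis using lin[OF ind[OF that(1)] ind[OF that(2)], of 1 1] that by (simp add: Q_def)
    qed
  qed
  have simple: "fa_simple_integral W Q f = L f" if f: "simple_function W f" for f
  proof -
    have "(\<Sum>y\<in>Y. y * Q (f -` {y} \<inter> space W)) = L (\<lambda>w. \<Sum>y\<in>Y. y * indicat_real (f -` {y} \<inter> space W) w) \<and>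
       (\<lambda>w. \<Sum>y\<in>Y. y * indicat_real (f -` {y} \<inter> space W) w) \<in> bounded_measurable W"
      if "finite Y" for Y using that
    proof (induction Y)
      case empty
      then show ?case using L0 bounded_measurable_const by simp
    next
      case (insert y Y)
      have A: "f -` {y} \<inter> space W \<in> sets W" using f by (rule simple_functionD)
      show ?case
        using insert lin[OF ind[OF A], of _ y 1] bounded_measurable_lin[OF ind[OF A], of _ y 1] A
        by (simp add: Q_def del: sum_mult_indicator)
    qed
    from this[of "f ` space W"] have 1: "fa_simple_integral W Q f =
        L (\<lambda>w. \<Sum>y\<in>f ` space W. y * indicat_real (f -` {y} \<inter> space W) w)"
      and 2: "(\<lambda>w. \<Sum>y\<in>f ` space W. y * indicat_real (f -` {y} \<inter> space W) w) \<in> bounded_measurable W"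
      using simple_functionD(1)[OF f] unfolding fa_simple_integral_def by auto
    have "(\<Sum>y\<in>f ` space W. y * indicat_real (f -` {y} \<inter> space W) w) = f w" if "w \<in> space W" for w
    proof -
      have "(\<Sum>y\<in>f ` space W. y * indicat_real (f -` {y} \<inter> space W) w) = (\<Sum>y\<in>f ` space W. if y = f w then y else 0)"
        using that by (intro sum.cong) (auto simp: indicator_def)
      then show ?thesis using simple_functionD(1)[OF f] that by (simp del: sum_mult_indicator)
    qed
    then show ?thesis unfolding 1 by (rule cong[OF 2 bounded_measurable_simple[OF f]])
  qed
  have "fa_integral W Q f = L f" if f: "f \<in> bounded_measurable W" for f
  proof (rule antisym)
    show "fa_integral W Q f \<le> L f" unfolding fa_integral_def
    proof (rule cSUP_least)
      obtain B where "\<And>w. w \<in> space W \<Longrightarrow> \<bar>f w\<bar> \<le> B" using bounded_measurable_bound[OF f] by blast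
      then have "(\<lambda>_. - B) \<in> {g. simple_function W g \<and> (\<forall>w\<in>space W. g w \<le> f w)}" by force
      then show "{g. simple_function W g \<and> (\<forall>w\<in>space W. g w \<le> f w)} \<noteq> {}" by blast
      fix g assume "g \<in> {g. simple_function W g \<and> (\<forall>w\<in>space W. g w \<le> f w)}"
      then show "fa_simple_integral W Q g \<le> L f"
        using simple mono[OF bounded_measurable_simple f] by simp
    qed
    show "L f \<le> fa_integral W Q f"
    proof (rule field_le_epsilon)
      fix \<epsilon> :: real assume "0 < \<epsilon>"
      obtain B where B: "\<And>w. w \<in> space W \<Longrightarrow> \<bar>f w\<bar> \<le> B" using bounded_measurable_bound[OF f] by blast
      have "f \<in> borel_measurable W" using f by (simp add: bounded_measurable_def)
      from simple_approx_below[OF this \<open>0 < \<epsilon>\<close>, of "- B" B] B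
      obtain g where g: "simple_function W g"
        "\<And>w. w \<in> space W \<Longrightarrow> - B \<le> g w \<and> g w \<le> f w \<and> f w \<le> g w + \<epsilon>" by (metis abs_le_iff minus_le_iff)
      have gb: "g \<in> bounded_measurable W" using g by (intro bounded_measurable_simple)
      have "L f \<le> L (\<lambda>w. g w + \<epsilon>)" using g gb f by (intro mono bounded_measurable_add_const) auto
      also have "\<dots> = L g + \<epsilon>"
        using lin[OF gb bounded_measurable_const[of 1], of 1 \<epsilon>] one by simp
      also have "L g \<le> fa_integral W Q f"
        using fa_simple_integral_le_fa_integral[OF Q ne f, of g] g simple by simp
      finally show "L f \<le> fa_integral W Q f + \<epsilon>" by simp
    qed
  qed
  with Q simple show ?thesis using that by blast
qed

section \<open>Variational representation of niveloids\<close>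

lemma topspace_weak_star: "topspace (weak_star W) = \<Delta> W"
proof -
  define B where "B = {{Q \<in> \<Delta> W. fa_integral W Q f \<in> T} | f T.
        f \<in> borel_measurable W \<and> bounded (f ` space W) \<and> open T}"
  have "{Q \<in> \<Delta> W. fa_integral W Q (\<lambda>_. 0) \<in> UNIV} \<in> B"
    unfolding B_def by (intro CollectI exI[of _ "\<lambda>_. 0"] exI[of _ UNIV]) (auto simp: bounded_iff)
  then have "\<Delta> W \<in> B" by simp
  moreover have "T \<subseteq> \<Delta> W" if "T \<in> B" for T using that unfolding B_def by blast
  ultimately have "\<Union> B = \<Delta> W" by blast
  then show ?thesis unfolding weak_star_def topology_generated_by_topspace B_def .
qed

definition acts_into :: "'w measure \<Rightarrow> real set \<Rightarrow> ('w \<Rightarrow> real) set" where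
  "acts_into W K = {f. simple_function W f \<and> f ` space W \<subseteq> K}"

text \<open>\<open>K\<close> will be the range of the utility and may be bounded, so every property
  is restricted to functions with values in \<open>K\<close>. Translations are by elements of
  \<open>K\<close>, since a shift arises by adding a constant act, and mixtures are midpoints of
  functions of equal value.\<close>

locale niveloid =
  fixes W :: "'w measure" and K :: "real set" and I :: "('w \<Rightarrow> real) \<Rightarrow> real"
  assumes nonempty: "space W \<noteq> {}"
    and K: "open K" "is_interval K" "0 \<in> K"
    and I_mono: "f \<in> acts_into W K \<Longrightarrow> g \<in> acts_into W K \<Longrightarrow> (\<And>w. w \<in> space W \<Longrightarrow> f w \<le> g w) \<Longrightarrow> I f \<le> I g"
    and I_const: "k \<in> K \<Longrightarrow> I (\<lambda>_. k) = k"
    and I_translate: "f \<in> acts_into W K \<Longrightarrow> k \<in> K \<Longrightarrow> (\<lambda>w. f w + k) \<in> acts_into W K \<Longrightarrow> I (\<lambda>w. f w + k) = I f + k"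
    and I_quasiconcave: "f \<in> acts_into W K \<Longrightarrow> g \<in> acts_into W K \<Longrightarrow> I f = I g \<Longrightarrow> I f \<le> I (\<lambda>w. f w / 2 + g w / 2)"
begin

lemma K_between: "a \<in> K \<Longrightarrow> b \<in> K \<Longrightarrow> a \<le> x \<Longrightarrow> x \<le> b \<Longrightarrow> x \<in> K"
  using K(2) by (rule mem_is_interval_1_I)

lemma K_convex: "a \<in> K \<Longrightarrow> b \<in> K \<Longrightarrow> 0 \<le> t \<Longrightarrow> t \<le> 1 \<Longrightarrow> (1 - t) * a + t * b \<in> K"
  using K(2) convexD_alt[of K a b t] by (simp add: is_interval_convex_1)

lemma acts_into_bounds:
  assumes "f \<in> acts_into W K"
  obtains lo hi where "lo \<in> K" "hi \<in> K" "\<And>w. w \<in> space W \<Longrightarrow> lo \<le> f w \<and> f w \<le> hi"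
proof (rule that)
  have fin: "finite (f ` space W)" "f ` space W \<noteq> {}" "f ` space W \<subseteq> K"
    using assms nonempty unfolding acts_into_def by (auto dest: simple_functionD)
  show "Min (f ` space W) \<in> K" "Max (f ` space W) \<in> K"
    using Min_in[OF fin(1,2)] Max_in[OF fin(1,2)] fin(3) by auto
qed (use assms in \<open>auto simp: acts_into_def dest: simple_functionD\<close>)

lemma acts_intoI:
  "simple_function W f \<Longrightarrow> lo \<in> K \<Longrightarrow> hi \<in> K \<Longrightarrow> (\<And>w. w \<in> space W \<Longrightarrow> lo \<le> f w \<and> f w \<le> hi) \<Longrightarrow> f \<in> acts_into W K"
  unfolding acts_into_def using K_between by blast

lemma acts_into_simple: "f \<in> acts_into W K \<Longrightarrow> simple_function W f"
  by (simp add: acts_into_def)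

lemma acts_into_K: "f \<in> acts_into W K \<Longrightarrow> w \<in> space W \<Longrightarrow> f w \<in> K"
  by (auto simp: acts_into_def)

lemma acts_into_const: "k \<in> K \<Longrightarrow> (\<lambda>_. k) \<in> acts_into W K"
  by (auto simp: acts_into_def)

lemma acts_into_convex:
  assumes "f \<in> acts_into W K" "g \<in> acts_into W K" "0 \<le> t" "t \<le> 1"
  shows "(\<lambda>w. (1 - t) * f w + t * g w) \<in> acts_into W K"
proof -
  have "simple_function W (\<lambda>w. (1 - t) * f w + t * g w)"
    using assms by (intro simple_function_add simple_function_mult simple_function_const) (auto simp: acts_into_def)
  moreover have "(1 - t) * f w + t * g w \<in> K" if "w \<in> space W" for w
    using K_convex acts_into_K assms that by blast
  ultimately show ?thesis by (auto simp: acts_into_def)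
qed

text \<open>The shift \<open>k\<close> is cut into equal steps so short that they lie in a ball
  around 0 inside \<open>K\<close>. The intermediate functions are convex combinations of the first
  and the last one, hence still have values in \<open>K\<close>.\<close>

lemma I_translate_all:
  assumes f: "f \<in> acts_into W K" and fk: "(\<lambda>w. f w + k) \<in> acts_into W K"
  shows "I (\<lambda>w. f w + k) = I f + k"
proof -
  obtain e where e: "e > 0" "ball 0 e \<subseteq> K" using K openE by blast
  obtain n where n: "\<bar>k\<bar> / e < real n" using reals_Archimedean2 by blast
  have "0 \<le> \<bar>k\<bar> / e" using e by simp
  then have n0: "n > 0" using n by (cases n) auto
  define d where "d = k / n"
  have dK: "d \<in> K" using n n0 e unfolding d_def by (intro subsetD[OF e(2)]) (simp add: field_simps)
  have in_i: "(\<lambda>w. f w + real i * d) \<in> acts_into W K" if "i \<le> n" for i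
  proof -
    have "(\<lambda>w. (1 - real i / n) * f w + (real i / n) * (f w + k)) \<in> acts_into W K"
      using that n0 by (intro acts_into_convex[OF f fk]) auto
    moreover have "(1 - real i / n) * f w + (real i / n) * (f w + k) = f w + real i * d" for w
      unfolding d_def by (simp add: algebra_simps add_divide_distrib)
    ultimately show ?thesis by simp
  qed
  have "I (\<lambda>w. f w + real i * d) = I f + real i * d" if "i \<le> n" for i using that
  proof (induction i)
    case (Suc i)
    have "(\<lambda>w. f w + real (Suc i) * d) = (\<lambda>w. (f w + real i * d) + d)" by (auto simp: algebra_simps)
    then show ?case
      using I_translate[OF in_i[of i] dK] in_i[of "Suc i"] Suc by (simp add: algebra_simps)
  qed simp
  from this[of n] show ?thesis using n0 by (simp add: d_def)
qed

lemma I_lipschitz: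
  assumes "f \<in> acts_into W K" "g \<in> acts_into W K" "(\<lambda>w. g w + e) \<in> acts_into W K"
    and "\<And>w. w \<in> space W \<Longrightarrow> f w \<le> g w + e"
  shows "I f \<le> I g + e"
  using I_mono[OF assms(1,3,4)] I_translate_all[OF assms(2,3)] by simp

lemma K_enlarge:
  assumes "lo \<in> K" "hi \<in> K"
  obtains \<delta> where "\<delta> > 0" "lo - \<delta> \<in> K" "hi + \<delta> \<in> K"
proof -
  obtain a b where ab: "a > 0" "ball lo a \<subseteq> K" "b > 0" "ball hi b \<subseteq> K" using K(1) assms openE by metis
  have "lo - min a b / 2 \<in> ball lo a" "hi + min a b / 2 \<in> ball hi b"
    using ab(1,3) by (auto simp: dist_real_def abs_real_def min_def)
  then have "lo - min a b / 2 \<in> K" "hi + min a b / 2 \<in> K" using ab by blast+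
  moreover have "0 < min a b / 2" using ab by simp
  ultimately show ?thesis using that by blast
qed

text \<open>Quasi-concavity compares functions of equal value, and equality can be forced by
  shifting one of them. The shifted function has values in \<open>K\<close> only if the shift is
  small, so the midpoint inequality is obtained for nearby points of the segment;
  \<open>local_midpoint_concave\<close> makes it global.\<close>

lemma I_concave:
  assumes f: "f \<in> acts_into W K" and g: "g \<in> acts_into W K" and t: "0 \<le> t" "t \<le> 1"
  shows "(1 - t) * I f + t * I g \<le> I (\<lambda>w. (1 - t) * f w + t * g w)"
proof -
  obtain l1 h1 where 1: "l1 \<in> K" "h1 \<in> K" "\<And>w. w \<in> space W \<Longrightarrow> l1 \<le> f w \<and> f w \<le> h1"
    using acts_into_bounds[OF f] by blast
  obtain l2 h2 where 2: "l2 \<in> K" "h2 \<in> K" "\<And>w. w \<in> space W \<Longrightarrow> l2 \<le> g w \<and> g w \<le> h2"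
    using acts_into_bounds[OF g] by blast
  define lo hi where "lo = min l1 l2" and "hi = max h1 h2"
  have lohi: "lo \<in> K" "hi \<in> K" unfolding lo_def hi_def min_def max_def using 1(1,2) 2(1,2) by auto
  obtain u where "u \<in> space W" using nonempty by blast
  then have "lo \<le> hi" unfolding lo_def hi_def using 1(3)[of u] by auto
  obtain \<delta> where \<delta>: "\<delta> > 0" "lo - \<delta> \<in> K" "hi + \<delta> \<in> K" using K_enlarge[OF lohi(1,2)] by blast
  define m where "m t = (\<lambda>w. (1 - t) * f w + t * g w)" for t
  have mD: "m t \<in> acts_into W K" if "t \<in> {0..1}" for t unfolding m_def using that acts_into_convex[OF f g] by simp
  have mb: "lo \<le> m t w \<and> m t w \<le> hi" if "t \<in> {0..1}" "w \<in> space W" for t w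
  proof -
    have fg: "f w \<in> {lo..hi}" "g w \<in> {lo..hi}" using 1(3)[OF that(2)] 2(3)[OF that(2)] unfolding lo_def hi_def by auto
    have "m t w \<in> {lo..hi}" using convexD_alt[OF _ fg, of t] that(1) unfolding m_def by simp
    then show ?thesis by simp
  qed
  define C where "C = hi - lo"
  have step: "m t w \<le> m s w + \<bar>t - s\<bar> * C" if "w \<in> space W" for t s w
  proof -
    have "m t w - m s w = (t - s) * (g w - f w)" unfolding m_def by (simp add: algebra_simps)
    also have "\<dots> \<le> \<bar>t - s\<bar> * \<bar>g w - f w\<bar>" by (metis abs_ge_self abs_mult)
    also have "\<dots> \<le> \<bar>t - s\<bar> * C"
      using 1(3)[OF that] 2(3)[OF that] unfolding C_def lo_def hi_def by (intro mult_left_mono) auto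
    finally show ?thesis by simp
  qed
  have shift: "(\<lambda>w. m t w + e) \<in> acts_into W K" if "t \<in> {0..1}" "\<bar>e\<bar> \<le> \<delta>" for t e
    using acts_into_simple[OF mD[OF that(1)]] mb[OF that(1)] that(2)
    by (intro acts_intoI[OF _ \<delta>(2,3)] simple_function_add) force+
  define h where "h t = I (m t)" for t
  have lip: "h t \<le> h s + \<bar>t - s\<bar> * C" if "t \<in> {0..1}" "s \<in> {0..1}" "\<bar>t - s\<bar> * C \<le> \<delta>" for t s
  proof -
    have C0: "0 \<le> \<bar>t - s\<bar> * C" using \<open>lo \<le> hi\<close> unfolding C_def by simp
    show ?thesis unfolding h_def
      using that C0 step by (intro I_lipschitz mD shift) auto
  qed
  \<comment> \<open>Within parameter distance \<open>2 * e0\<close> the values of \<open>h\<close>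
    differ by at most \<delta>, the amount by which functions on the segment may be shifted inside
    \<open>K\<close>. The summand 1 covers \<open>C = 0\<close>.\<close>
  define e0 where "e0 = \<delta> / (2 * (C + 1))"
  have C: "0 \<le> C" using \<open>lo \<le> hi\<close> C_def by simp
  have e0: "e0 > 0" "2 * e0 * C \<le> \<delta>" unfolding e0_def using \<delta> C by (auto simp: field_simps)
  have cont: "continuous_on {0..1} h"
  proof (rule continuous_onI)
    fix t \<epsilon> :: real assume t: "t \<in> {0..1}" and "\<epsilon> > 0"
    define \<mu> where "\<mu> = min \<delta> \<epsilon>"
    define d where "d = \<mu> / (2 * (C + 1))"
    have \<mu>: "0 < \<mu>" "\<mu> \<le> \<delta>" "\<mu> \<le> \<epsilon>" unfolding \<mu>_def using \<delta> \<open>\<epsilon> > 0\<close> by auto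
    have "d * C < \<mu>" unfolding d_def using C \<mu>(1) by (simp add: field_simps add_nonneg_pos)
    then have d: "d > 0" "d * C \<le> \<delta>" "d * C < \<epsilon>" using \<mu> C unfolding d_def by auto
    have "dist (h s) (h t) \<le> \<epsilon>" if "s \<in> {0..1}" "dist s t < d" for s
    proof -
      have "\<bar>s - t\<bar> * C \<le> d * C" using that C by (intro mult_right_mono) (auto simp: dist_real_def)
      then have "\<bar>s - t\<bar> * C \<le> \<delta>" "\<bar>s - t\<bar> * C \<le> \<epsilon>" using d by auto
      then show ?thesis using lip[OF that(1) t] lip[OF t that(1)]
        by (auto simp: dist_real_def abs_minus_commute)
    qed
    then show "\<exists>d>0. \<forall>s\<in>{0..1}. dist s t < d \<longrightarrow> dist (h s) (h t) \<le> \<epsilon>" using d by blast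
  qed
  have mid: "(h (s - e) + h (s + e)) / 2 \<le> h s" if s: "0 \<le> e" "e \<le> e0" "0 \<le> s - e" "s + e \<le> 1" for s e
  proof -
    have se: "s - e \<in> {0..1}" "s + e \<in> {0..1}" "s \<in> {0..1}" using s by auto
    have "2 * e * C \<le> 2 * e0 * C" using s C by (intro mult_right_mono) auto
    then have ed: "2 * e * C \<le> \<delta>" using e0 by simp
    \<comment> \<open>The shift that gives both ends the same value; half of it reappears at the
      midpoint and cancels in the final inequality.\<close>
    define d where "d = h (s - e) - h (s + e)"
    have d: "\<bar>d\<bar> \<le> \<delta>"
      using lip[OF se(1,2)] lip[OF se(2,1)] s ed unfolding d_def by auto
    have eq: "I (\<lambda>w. m (s + e) w + d) = h (s - e)"
      using I_translate_all[OF mD[OF se(2)] shift[OF se(2) d]] unfolding h_def d_def by simp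
    have "I (m (s - e)) \<le> I (\<lambda>w. m (s - e) w / 2 + (m (s + e) w + d) / 2)"
      using mD[OF se(1)] shift[OF se(2) d] eq by (intro I_quasiconcave) (auto simp: h_def)
    also have "(\<lambda>w. m (s - e) w / 2 + (m (s + e) w + d) / 2) = (\<lambda>w. m s w + d / 2)"
      unfolding m_def by (auto simp: fun_eq_iff field_simps)
    also have "I (\<lambda>w. m s w + d / 2) = h s + d / 2"
      unfolding h_def using d by (intro I_translate_all mD shift se) auto
    finally show ?thesis unfolding h_def[symmetric] d_def by (simp add: diff_divide_distrib add_divide_distrib)
  qed
  have "(1 - t) * h 0 + t * h 1 \<le> h t"
    using t by (intro local_midpoint_concave[OF cont e0(1) mid]) auto
  then show ?thesis unfolding h_def m_def by simp
qed

text \<open>The smallest translation invariant extension of \<open>I\<close> to all bounded functions.\<close>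

definition ext_values :: "('w \<Rightarrow> real) \<Rightarrow> real set" where
  "ext_values h = {I f + k | f k. f \<in> acts_into W K \<and> (\<forall>w\<in>space W. f w + k \<le> h w)}"

definition ext :: "('w \<Rightarrow> real) \<Rightarrow> real" where
  "ext h = Sup (ext_values h)"

lemma I_le: "f \<in> acts_into W K \<Longrightarrow> (\<And>w. w \<in> space W \<Longrightarrow> f w \<le> B) \<Longrightarrow> I f \<le> B"
proof -
  assume f: "f \<in> acts_into W K" and B: "\<And>w. w \<in> space W \<Longrightarrow> f w \<le> B"
  define M where "M = Max (f ` space W)"
  have fin: "finite (f ` space W)" "f ` space W \<noteq> {}" "f ` space W \<subseteq> K"
    using f nonempty unfolding acts_into_def by (auto dest: simple_functionD)
  have M: "M \<in> K" "M \<le> B" unfolding M_def using Max_in[OF fin(1,2)] fin(3) B by auto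
  have "I f \<le> I (\<lambda>_. M)" unfolding M_def[symmetric] using fin M(1)
    by (intro I_mono f acts_into_const) (auto simp: M_def)
  then show "I f \<le> B" using I_const M by simp
qed

lemma ext_values_bdd:
  assumes "h \<in> bounded_measurable W"
  shows "bdd_above (ext_values h)" and "ext_values h \<noteq> {}"
proof -
  obtain B where B: "\<And>w. w \<in> space W \<Longrightarrow> \<bar>h w\<bar> \<le> B" using bounded_measurable_bound[OF assms] by blast
  show "bdd_above (ext_values h)"
  proof (rule bdd_aboveI[of _ B])
    fix x assume "x \<in> ext_values h"
    then obtain f k where *: "x = I f + k" "f \<in> acts_into W K" "\<forall>w\<in>space W. f w + k \<le> h w"
      unfolding ext_values_def by auto
    have "I f \<le> B - k" using * B by (intro I_le) force+
    then show "x \<le> B" using * by simp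
  qed
  have "I (\<lambda>_. 0) + (- B) \<in> ext_values h"
    unfolding ext_values_def using acts_into_const[OF K(3)] B by (intro CollectI exI[of _ "\<lambda>_. 0"] exI[of _ "- B"]) force
  then show "ext_values h \<noteq> {}" by blast
qed

lemma ext_ge:
  "h \<in> bounded_measurable W \<Longrightarrow> f \<in> acts_into W K \<Longrightarrow> (\<And>w. w \<in> space W \<Longrightarrow> f w + k \<le> h w) \<Longrightarrow> I f + k \<le> ext h"
  unfolding ext_def using ext_values_bdd(1) by (intro cSup_upper) (auto simp: ext_values_def)

lemma ext_le:
  assumes "h \<in> bounded_measurable W"
    and "\<And>f k. f \<in> acts_into W K \<Longrightarrow> (\<And>w. w \<in> space W \<Longrightarrow> f w + k \<le> h w) \<Longrightarrow> I f + k \<le> c"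
  shows "ext h \<le> c"
  unfolding ext_def using ext_values_bdd(2)[OF assms(1)] assms(2)
  by (intro cSup_least) (auto simp: ext_values_def)

lemma ext_mono:
  assumes "h \<in> bounded_measurable W" "g \<in> bounded_measurable W" "\<And>w. w \<in> space W \<Longrightarrow> h w \<le> g w"
  shows "ext h \<le> ext g"
  using assms(1) by (rule ext_le) (use assms ext_ge order_trans in blast)

lemma ext_translate_ge:
  assumes h: "h \<in> bounded_measurable W"
  shows "ext h + c \<le> ext (\<lambda>w. h w + c)"
proof -
  have "ext h \<le> ext (\<lambda>w. h w + c) - c"
  proof (rule ext_le[OF h])
    fix f k assume "f \<in> acts_into W K" "\<And>w. w \<in> space W \<Longrightarrow> f w + k \<le> h w"
    then have "I f + (k + c) \<le> ext (\<lambda>w. h w + c)"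
      by (intro ext_ge bounded_measurable_add_const h) (auto simp: add.assoc[symmetric])
    then show "I f + k \<le> ext (\<lambda>w. h w + c) - c" by simp
  qed
  then show ?thesis by simp
qed

lemma ext_approx:
  assumes h: "h \<in> bounded_measurable W" and "0 < \<epsilon>"
  obtains f k where "ext h - \<epsilon> < I f + k" "f \<in> acts_into W K" "\<forall>w\<in>space W. f w + k \<le> h w"
proof -
  have "ext h - \<epsilon> < Sup (ext_values h)" unfolding ext_def using \<open>0 < \<epsilon>\<close> by simp
  then obtain x where "x \<in> ext_values h" "ext h - \<epsilon> < x"
    using less_cSupE[OF _ ext_values_bdd(2)[OF h]] by metis
  then show ?thesis using that unfolding ext_values_def by blast
qed

lemma ext_concave:
  assumes h: "h1 \<in> bounded_measurable W" "h2 \<in> bounded_measurable W" and t: "0 \<le> t" "t \<le> 1"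
  shows "(1 - t) * ext h1 + t * ext h2 \<le> ext (\<lambda>w. (1 - t) * h1 w + t * h2 w)"
proof (rule field_le_epsilon)
  fix \<epsilon> :: real assume \<epsilon>: "0 < \<epsilon>"
  obtain f1 k1 where 1: "ext h1 - \<epsilon> < I f1 + k1" "f1 \<in> acts_into W K" "\<forall>w\<in>space W. f1 w + k1 \<le> h1 w"
    using ext_approx[OF h(1) \<epsilon>] by blast
  obtain f2 k2 where 2: "ext h2 - \<epsilon> < I f2 + k2" "f2 \<in> acts_into W K" "\<forall>w\<in>space W. f2 w + k2 \<le> h2 w"
    using ext_approx[OF h(2) \<epsilon>] by blast
  have "(1 - t) * (ext h1 - \<epsilon>) + t * (ext h2 - \<epsilon>) \<le> (1 - t) * (I f1 + k1) + t * (I f2 + k2)"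
    using 1 2 t by (intro add_mono mult_left_mono) auto
  also have "\<dots> = ((1 - t) * I f1 + t * I f2) + ((1 - t) * k1 + t * k2)" by (simp add: algebra_simps)
  also have "\<dots> \<le> I (\<lambda>w. (1 - t) * f1 w + t * f2 w) + ((1 - t) * k1 + t * k2)"
    using I_concave[OF 1(2) 2(2) t] by simp
  also have "\<dots> \<le> ext (\<lambda>w. (1 - t) * h1 w + t * h2 w)"
  proof (rule ext_ge)
    fix w assume w: "w \<in> space W"
    have "(1 - t) * (f1 w + k1) + t * (f2 w + k2) \<le> (1 - t) * h1 w + t * h2 w"
      using 1 2 t w by (intro add_mono mult_left_mono) auto
    then show "(1 - t) * f1 w + t * f2 w + ((1 - t) * k1 + t * k2) \<le> (1 - t) * h1 w + t * h2 w"
      by (simp add: algebra_simps)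
  qed (use acts_into_convex[OF 1(2) 2(2) t] bounded_measurable_lin[OF h] in auto)
  finally show "(1 - t) * ext h1 + t * ext h2 \<le> ext (\<lambda>w. (1 - t) * h1 w + t * h2 w) + \<epsilon>"
    by (simp add: algebra_simps)
qed

text \<open>The criterion by which the value of a general act is recognised: \<open>c\<close> only
  has to be compared with \<open>I\<close> on simple functions below and above \<open>h\<close>
  whose values are in \<open>K\<close>.\<close>

lemma ext_eqI:
  assumes h: "h \<in> bounded_measurable W" and lohi: "lo \<in> K" "hi \<in> K"
    and bnd: "\<And>w. w \<in> space W \<Longrightarrow> lo \<le> h w \<and> h w \<le> hi"
    and below: "\<And>f. f \<in> acts_into W K \<Longrightarrow> (\<And>w. w \<in> space W \<Longrightarrow> f w \<le> h w) \<Longrightarrow> I f \<le> c"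
    and above: "\<And>f. f \<in> acts_into W K \<Longrightarrow> (\<And>w. w \<in> space W \<Longrightarrow> h w \<le> f w) \<Longrightarrow> c \<le> I f"
  shows "ext h = c"
proof (rule antisym)
  show "ext h \<le> c"
  proof (rule ext_le[OF h])
    fix f k assume f: "f \<in> acts_into W K" and le: "\<And>w. w \<in> space W \<Longrightarrow> f w + k \<le> h w"
    \<comment> \<open>A competitor \<open>f + k\<close> may dip below \<open>lo\<close> and out of
      \<open>K\<close>. Cutting it off at \<open>lo\<close> can only raise \<open>I\<close> and
      keeps it below \<open>h\<close>. If \<open>f + k\<close> never reaches \<open>lo\<close>, then
      \<open>f\<close> lies below the constant \<open>lo - k\<close> and the bound is
      immediate.\<close>
    define g where "g w = max (f w) (lo - k)" for w
    show "I f + k \<le> c"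
    proof (cases "\<exists>w\<in>space W. lo \<le> f w + k")
      case True
      then obtain u where u: "u \<in> space W" "lo - k \<le> f u" by auto
      obtain l1 h1 where 1: "l1 \<in> K" "h1 \<in> K" "\<And>w. w \<in> space W \<Longrightarrow> l1 \<le> f w \<and> f w \<le> h1"
        using acts_into_bounds[OF f] by blast
      have sg: "simple_function W g" unfolding g_def
        by (rule simple_function_compose1[OF acts_into_simple[OF f]])
      then have gD: "g \<in> acts_into W K" by (rule acts_intoI[OF _ 1(1,2)]) (use 1(3) u in \<open>force simp: g_def\<close>)
      have gk: "(\<lambda>w. g w + k) \<in> acts_into W K"
        using sg bnd le by (intro acts_intoI[OF _ lohi] simple_function_add) (fastforce simp: g_def)+
      have "I f \<le> I g" by (rule I_mono[OF f gD]) (simp add: g_def)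
      moreover have "I (\<lambda>w. g w + k) \<le> c"
        by (rule below[OF gk]) (use le bnd in \<open>force simp: g_def\<close>)
      ultimately show ?thesis using I_translate_all[OF gD gk] by simp
    next
      case False
      then have "I f \<le> lo - k" using f by (intro I_le) force+
      moreover have "lo \<le> c" using below[OF acts_into_const[OF lohi(1)]] I_const[OF lohi(1)] bnd by simp
      ultimately show ?thesis by simp
    qed
  qed
  show "c \<le> ext h"
  proof (rule field_le_epsilon)
    fix \<epsilon>' :: real assume "0 < \<epsilon>'"
    \<comment> \<open>Room above \<open>hi\<close>, so that the approximation from below can be
      lifted over \<open>h\<close> without leaving \<open>K\<close>.\<close>
    obtain \<delta> where \<delta>: "\<delta> > 0" "lo - \<delta> \<in> K" "hi + \<delta> \<in> K" using K_enlarge[OF lohi] by blast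
    define \<epsilon> where "\<epsilon> = min \<epsilon>' \<delta>"
    have \<epsilon>: "0 < \<epsilon>" "\<epsilon> \<le> \<epsilon>'" "\<epsilon> \<le> \<delta>" unfolding \<epsilon>_def using \<open>0 < \<epsilon>'\<close> \<delta> by auto
    have "h \<in> borel_measurable W" using h by (simp add: bounded_measurable_def)
    from simple_approx_below[OF this \<epsilon>(1) bnd]
    obtain g where g: "simple_function W g"
      "\<And>w. w \<in> space W \<Longrightarrow> lo \<le> g w \<and> g w \<le> h w \<and> h w \<le> g w + \<epsilon>" by blast
    have gD: "g \<in> acts_into W K" using g bnd by (intro acts_intoI[OF _ lohi]) force+
    have g\<epsilon>: "(\<lambda>w. g w + \<epsilon>) \<in> acts_into W K"
      using g bnd \<epsilon> by (intro acts_intoI[OF _ lohi(1) \<delta>(3)] simple_function_add) fastforce+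
    have "c \<le> I (\<lambda>w. g w + \<epsilon>)" by (rule above[OF g\<epsilon>]) (use g in auto)
    also have "\<dots> = I g + \<epsilon>" by (rule I_translate_all[OF gD g\<epsilon>])
    finally have "c \<le> I g + \<epsilon>" .
    moreover have "I g + 0 \<le> ext h" using g by (intro ext_ge h gD) auto
    ultimately show "c \<le> ext h + \<epsilon>'" using \<epsilon> by simp
  qed
qed

section \<open>The penalty as a convex conjugate\<close>

definition penalty :: "('w set \<Rightarrow> real) \<Rightarrow> ereal" where
  "penalty Q = (SUP f\<in>acts_into W K. ereal (I f - fa_simple_integral W Q f))"

lemma penalty_ge: "f \<in> acts_into W K \<Longrightarrow> ereal (I f - fa_simple_integral W Q f) \<le> penalty Q"
  unfolding penalty_def by (rule SUP_upper)

lemma penalty_nonneg: "Q \<in> \<Delta> W \<Longrightarrow> 0 \<le> penalty Q"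
  using penalty_ge[OF acts_into_const[OF K(3)], of Q] I_const[OF K(3)] nonempty
  by (simp add: fa_simple_integral_const zero_ereal_def)

text \<open>The penalty tests only simple functions with values in \<open>K\<close>, but every
  competitor \<open>f + k\<close> in the definition of \<open>ext\<close> is a shift of one of them,
  and shifts cancel against the integral.\<close>

lemma ext_le_penalty:
  assumes Q: "Q \<in> \<Delta> W" and h: "h \<in> bounded_measurable W"
  shows "ereal (ext h) \<le> ereal (fa_integral W Q h) + penalty Q"
proof (cases "penalty Q")
  case (real c)
  have "ext h \<le> fa_integral W Q h + c"
  proof (rule ext_le[OF h])
    fix f k assume f: "f \<in> acts_into W K" and le: "\<And>w. w \<in> space W \<Longrightarrow> f w + k \<le> h w"
    have "I f - fa_simple_integral W Q f \<le> c" using penalty_ge[OF f, of Q] real by simp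
    moreover have "fa_simple_integral W Q f + k \<le> fa_integral W Q h"
      using fa_simple_integral_le_fa_integral[OF Q nonempty h, of "\<lambda>w. f w + k"] le
        fa_simple_integral_add_const[OF Q acts_into_simple[OF f], of k] acts_into_simple[OF f] by simp
    ultimately show "I f + k \<le> fa_integral W Q h + c" by simp
  qed
  then show ?thesis using real by simp
qed (use penalty_nonneg[OF Q] in auto)

text \<open>The linear functional dominated by the convex \<open>p\<close> is a supergradient of
  \<open>ext\<close> at \<open>h\<close>. Monotonicity of \<open>ext\<close> makes it positive and
  translations by 1 and -1 normalise it, so it is integration against some \<open>Q\<close>, at
  which the conjugate inequality is tight.\<close>

lemma ext_attained:
  assumes h: "h \<in> bounded_measurable W"
  obtains Q where "Q \<in> \<Delta> W" "ereal (ext h) = ereal (fa_integral W Q h) + penalty Q"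
proof -
  let ?X = "bounded_measurable W"
  define p where "p f = ext h - ext (\<lambda>w. h w - f w)" for f
  have diff: "(\<lambda>w. h w - f w) \<in> ?X" if "f \<in> ?X" for f
    using bounded_measurable_lin[OF h that, of 1 "- 1"] by simp
  obtain L where L: "\<And>f. f \<in> ?X \<Longrightarrow> L f \<le> p f"
    "\<And>f g a b. f \<in> ?X \<Longrightarrow> g \<in> ?X \<Longrightarrow> L (\<lambda>x. a * f x + b * g x) = a * L f + b * L g"
  proof (rule hahn_banach_convex[of ?X p])
    fix f g :: "'w \<Rightarrow> real" and t :: real assume f: "f \<in> ?X" "g \<in> ?X" and t: "0 \<le> t" "t \<le> 1"
    have "(\<lambda>w. (1 - t) * (h w - f w) + t * (h w - g w)) = (\<lambda>w. h w - ((1 - t) * f w + t * g w))"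
      by (auto simp: fun_eq_iff algebra_simps)
    then show "p (\<lambda>w. (1 - t) * f w + t * g w) \<le> (1 - t) * p f + t * p g"
      using ext_concave[OF diff[OF f(1)] diff[OF f(2)] t] unfolding p_def by (simp add: algebra_simps)
  qed (auto simp: p_def bounded_measurable_const bounded_measurable_lin)
  have neg: "L (\<lambda>w. - f w) = - L f" if "f \<in> ?X" for f
    using L(2)[OF that that, of "- 1" 0] by simp
  have support: "ext g - ext h \<le> L g - L h" if g: "g \<in> ?X" for g
  proof -
    have "L (\<lambda>w. 1 * h w + (- 1) * g w) \<le> p (\<lambda>w. 1 * h w + (- 1) * g w)"
      by (rule L(1)[OF bounded_measurable_lin[OF h g]])
    then show ?thesis unfolding L(2)[OF h g] p_def by simp
  qed
  have pos: "0 \<le> L f" if f: "f \<in> ?X" "\<And>w. w \<in> space W \<Longrightarrow> 0 \<le> f w" for f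
  proof -
    have nf: "(\<lambda>w. - f w) \<in> ?X" using bounded_measurable_lin[OF f(1) f(1), of "- 1" 0] by simp
    have "L (\<lambda>w. - f w) \<le> p (\<lambda>w. - f w)" by (rule L(1)[OF nf])
    also have "\<dots> \<le> 0" unfolding p_def using ext_mono[OF h diff[OF nf]] f(2) by simp
    finally show ?thesis using neg[OF f(1)] by simp
  qed
  have "L (\<lambda>_. 1) \<le> 1"
    using L(1)[OF bounded_measurable_const[of 1]] ext_translate_ge[OF h, of "- 1"] unfolding p_def by simp
  moreover have "L (\<lambda>_. - 1) \<le> - 1"
    using L(1)[OF bounded_measurable_const[of "- 1"]] ext_translate_ge[OF h, of 1] unfolding p_def by simp
  ultimately have one: "L (\<lambda>_. 1) = 1" using neg[OF bounded_measurable_const[of 1]] by simp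
  obtain Q where Q: "Q \<in> \<Delta> W" "\<And>f. f \<in> ?X \<Longrightarrow> fa_integral W Q f = L f"
    "\<And>f. simple_function W f \<Longrightarrow> fa_simple_integral W Q f = L f"
    by (rule positive_functional_representation[where L = L, OF L(2) pos one nonempty]) blast+
  have "penalty Q \<le> ereal (ext h - L h)" unfolding penalty_def
  proof (rule SUP_least)
    fix f assume f: "f \<in> acts_into W K"
    then have fX: "f \<in> ?X" by (intro bounded_measurable_simple acts_into_simple)
    have "I f + 0 \<le> ext f" using f by (intro ext_ge fX) auto
    then show "ereal (I f - fa_simple_integral W Q f) \<le> ereal (ext h - L h)"
      using support[OF fX] Q(3)[OF acts_into_simple[OF f]] by simp
  qed
  then have "ereal (fa_integral W Q h) + penalty Q \<le> ereal (L h) + ereal (ext h - L h)"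
    unfolding Q(2)[OF h] by (rule add_left_mono)
  then have "ereal (ext h) = ereal (fa_integral W Q h) + penalty Q"
    using ext_le_penalty[OF Q(1) h] by (intro antisym) auto
  then show ?thesis using that Q(1) by blast
qed

lemma ext_0: "ext (\<lambda>_. 0) = 0"
  using I_const[OF K(3)] I_mono[OF acts_into_const[OF K(3)]] I_mono[OF _ acts_into_const[OF K(3)]]
  by (intro ext_eqI[OF bounded_measurable_const K(3,3)]) auto

text \<open>Groundedness is attainment at the zero function. Convexity and closed sublevel sets hold
  because the penalty is a supremum of functions of \<open>Q\<close> that are affine and weak-star
  continuous on \<Delta>.\<close>

lemma is_penalty_penalty: "is_penalty W penalty"
  unfolding is_penalty_def
proof (intro conjI ballI allI)
  obtain Q where "Q \<in> \<Delta> W" "ereal (ext (\<lambda>_. 0)) = ereal (fa_integral W Q (\<lambda>_. 0)) + penalty Q"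
    using ext_attained[OF bounded_measurable_const] by blast
  then have "penalty Q = 0" using nonempty by (simp add: ext_0 fa_integral_const zero_ereal_def[symmetric])
  then show "grounded W penalty" unfolding grounded_def using penalty_nonneg \<open>Q \<in> \<Delta> W\<close> by blast
next
  fix Q Q' and \<alpha> :: real assume Q: "Q \<in> \<Delta> W" "Q' \<in> \<Delta> W" and \<alpha>: "\<alpha> \<in> {0..1}"
  show "penalty (\<lambda>A. \<alpha> * Q A + (1 - \<alpha>) * Q' A) \<le> ereal \<alpha> * penalty Q + ereal (1 - \<alpha>) * penalty Q'"
    unfolding penalty_def[of "\<lambda>A. \<alpha> * Q A + (1 - \<alpha>) * Q' A"]
  proof (rule SUP_least)
    fix f assume f: "f \<in> acts_into W K"
    have "ereal (I f - fa_simple_integral W (\<lambda>A. \<alpha> * Q A + (1 - \<alpha>) * Q' A) f) =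
        ereal \<alpha> * ereal (I f - fa_simple_integral W Q f) + ereal (1 - \<alpha>) * ereal (I f - fa_simple_integral W Q' f)"
      by (simp add: fa_simple_integral_def algebra_simps sum.distrib sum_distrib_left sum_subtractf)
    also have "\<dots> \<le> ereal \<alpha> * penalty Q + ereal (1 - \<alpha>) * penalty Q'"
      using \<alpha> penalty_ge[OF f] by (intro add_mono ereal_mult_left_mono) auto
    finally show "ereal (I f - fa_simple_integral W (\<lambda>A. \<alpha> * Q A + (1 - \<alpha>) * Q' A) f) \<le>
      ereal \<alpha> * penalty Q + ereal (1 - \<alpha>) * penalty Q'" .
  qed
next
  fix a :: ereal
  have op: "openin (weak_star W) {Q \<in> \<Delta> W. a < ereal (I f - fa_simple_integral W Q f)}" if f: "f \<in> acts_into W K" for f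
  proof -
    define T where "T = {x. a < ereal (I f - x)}"
    have "T = (\<lambda>x. ereal (I f - x)) -` {a<..}" by (auto simp: T_def)
    then have "open T" by (auto intro!: open_vimage continuous_intros)
    have "f \<in> bounded_measurable W" using f by (intro bounded_measurable_simple acts_into_simple)
    then have fb: "f \<in> borel_measurable W" "bounded (f ` space W)" by (auto simp: bounded_measurable_def)
    have "openin (weak_star W) {Q \<in> \<Delta> W. fa_integral W Q f \<in> T}"
      unfolding weak_star_def using \<open>open T\<close> fb by (intro topology_generated_by_Basis) blast
    moreover have "{Q \<in> \<Delta> W. fa_integral W Q f \<in> T} = {Q \<in> \<Delta> W. a < ereal (I f - fa_simple_integral W Q f)}"
      using fa_integral_simple[OF _ nonempty acts_into_simple[OF f]] by (auto simp: T_def)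
    ultimately show ?thesis by simp
  qed
  have "\<Delta> W - {Q \<in> \<Delta> W. penalty Q \<le> a} =
     (\<Union>f\<in>acts_into W K. {Q \<in> \<Delta> W. a < ereal (I f - fa_simple_integral W Q f)})"
    unfolding penalty_def by (auto simp: SUP_le_iff not_le)
  then have "openin (weak_star W) (\<Delta> W - {Q \<in> \<Delta> W. penalty Q \<le> a})" using op by auto
  then show "closedin (weak_star W) {Q \<in> \<Delta> W. penalty Q \<le> a}"
    unfolding closedin_def topspace_weak_star by blast
qed

end

section \<open>Risk preferences\<close>

definition lift :: "('s \<Rightarrow> real) \<Rightarrow> ('w, 's) act" where
  "lift x = (\<lambda>(w, s). x s)"

definition bet_cdf :: "real \<Rightarrow> real \<Rightarrow> real \<Rightarrow> real \<Rightarrow> real" where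
  "bet_cdf p x y t = (if x \<le> t then p else 0) + (if y \<le> t then 1 - p else 0)"

locale preference = prob_space P for P :: "'s measure" +
  fixes W :: "'w measure" and R :: "('w, 's) pref"
  assumes states: "space W \<noteq> {}"
    and uniform: "supports_uniform P"
    and rational: "satisfies_axioms W P R"
begin

lemma space_S: "space P \<noteq> {}" by (rule not_empty)

lemma section_measurable: "v \<in> tV0 W P \<Longrightarrow> w \<in> space W \<Longrightarrow> (\<lambda>s. v (w, s)) \<in> borel_measurable P"
  unfolding tV0_def tV_def by (auto intro: measurable_Pair2)

lemma section_finite: "v \<in> tV0 W P \<Longrightarrow> w \<in> space W \<Longrightarrow> finite ((\<lambda>s. v (w, s)) ` space P)"
  unfolding tV0_def by (auto simp: space_pair_measure elim!: finite_subset[rotated])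

lemma tV0I:
  "v \<in> borel_measurable (W \<Otimes>\<^sub>M P) \<Longrightarrow> finite (v ` (space W \<times> space P)) \<Longrightarrow> v \<in> tV0 W P"
  unfolding tV0_def tV_def by (auto simp: space_pair_measure finite_imp_bounded)

lemma V0_tV0: "v \<in> V0 W P \<Longrightarrow> v \<in> tV0 W P"
  unfolding V0_def by simp

lemma FV_eq: "v \<in> V0 W P \<Longrightarrow> w \<in> space W \<Longrightarrow> FV W P v = F P v w"
proof -
  assume v: "v \<in> V0 W P" and w: "w \<in> space W"
  have "\<forall>w'\<in>space W. F P v w' = F P v w" using v w unfolding V0_def by blast
  then show ?thesis unfolding FV_def using w by (intro the_equality) metis+
qed

lemma lift_V0: "x \<in> borel_measurable P \<Longrightarrow> finite (x ` space P) \<Longrightarrow> lift x \<in> V0 W P"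
  unfolding V0_def F_def lift_def
  by (auto intro!: tV0I elim!: finite_subset[rotated])

lemma F_lift: "F P (lift x) w = rv_cdf P x"
  by (simp add: F_def lift_def)

lemma FV_lift: "x \<in> borel_measurable P \<Longrightarrow> finite (x ` space P) \<Longrightarrow> FV W P (lift x) = rv_cdf P x"
  using FV_eq[OF lift_V0] states F_lift by fastforce

lemma const_V0: "const m \<in> V0 W P"
  unfolding V0_def F_def by (auto intro!: tV0I simp: image_constant_conv)

lemma const_tV0: "const m \<in> tV0 W P" using const_V0 by (rule V0_tV0)

lemma bet_V0: "A \<in> sets P \<Longrightarrow> bet t A x \<in> V0 W P"
proof -
  assume "A \<in> sets P"
  then have "lift (\<lambda>s. if s \<in> A then t else x) \<in> V0 W P"
    by (intro lift_V0) (auto intro: finite_subset[of _ "{t, x}"])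
  then show ?thesis by (simp add: lift_def bet_def)
qed

lemma F_bet:
  assumes "A \<in> sets P"
  shows "F P (bet t A x) w = bet_cdf (prob A) t x"
proof
  fix a
  have *: "{s \<in> space P. (if s \<in> A then t else x) \<le> a} =
      (if t \<le> a then A else {}) \<union> (if x \<le> a then space P - A else {})"
    using sets.sets_into_space[OF assms] by auto
  show "F P (bet t A x) w a = bet_cdf (prob A) t x a"
    unfolding F_def rv_cdf_def bet_def bet_cdf_def using assms * prob_compl[OF assms]
    by (auto simp: prob_space Un_absorb1 sets.sets_into_space)
qed

lemma F_const: "F P (const x) w = bet_cdf p x x"
  unfolding F_def rv_cdf_def bet_cdf_def by (auto simp: fun_eq_iff prob_space)

lemma FV_const: "FV W P (const x) = bet_cdf p x x"
proof -
  obtain w where w: "w \<in> space W" using states by blast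
  show ?thesis using FV_eq[OF const_V0 w, of x] F_const[of x w p] by simp
qed

lemma FV_bet: "A \<in> sets P \<Longrightarrow> FV W P (bet t A x) = bet_cdf (prob A) t x"
  using FV_eq[OF bet_V0] F_bet states by (metis all_not_in_conv)

lemma total: "v \<in> tV0 W P \<Longrightarrow> u \<in> tV0 W P \<Longrightarrow> R v u \<or> R u v"
  using rational unfolding satisfies_axioms_def A1_def by blast

lemma refl: "v \<in> tV0 W P \<Longrightarrow> R v v"
  using total by blast

lemma trans: "R v u \<Longrightarrow> R u r \<Longrightarrow> v \<in> tV0 W P \<Longrightarrow> u \<in> tV0 W P \<Longrightarrow> r \<in> tV0 W P \<Longrightarrow> R v r"
  using rational unfolding satisfies_axioms_def A1_def by blast

lemma strict_trans1: "strict R v u \<Longrightarrow> R u r \<Longrightarrow> v \<in> tV0 W P \<Longrightarrow> u \<in> tV0 W P \<Longrightarrow> r \<in> tV0 W P \<Longrightarrow> strict R v r"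
  and strict_trans2: "R v u \<Longrightarrow> strict R u r \<Longrightarrow> v \<in> tV0 W P \<Longrightarrow> u \<in> tV0 W P \<Longrightarrow> r \<in> tV0 W P \<Longrightarrow> strict R v r"
  using trans[of v u r] trans[of u r v] trans[of r v u] unfolding strict_def by blast+

lemma same_law: "v \<in> tV0 W P \<Longrightarrow> u \<in> tV0 W P \<Longrightarrow> (\<And>w. w \<in> space W \<Longrightarrow> F P v w = F P u w) \<Longrightarrow> indiff R v u"
  using rational unfolding satisfies_axioms_def A2_def by blast

lemma dominance: "v \<in> V0 W P \<Longrightarrow> u \<in> V0 W P \<Longrightarrow> (\<And>t. FV W P v t \<le> FV W P u t) \<Longrightarrow> R v u"
  and strict_dominance: "v \<in> V0 W P \<Longrightarrow> u \<in> V0 W P \<Longrightarrow> (\<And>t. FV W P v t \<le> FV W P u t) \<Longrightarrow>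
    FV W P v t < FV W P u t \<Longrightarrow> strict R v u"
  using rational unfolding satisfies_axioms_def A4_def by blast+

lemma const_less: "m < n \<Longrightarrow> strict R (const n) (const m)"
  using strict_dominance[OF const_V0 const_V0, of n m m] FV_const[of _ 1] by (auto simp: bet_cdf_def)

lemma const_iff: "R (const m) (const n) \<longleftrightarrow> n \<le> m"
  using const_less[of m n] const_less[of n m] refl[OF const_tV0[of m]]
  unfolding strict_def by (cases m n rule: linorder_cases) auto

lemma section_dominance:
  assumes "v \<in> tV0 W P" "u \<in> tV0 W P"
    and "\<And>w. w \<in> space W \<Longrightarrow> R (lift (\<lambda>s. v (w, s))) (lift (\<lambda>s. u (w, s)))"
  shows "R v u"
proof -
  have "section_pref W P R v u w" if w: "w \<in> space W" for w
    unfolding section_pref_def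
  proof (intro bexI conjI)
    show "FV W P (lift (\<lambda>s. v (w, s))) = F P v w" "FV W P (lift (\<lambda>s. u (w, s))) = F P u w"
      using FV_lift section_measurable section_finite assms w unfolding F_def by blast+
    show "lift (\<lambda>s. v (w, s)) \<in> V0 W P" "lift (\<lambda>s. u (w, s)) \<in> V0 W P"
      using lift_V0 section_measurable section_finite assms w by blast+
  qed (use assms w in auto)
  then show ?thesis using rational assms unfolding satisfies_axioms_def A5_def by blast
qed

lemma pointwise:
  assumes "v \<in> tV0 W P" "u \<in> tV0 W P" "\<And>w s. w \<in> space W \<Longrightarrow> s \<in> space P \<Longrightarrow> u (w, s) \<le> v (w, s)"
  shows "R v u"
proof (rule section_dominance[OF assms(1,2)])
  fix w assume w: "w \<in> space W"
  have m: "(\<lambda>s. v (w, s)) \<in> borel_measurable P" "(\<lambda>s. u (w, s)) \<in> borel_measurable P"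
    using section_measurable assms w by blast+
  have f: "finite ((\<lambda>s. v (w, s)) ` space P)" "finite ((\<lambda>s. u (w, s)) ` space P)"
    using section_finite assms w by blast+
  show "R (lift (\<lambda>s. v (w, s))) (lift (\<lambda>s. u (w, s)))"
  proof (rule dominance[OF lift_V0[OF m(1) f(1)] lift_V0[OF m(2) f(2)]])
    fix t
    have "prob {s \<in> space P. v (w, s) \<le> t} \<le> prob {s \<in> space P. u (w, s) \<le> t}"
      using assms(3)[OF w] m(2) by (intro finite_measure_mono) (auto intro: order_trans)
    then show "FV W P (lift (\<lambda>s. v (w, s))) t \<le> FV W P (lift (\<lambda>s. u (w, s))) t"
      using FV_lift[OF m(1) f(1)] FV_lift[OF m(2) f(2)] by (simp add: rv_cdf_def)
  qed
qed

section \<open>Certainty equivalents\<close>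

lemma ce_ex1:
  assumes v: "v \<in> tV0 W P"
  shows "\<exists>!m. indiff R (const m) v"
proof -
  obtain B where B: "\<And>w s. w \<in> space W \<Longrightarrow> s \<in> space P \<Longrightarrow> \<bar>v (w, s)\<bar> \<le> B"
    using v unfolding tV0_def tV_def bounded_iff by (auto simp: space_pair_measure)
  have B1: "R (const B) v" by (rule pointwise[OF const_tV0 v]) (use B in \<open>force simp: abs_le_iff\<close>)
  have B2: "R v (const (- B))" by (rule pointwise[OF v const_tV0]) (use B in \<open>force simp: abs_le_iff\<close>)
  have B3: "strict R (const (B + 1)) (const B)" "strict R (const (- B)) (const (- B - 1))"
    by (rule const_less, simp)+
  have "strict R (const (B + 1)) v" by (rule strict_trans1[OF B3(1) B1 const_tV0 const_tV0 v])
  moreover have "strict R v (const (- B - 1))" by (rule strict_trans2[OF B2 B3(2) v const_tV0 const_tV0])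
  moreover have "open {m. strict R (const m) v}" "open {m. strict R v (const m)}"
    using rational v unfolding satisfies_axioms_def A3_def by blast+
  moreover have "{m. strict R (const m) v} \<inter> {m. strict R v (const m)} \<inter> UNIV = {}"
    unfolding strict_def by auto
  \<comment> \<open>The constants above \<open>v\<close> and those below it form disjoint non-empty
    open sets, which cannot cover the connected line; a constant in neither set is indifferent to
    \<open>v\<close>.\<close>
  ultimately have "\<not> UNIV \<subseteq> {m. strict R (const m) v} \<union> {m. strict R v (const m)}"
    using connectedD[OF connected_UNIV] by blast
  then obtain m where "\<not> strict R (const m) v" "\<not> strict R v (const m)" by blast
  then have "indiff R (const m) v" using total[OF v const_tV0[of m]] unfolding strict_def indiff_def by blast
  moreover have "m = n" if "indiff R (const m) v" "indiff R (const n) v" for m n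
    using that trans[of "const m" v "const n"] trans[of "const n" v "const m"] v const_tV0 const_iff
    unfolding indiff_def by (metis order_antisym)
  ultimately show ?thesis by blast
qed

lemma indiff_ce: "v \<in> tV0 W P \<Longrightarrow> indiff R (const (ce R v)) v"
  unfolding ce_def by (rule theI'[OF ce_ex1])

lemma R_iff_ce:
  assumes "v \<in> tV0 W P" "u \<in> tV0 W P"
  shows "R v u \<longleftrightarrow> ce R u \<le> ce R v"
proof -
  have "R v u \<longleftrightarrow> R (const (ce R v)) (const (ce R u))"
    using indiff_ce[OF assms(1)] indiff_ce[OF assms(2)] trans assms const_tV0 unfolding indiff_def by meson
  then show ?thesis using const_iff by simp
qed

lemma strict_iff_ce: "v \<in> tV0 W P \<Longrightarrow> u \<in> tV0 W P \<Longrightarrow> strict R v u \<longleftrightarrow> ce R u < ce R v"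
  unfolding strict_def by (auto simp: R_iff_ce)

lemma indiff_iff_ce: "v \<in> tV0 W P \<Longrightarrow> u \<in> tV0 W P \<Longrightarrow> indiff R v u \<longleftrightarrow> ce R v = ce R u"
  unfolding indiff_def by (auto simp: R_iff_ce)

lemma ce_const: "ce R (const m) = m"
  using indiff_ce[OF const_tV0[of m]] const_iff unfolding indiff_def by (simp add: order_antisym)

lemma ce_same_law: "v \<in> tV0 W P \<Longrightarrow> u \<in> tV0 W P \<Longrightarrow> (\<And>w. w \<in> space W \<Longrightarrow> F P v w = F P u w) \<Longrightarrow> ce R v = ce R u"
  using same_law indiff_iff_ce by blast

text \<open>The value outside \<open>{0..1}\<close> makes \<open>event p\<close> measurable for all \<open>p\<close>, so that relations which agree
  on risky acts share the whole function \<open>bet_ce\<close> below.\<close>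

definition event :: "real \<Rightarrow> 's set" where
  "event p = (if p \<in> {0..1} then SOME A. A \<in> sets P \<and> prob A = p else {})"

lemma event:
  assumes "p \<in> {0..1}"
  shows "event p \<in> sets P" "prob (event p) = p"
proof -
  obtain X where X: "X \<in> borel_measurable P" "distr P borel X = uniform_measure lborel {0..1::real}"
    using uniform unfolding supports_uniform_def by blast
  have "prob (X -` {..p} \<inter> space P) = measure (distr P borel X) {..p}"
    using X(1) by (simp add: measure_distr)
  also have "\<dots> = measure lborel ({0..1} \<inter> {..p}) / measure lborel {0..1::real}"
    unfolding X(2) by (rule measure_uniform_measure) auto
  also have "{0..1} \<inter> {..p} = {0..p}" using assms by auto
  finally have "prob (X -` {..p} \<inter> space P) = p" using assms by simp
  moreover have "X -` {..p} \<inter> space P \<in> sets P" using X(1) by measurable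
  ultimately have "\<exists>A. A \<in> sets P \<and> prob A = p" by blast
  from someI_ex[OF this] show "event p \<in> sets P" "prob (event p) = p"
    unfolding event_def using assms by auto
qed

lemma event_sets: "event p \<in> sets P"
  using event(1)[of p] by (cases "p \<in> {0..1}") (auto simp: event_def)

section \<open>Certainty equivalents of bets\<close>

definition bet_ce :: "real \<Rightarrow> real \<Rightarrow> real \<Rightarrow> real" where
  "bet_ce p x y = ce R (bet x (event p) y)"

lemma ce_bet: "A \<in> sets P \<Longrightarrow> ce R (bet x A y) = bet_ce (prob A) x y"
  unfolding bet_ce_def using event[of "prob A"]
  by (intro ce_same_law V0_tV0 bet_V0) (auto simp: F_bet)

lemma ce_bet_compl: "A \<in> sets P \<Longrightarrow> ce R (bet x (space P - A) y) = bet_ce (prob A) y x"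
proof -
  assume A: "A \<in> sets P"
  have "ce R (bet x (space P - A) y) = ce R (bet y A x)"
    using A by (intro ce_same_law V0_tV0 bet_V0) (auto simp: F_bet prob_compl bet_cdf_def fun_eq_iff)
  then show ?thesis using ce_bet[OF A] by simp
qed

lemma bet_V0_event: "p \<in> {0..1} \<Longrightarrow> bet x (event p) y \<in> V0 W P"
  using event bet_V0 by blast

lemma FV_bet_event: "p \<in> {0..1} \<Longrightarrow> FV W P (bet x (event p) y) = bet_cdf p x y"
  using event FV_bet by metis

lemma bet_ce_le:
  assumes "p \<in> {0..1}" "p' \<in> {0..1}" "\<And>t. bet_cdf p x y t \<le> bet_cdf p' x' y' t"
  shows "bet_ce p' x' y' \<le> bet_ce p x y"
proof -
  have "R (bet x (event p) y) (bet x' (event p') y')"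
    using assms by (intro dominance bet_V0_event) (auto simp: FV_bet_event)
  then show ?thesis using assms by (simp add: R_iff_ce V0_tV0 bet_V0_event bet_ce_def)
qed

lemma bet_ce_less:
  assumes "p \<in> {0..1}" "p' \<in> {0..1}" "\<And>t. bet_cdf p x y t \<le> bet_cdf p' x' y' t"
    "bet_cdf p x y t < bet_cdf p' x' y' t"
  shows "bet_ce p' x' y' < bet_ce p x y"
proof -
  have "strict R (bet x (event p) y) (bet x' (event p') y')"
    using assms by (intro strict_dominance[where t = t] bet_V0_event) (auto simp: FV_bet_event)
  then show ?thesis using assms by (simp add: strict_iff_ce V0_tV0 bet_V0_event bet_ce_def)
qed

lemma bet_same: "bet x A x = const x"
  by (auto simp: bet_def fun_eq_iff)

lemma bet_ce_same: "bet_ce p x x = x"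
  unfolding bet_ce_def bet_same by (rule ce_const)

lemma bet_ce_0: "bet_ce 0 x y = y" and bet_ce_1: "bet_ce 1 x y = x"
proof -
  have "ce R (bet x (event 0) y) = ce R (const y)" "ce R (bet x (event 1) y) = ce R (const x)"
    using event[of 0] event[of 1]
    by (auto intro!: ce_same_law V0_tV0 bet_V0 const_V0 simp: F_bet F_const[of _ _ 0] bet_cdf_def fun_eq_iff)
  then show "bet_ce 0 x y = y" "bet_ce 1 x y = x" unfolding bet_ce_def ce_const .
qed

text \<open>\<open>A3\<close> perturbs both sides of a strict preference. Here one side is a
  constant act and its sequence is constant, so the bets on the other side give the lower and the
  upper bound of the limit separately.\<close>

lemma bet_ce_continuous: "continuous_on {0..1} (\<lambda>p. bet_ce p x y)"
proof (rule continuous_on_sequentiallyI)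
  fix p a assume p: "\<forall>n. p n \<in> {0..1::real}" and a: "a \<in> {0..1}" and lim: "p \<longlonglongrightarrow> a"
  let ?b = "\<lambda>p. bet x (event p) y :: ('w, 's) act"
  have conv: "conv_in_distr W P (\<lambda>n. ?b (p n)) (?b a)"
    unfolding conv_in_distr_def weak_conv_def using p a
    by (auto simp: FV_bet_event bet_cdf_def intro!: tendsto_eq_intros lim)
  have convc: "conv_in_distr W P (\<lambda>n. const m) (const m)" for m
    unfolding conv_in_distr_def weak_conv_def by simp
  have bdd: "uniformly_bounded W P (\<lambda>n. ?b (p n))"
    unfolding uniformly_bounded_def
    by (intro exI[of _ "max \<bar>x\<bar> \<bar>y\<bar>"]) (auto simp: bet_def)
  have bddc: "uniformly_bounded W P (\<lambda>n. const m)" for m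
    unfolding uniformly_bounded_def by auto
  have V: "?b a \<in> V0 W P" "range (\<lambda>n. ?b (p n)) \<subseteq> V0 W P" "range (\<lambda>n::nat. const m) \<subseteq> V0 W P" for m
    using bet_V0_event p a const_V0 by auto
  have A3: "\<exists>N. \<forall>n\<ge>N. strict R (vn n) u \<and> strict R v (un n)"
    if "v \<in> V0 W P" "u \<in> V0 W P" "strict R v u" "range vn \<subseteq> V0 W P" "range un \<subseteq> V0 W P"
      "uniformly_bounded W P vn" "uniformly_bounded W P un" "conv_in_distr W P vn v" "conv_in_distr W P un u"
    for v u and vn un :: "nat \<Rightarrow> ('w, 's) act"
    using rational that unfolding satisfies_axioms_def A3_def by blast
  have T: "?b (p n) \<in> tV0 W P" "?b a \<in> tV0 W P" for n using p a bet_V0_event V0_tV0 by blast+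
  show "(\<lambda>n. bet_ce (p n) x y) \<longlonglongrightarrow> bet_ce a x y"
  proof (rule order_tendstoI)
    fix m assume "m < bet_ce a x y"
    then have "strict R (?b a) (const m)"
      using T const_tV0 by (simp add: strict_iff_ce ce_const bet_ce_def)
    from A3[OF V(1) const_V0 this V(2) V(3) bdd bddc conv convc]
    obtain N where "\<And>n. n \<ge> N \<Longrightarrow> strict R (?b (p n)) (const m)" by blast
    then show "\<forall>\<^sub>F n in sequentially. m < bet_ce (p n) x y"
      using T const_tV0 by (auto simp: strict_iff_ce ce_const bet_ce_def eventually_sequentially)
  next
    fix m assume "bet_ce a x y < m"
    then have "strict R (const m) (?b a)"
      using T const_tV0 by (simp add: strict_iff_ce ce_const bet_ce_def)
    from A3[OF const_V0 V(1) this V(3) V(2) bddc bdd convc conv]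
    obtain N where "\<And>n. n \<ge> N \<Longrightarrow> strict R (const m) (?b (p n))" by blast
    then show "\<forall>\<^sub>F n in sequentially. bet_ce (p n) x y < m"
      using T const_tV0 by (auto simp: strict_iff_ce ce_const bet_ce_def eventually_sequentially)
  qed
qed

section \<open>Bisymmetry of bets\<close>

lemma essential_event:
  assumes "0 < p" "p < 1"
  shows "essential P R (event p)"
proof -
  have p: "p \<in> {0..1}" using assms by simp
  have 1: "bet_ce p 1 0 < 1" using bet_ce_less[of 1 p 1 1 1 0 0] assms by (simp add: bet_ce_same bet_cdf_def)
  have 0: "0 < bet_ce p 1 0" using bet_ce_less[of p 0 1 0 0 0 0] assms by (simp add: bet_ce_same bet_cdf_def)
  show ?thesis unfolding essential_def
    using 0 1 event(1)[OF p] V0_tV0[OF bet_V0_event[OF p]] const_tV0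
    by (intro conjI exI[of _ 1] exI[of _ 0]) (auto simp: strict_iff_ce ce_const bet_ce_def)
qed

lemma sub_bet: "sub R (bet x A y) B (bet x' A y') = bet (ce R (bet x B x')) A (ce R (bet y B y'))"
  unfolding sub_def by (auto simp: bet_def[of _ A] fun_eq_iff)

text \<open>The certainty equivalent \<open>m\<close> is written as a bet with two equal prizes, so
  that \<open>A8\<close> applies to the indifference in both directions and yields an
  equation.\<close>

lemma act_independence:
  assumes p: "0 < p" "p < 1" and B: "B \<in> sets P"
    and ord: "y \<le> x" "y'' \<le> x''"
    and m: "bet_ce p x y = m"
    and dom: "x \<ge> x'' \<and> m \<ge> x'' \<and> y \<ge> y'' \<and> m \<ge> y'' \<or> x'' \<ge> x \<and> x'' \<ge> m \<and> y'' \<ge> y \<and> y'' \<ge> m"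
  shows "bet_ce p (ce R (bet x B x'')) (ce R (bet y B y'')) = bet_ce p (ce R (bet m B x'')) (ce R (bet m B y''))"
proof -
  let ?A = "event p"
  let ?v = "bet x ?A y :: ('w, 's) act" and ?u = "bet m ?A m :: ('w, 's) act" and ?r = "bet x'' ?A y'' :: ('w, 's) act"
  have p': "p \<in> {0..1}" using p by simp
  have ind: "R ?v ?u" "R ?u ?v"
    using m V0_tV0[OF bet_V0_event[OF p']] by (auto simp: R_iff_ce bet_ce_def[symmetric] bet_ce_same)
  have co: "comonotonic W P ?v ?u" "comonotonic W P ?u ?v" "comonotonic W P ?v ?r" "comonotonic W P ?u ?r"
    unfolding comonotonic_def bet_def using ord by (auto simp: mult_nonneg_nonneg mult_nonpos_nonpos)
  have dom': "m \<ge> x'' \<and> x \<ge> x'' \<and> m \<ge> y'' \<and> y \<ge> y'' \<or> x'' \<ge> m \<and> x'' \<ge> x \<and> y'' \<ge> m \<and> y'' \<ge> y"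
    using dom by blast
  have A8: "A8 W P R" using rational unfolding satisfies_axioms_def by blast
  have "R (sub R ?v B ?r) (sub R ?u B ?r)" "R (sub R ?u B ?r) (sub R ?v B ?r)"
    using A8[unfolded A8_def, rule_format, OF essential_event[OF p] B HOL.refl HOL.refl HOL.refl co(1,3,4) dom ind(1)]
      A8[unfolded A8_def, rule_format, OF essential_event[OF p] B HOL.refl HOL.refl HOL.refl co(2,4,3) dom' ind(2)] .
  then show ?thesis
    unfolding sub_bet using V0_tV0[OF bet_V0_event[OF p']] by (simp add: R_iff_ce bet_ce_def)
qed

text \<open>Axiom \<open>A8\<close> is used twice: first the bet on \<open>x\<close>, \<open>y\<close> is replaced by its certainty equivalent \<open>m\<close>,
  then the bet on \<open>u\<close>, \<open>z\<close> by its certainty equivalent, now mixed with the constant \<open>m\<close> on the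
  complementary event.  The order \<open>u \<le> y\<close> ensures that \<open>m\<close> dominates \<open>u\<close>.\<close>

lemma bet_ce_bisym:
  assumes p: "0 < p" "p < 1" and q: "0 < q" "q < 1" and ord: "z \<le> y" "y \<le> x" "z \<le> u" "u \<le> y"
  shows "bet_ce p (bet_ce q x u) (bet_ce q y z) = bet_ce q (bet_ce p x y) (bet_ce p u z)"
proof -
  define m n where "m = bet_ce p x y" and "n = bet_ce p u z"
  have q': "q \<in> {0..1}" using q by simp
  note B = event[OF q']
  have m: "y \<le> m" "m \<le> x"
    using bet_ce_le[of p p x y y y] bet_ce_le[of p p x x x y] p ord
    by (auto simp: bet_ce_same m_def bet_cdf_def)
  have n: "z \<le> n" "n \<le> u"
    using bet_ce_le[of p p u z z z] bet_ce_le[of p p u u u z] p ord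
    by (auto simp: bet_ce_same n_def bet_cdf_def)
  have "bet_ce p (bet_ce q x u) (bet_ce q y z) = bet_ce p (bet_ce q m u) (bet_ce q m z)"
    using act_independence[OF p B(1), of y x z u m] ord m m_def by (simp add: ce_bet[OF B(1)] B(2))
  also have "\<dots> = bet_ce p (bet_ce q m n) (bet_ce q m n)"
    using act_independence[OF p sets.compl_sets[OF B(1)], of z u m m n] ord m n n_def
    by (simp add: ce_bet_compl[OF B(1)] B(2))
  finally show ?thesis by (simp add: bet_ce_same m_def n_def)
qed

sublocale bisymmetric_family bet_ce
proof
  fix p q x y x' y' z u :: real
  show "p \<in> {0..1} \<Longrightarrow> bet_ce p x x = x" by (rule bet_ce_same)
  show "bet_ce p x y < bet_ce p x' y" if "0 < p" "p < 1" "y \<le> x" "x < x'"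
    using that by (intro bet_ce_less[where t = x]) (auto simp: bet_cdf_def)
  show "bet_ce p x y < bet_ce p x y'" if "0 < p" "p < 1" "y < y'" "y' \<le> x"
    using that by (intro bet_ce_less[where t = y]) (auto simp: bet_cdf_def)
  show "bet_ce p x y < bet_ce q x y" if "y < x" "0 \<le> p" "p < q" "q \<le> 1"
    using that by (intro bet_ce_less[where t = y]) (auto simp: bet_cdf_def)
  show "bet_ce 0 x y = y" "bet_ce 1 x y = x" by (rule bet_ce_0 bet_ce_1)+
  show "continuous_on {0..1} (\<lambda>p. bet_ce p x y)" by (rule bet_ce_continuous)
  show "bet_ce p (bet_ce q x u) (bet_ce q y z) = bet_ce q (bet_ce p x y) (bet_ce p u z)"
    if "0 < p" "p < 1" "0 < q" "q < 1" "z \<le> y" "y \<le> x" "z \<le> u" "u \<le> x"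
  proof (cases "u \<le> y")
    case True
    then show ?thesis using bet_ce_bisym[of p q z y x u] that by blast
  next
    case False
    \<comment> \<open>The identity is its own mirror image under exchanging \<open>p\<close> with
      \<open>q\<close> and \<open>y\<close> with \<open>u\<close>.\<close>
    then have "y \<le> u" by simp
    then show ?thesis using bet_ce_bisym[of q p z u x y, symmetric] that by blast
  qed
qed

end

section \<open>Representation\<close>

lemma measure_split_at_0:
  fixes a b :: real
  assumes "a \<le> b"
  shows "measure lborel ({..0} \<inter> {a..<b}) + measure lborel ({0..} \<inter> {a..<b}) = b - a"
proof -
  have "{..0} \<inter> {a..<b} = (if b \<le> 0 then {a..<b} else if a \<le> 0 then {a..0} else {})"
    "{0..} \<inter> {a..<b} = (if 0 \<le> a then {a..<b} else if 0 \<le> b then {0..<b} else {})" by auto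
  then show ?thesis using assms by auto
qed

lemma set_integral_step:
  fixes a b c :: real
  assumes "S \<in> sets borel"
  shows "set_integrable lborel S (\<lambda>t. c * indicator {a..<b} t)"
    and "(LINT t:S|lborel. c * indicator {a..<b} t) = c * measure lborel (S \<inter> {a..<b})"
proof -
  have "emeasure lborel (S \<inter> {a..<b}) \<le> emeasure lborel {a..<b}" by (rule emeasure_mono) auto
  also have "\<dots> < \<infinity>" by (cases "a \<le> b") auto
  finally have fin: "emeasure lborel (S \<inter> {a..<b}) < \<infinity>" .
  have eq: "(\<lambda>t. indicat_real S t *\<^sub>R (c * indicator {a..<b} t)) = (\<lambda>t. c * indicator (S \<inter> {a..<b}) t)"
    by (auto simp: indicator_def)
  show "set_integrable lborel S (\<lambda>t. c * indicator {a..<b} t)"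
    unfolding set_integrable_def eq using fin assms by (intro integrable_mult_right integrable_real_indicator) auto
  show "(LINT t:S|lborel. c * indicator {a..<b} t) = c * measure lborel (S \<inter> {a..<b})"
    unfolding set_lebesgue_integral_def eq using assms by simp
qed

context preference
begin

lemma is_utility_util: "is_utility util"
  unfolding is_utility_def using util_strict_mono util_continuous by simp

lemma weight_unit: "p \<in> {0..1} \<Longrightarrow> weight p \<in> {0..1}"
  using weight_strict[of 0 p] weight_strict[of p 1] weight_0 weight_1
  by (cases "p = 0"; cases "p = 1") auto

lemma is_distortion_weight: "is_distortion weight"
  unfolding is_distortion_def
proof (intro conjI)
  show "weight ` {0..1} \<subseteq> {0..1}" using weight_unit by blast
  show "\<not> weight constant_on {0..1}"
    unfolding constant_on_def using weight_0 weight_1 by (metis atLeastAtMost_iff order_refl zero_le_one zero_neq_one)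
  show "mono_on {0..1} weight"
    by (rule mono_onI) (metis atLeastAtMost_iff less_eq_real_def weight_strict)
qed (use weight_continuous weight_0 weight_1 in auto)

section \<open>The preference functional in utility units\<close>

definition J :: "('w, 's) act \<Rightarrow> real" where
  "J v = util (ce R v)"

lemma R_iff_J: "v \<in> tV0 W P \<Longrightarrow> u \<in> tV0 W P \<Longrightarrow> R v u \<longleftrightarrow> J u \<le> J v"
  unfolding J_def using R_iff_ce util_strict_mono by (simp add: strict_mono_less_eq)

lemma J_const: "J (const m) = util m"
  unfolding J_def ce_const ..

lemma J_bet: "A \<in> sets P \<Longrightarrow> x \<le> t \<Longrightarrow>
    J (bet t A x) = util t * weight (prob A) + util x * (1 - weight (prob A))"
  unfolding J_def using ce_bet util_M[of "prob A" x t] by (simp add: mult.commute)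

text \<open>Opens the way to \<open>A6\<close> and \<open>A7\<close>, whose operations are formed
  with a biseparable utility.\<close>

lemma biseparable: "biseparable_utility W P R util"
  unfolding biseparable_utility_def
proof (intro conjI exI[of _ J] exI[of _ weight])
  have "weight (1/2) \<noteq> 0" "weight (1/2) \<noteq> 1"
    using weight_strict[of 0 "1/2"] weight_strict[of "1/2" 1] weight_0 weight_1 by auto
  then show "\<not> (\<forall>p\<in>{0<..<1}. weight p = 0)" "\<not> (\<forall>p\<in>{0<..<1}. weight p = 1)"
    by (auto intro!: bexI[of _ "1/2"])
qed (use is_utility_util R_iff_J V0_tV0 J_const J_bet weight_unit in auto)

abbreviation K :: "real set" where "K \<equiv> range util"

definition uinv :: "real \<Rightarrow> real" where "uinv = inv util"

lemma util_uinv: "k \<in> K \<Longrightarrow> util (uinv k) = k"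
  unfolding uinv_def by (rule f_inv_into_f)

lemma uinv_util: "uinv (util x) = x"
  unfolding uinv_def using strict_mono_imp_inj_on[OF util_strict_mono] by (rule inv_f_f)

lemma uinv_mono: "a \<in> K \<Longrightarrow> b \<in> K \<Longrightarrow> a \<le> b \<Longrightarrow> uinv a \<le> uinv b"
  using util_uinv util_strict_mono by (metis strict_mono_less_eq)

lemma is_interval_K: "is_interval K"
  using connected_continuous_image[OF util_continuous connected_UNIV] is_interval_connected_1 by blast

lemma zero_K: "0 \<in> K" using util_0 by (metis rangeI)

lemma between_K: "a \<in> K \<Longrightarrow> b \<in> K \<Longrightarrow> a \<le> x \<Longrightarrow> x \<le> b \<Longrightarrow> x \<in> K"
  using is_interval_K by (rule mem_is_interval_1_I)

lemma mid_K: "a \<in> K \<Longrightarrow> b \<in> K \<Longrightarrow> a / 2 + b / 2 \<in> K"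
  by (cases "a \<le> b") (auto intro: between_K[of a b] between_K[of b a])

lemma half_K: "a \<in> K \<Longrightarrow> a / 2 \<in> K"
  using mid_K[of a 0] zero_K by simp

lemma J_mono: "v \<in> tV0 W P \<Longrightarrow> u \<in> tV0 W P \<Longrightarrow>
    (\<And>w s. w \<in> space W \<Longrightarrow> s \<in> space P \<Longrightarrow> util (u (w, s)) \<le> util (v (w, s))) \<Longrightarrow> J u \<le> J v"
  using pointwise[of v u] R_iff_J[of v u] util_strict_mono by (simp add: strict_mono_less_eq)

lemma J_le: "v \<in> tV0 W P \<Longrightarrow> (\<And>w s. w \<in> space W \<Longrightarrow> s \<in> space P \<Longrightarrow> util (v (w, s)) \<le> k) \<Longrightarrow> k \<in> K \<Longrightarrow> J v \<le> k"
  using J_mono[of "const (uinv k)" v] const_tV0 J_const util_uinv by simp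

lemma J_ge: "v \<in> tV0 W P \<Longrightarrow> (\<And>w s. w \<in> space W \<Longrightarrow> s \<in> space P \<Longrightarrow> k \<le> util (v (w, s))) \<Longrightarrow> k \<in> K \<Longrightarrow> k \<le> J v"
  using J_mono[of v "const (uinv k)"] const_tV0 J_const util_uinv by simp

lemma J_cong: "v \<in> tV0 W P \<Longrightarrow> u \<in> tV0 W P \<Longrightarrow>
    (\<And>w s. w \<in> space W \<Longrightarrow> s \<in> space P \<Longrightarrow> u (w, s) = v (w, s)) \<Longrightarrow> J u = J v"
  by (intro antisym J_mono) auto

text \<open>\<open>A7\<close> in both directions. As \<open>util 0 = 0\<close>, the subjective sum
  is pointwise addition of utilities.\<close>

lemma J_sum_eq:
  assumes v: "v \<in> tV0 W P" and u: "u \<in> tV0 W P" and r: "r \<in> V0 W P"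
    and com: "comonotonic W P v r" "comonotonic W P u r" and "J v = J u"
    and z: "z \<in> tV0 W P" "\<And>w s. w \<in> space W \<Longrightarrow> s \<in> space P \<Longrightarrow> util (z (w, s)) = util (v (w, s)) + util (r (w, s))"
    and z': "z' \<in> tV0 W P" "\<And>w s. w \<in> space W \<Longrightarrow> s \<in> space P \<Longrightarrow> util (z' (w, s)) = util (u (w, s)) + util (r (w, s))"
  shows "J z = J z'"
proof -
  have sums: "is_sum W P util v r z" "is_sum W P util u r z'"
    unfolding is_sum_def using z z' by (auto simp: space_pair_measure util_0)
  have A7: "R vr ur" if "v \<in> tV0 W P" "u \<in> tV0 W P" "comonotonic W P v r" "comonotonic W P u r" "R v u"
     "is_sum W P util v r vr" "is_sum W P util u r ur" for v u vr ur
    using rational biseparable r that unfolding satisfies_axioms_def A7_def by blast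
  have "R v u" "R u v" using R_iff_J v u \<open>J v = J u\<close> by auto
  then have "R z z'" "R z' z" using A7 v u com sums by blast+
  then show ?thesis using R_iff_J z(1) z'(1) by (simp add: antisym)
qed

text \<open>\<open>A7\<close> is applied to \<open>v\<close> and its certainty equivalent, with a
  constant as the common summand; constants are comonotonic with every act. The sum on the constant
  side exists because \<open>J v + k\<close> lies between the extreme utilities of
  \<open>z\<close>.\<close>

lemma J_translate:
  assumes v: "v \<in> tV0 W P" and z: "z \<in> tV0 W P" and k: "k \<in> K"
    and zv: "\<And>w s. w \<in> space W \<Longrightarrow> s \<in> space P \<Longrightarrow> util (z (w, s)) = util (v (w, s)) + k"
  shows "J z = J v + k"
proof -
  let ?V = "v ` (space W \<times> space P)"
  have fin: "finite ?V" "?V \<noteq> {}"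
    using v states space_S unfolding tV0_def by (auto simp: space_pair_measure)
  obtain w1 s1 where 1: "w1 \<in> space W" "s1 \<in> space P" "v (w1, s1) = Min ?V" using Min_in[OF fin] by fastforce
  obtain w2 s2 where 2: "w2 \<in> space W" "s2 \<in> space P" "v (w2, s2) = Max ?V" using Max_in[OF fin] by fastforce
  have lo: "util (v (w1, s1)) \<le> J v"
    using 1 fin util_strict_mono by (intro J_ge v) (auto simp: strict_mono_less_eq)
  have hi: "J v \<le> util (v (w2, s2))"
    using 2 fin util_strict_mono by (intro J_le v) (auto simp: strict_mono_less_eq)
  have "J v + k \<in> K"
  proof (rule between_K)
    show "util (z (w1, s1)) \<in> K" "util (z (w2, s2)) \<in> K" by auto
    show "util (z (w1, s1)) \<le> J v + k" "J v + k \<le> util (z (w2, s2))"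
      using lo hi zv 1 2 by simp_all
  qed
  note y = util_uinv[OF this]
  have "J z = J (const (uinv (J v + k)))"
  proof (rule J_sum_eq[where v = v and u = "const (ce R v)" and r = "const (uinv k)"])
    show "J v = J (const (ce R v))" unfolding J_const by (simp add: J_def)
    show "util (uinv (J v + k)) = util (ce R v) + util (uinv k)"
      unfolding y util_uinv[OF k] by (simp add: J_def)
  qed (use v z zv util_uinv[OF k] in \<open>auto simp: const_tV0 const_V0 comonotonic_def\<close>)
  then show ?thesis unfolding J_const y .
qed

section \<open>Comonotonic additivity and the Choquet integral\<close>

definition risky :: "('s \<Rightarrow> real) \<Rightarrow> ('w, 's) act" where
  "risky f = lift (\<lambda>s. uinv (f s))"

lemma risky_V0: "f \<in> acts_into P K \<Longrightarrow> risky f \<in> V0 W P"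
  unfolding risky_def acts_into_def
  by (intro lift_V0 borel_measurable_simple_function simple_functionD(1)[OF simple_function_compose1])
    (auto intro: simple_function_compose1)

lemma risky_tV0: "f \<in> acts_into P K \<Longrightarrow> risky f \<in> tV0 W P"
  using risky_V0 V0_tV0 by blast

lemma util_risky: "f \<in> acts_into P K \<Longrightarrow> s \<in> space P \<Longrightarrow> util (risky f (w, s)) = f s"
  unfolding risky_def lift_def acts_into_def using util_uinv by auto

lemma acts_into_comp2:
  assumes "f \<in> acts_into N K" "g \<in> acts_into N K" "\<And>a b. a \<in> K \<Longrightarrow> b \<in> K \<Longrightarrow> h a b \<in> K"
  shows "(\<lambda>s. h (f s) (g s)) \<in> acts_into N K"
proof -
  have "simple_function N (\<lambda>s. h (f s) (g s))"
    using assms(1,2) unfolding acts_into_def by (auto intro: simple_function_compose2)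
  moreover have "h (f s) (g s) \<in> K" if "s \<in> space N" for s
    using assms that unfolding acts_into_def by blast
  ultimately show ?thesis unfolding acts_into_def by blast
qed

lemma comonotonic_risky:
  assumes "f \<in> acts_into P K" "g \<in> acts_into P K"
    and "\<And>s s'. s \<in> space P \<Longrightarrow> s' \<in> space P \<Longrightarrow> 0 \<le> (f s' - f s) * (g s' - g s)"
  shows "comonotonic W P (risky f) (risky g)"
  unfolding comonotonic_def
proof (intro ballI)
  fix w s s' assume s: "s \<in> space P" "s' \<in> space P"
  have K: "f s \<in> K" "f s' \<in> K" "g s \<in> K" "g s' \<in> K" using assms(1,2) s unfolding acts_into_def by auto
  have "f s \<le> f s' \<and> g s \<le> g s' \<or> f s' \<le> f s \<and> g s' \<le> g s"
    using assms(3)[OF s] by (auto simp: zero_le_mult_iff)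
  then show "0 \<le> (risky f (w, s') - risky f (w, s)) * (risky g (w, s') - risky g (w, s))"
    using uinv_mono K unfolding risky_def lift_def by (auto simp: zero_le_mult_iff)
qed

text \<open>By \<open>A7\<close> with the common summand g/2, the act f/2 may be replaced by a
  constant of the same value \<open>j\<close>, and translation invariance finishes. Halving keeps
  all sums in \<open>K\<close>: since \<open>2 * j\<close> lies between the extreme values of
  \<open>f\<close>, g/2 + j is a midpoint of two elements of \<open>K\<close>.\<close>

lemma J_risky_half_sum:
  assumes f: "f \<in> acts_into P K" and g: "g \<in> acts_into P K"
    and com: "\<And>s s'. s \<in> space P \<Longrightarrow> s' \<in> space P \<Longrightarrow> 0 \<le> (f s' - f s) * (g s' - g s)"
  shows "J (risky (\<lambda>s. f s / 2 + g s / 2)) = J (risky (\<lambda>s. f s / 2)) + J (risky (\<lambda>s. g s / 2))"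
proof -
  have D: "(\<lambda>s. f s / 2) \<in> acts_into P K" "(\<lambda>s. g s / 2) \<in> acts_into P K" "(\<lambda>s. f s / 2 + g s / 2) \<in> acts_into P K"
    using acts_into_comp2[OF f f, of "\<lambda>a b. a / 2"] acts_into_comp2[OF g g, of "\<lambda>a b. a / 2"]
      acts_into_comp2[OF f g, of "\<lambda>a b. a / 2 + b / 2"] half_K mid_K by auto
  define j where "j = J (risky (\<lambda>s. f s / 2))"
  have fin: "finite (f ` space P)" "f ` space P \<noteq> {}" "f ` space P \<subseteq> K"
    using f space_S unfolding acts_into_def by (auto dest: simple_functionD)
  define lo hi where "lo = Min (f ` space P)" and "hi = Max (f ` space P)"
  have lohi: "lo \<in> K" "hi \<in> K" unfolding lo_def hi_def using fin(3) Min_in[OF fin(1,2)] Max_in[OF fin(1,2)] by blast+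
  have bnd: "lo \<le> f s" "f s \<le> hi" if "s \<in> space P" for s unfolding lo_def hi_def using fin that by auto
  have j: "lo / 2 \<le> j" "j \<le> hi / 2"
    unfolding j_def
    using J_ge[OF risky_tV0[OF D(1)] _ half_K[OF lohi(1)]] J_le[OF risky_tV0[OF D(1)] _ half_K[OF lohi(2)]]
    by (simp_all add: util_risky[OF D(1)] divide_right_mono bnd)
  have jK: "2 * j \<in> K" "j \<in> K" using between_K[OF lohi, of "2 * j"] j half_K[of "2 * j"] by auto
  have D': "(\<lambda>s. g s / 2 + j) \<in> acts_into P K"
    using acts_into_comp2[OF g g, of "\<lambda>a b. a / 2 + j"] mid_K[OF _ jK(1)] by simp
  have "J (risky (\<lambda>s. f s / 2 + g s / 2)) = J (risky (\<lambda>s. g s / 2 + j))"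
  proof (rule J_sum_eq[where v = "risky (\<lambda>s. f s / 2)" and u = "const (uinv j)" and r = "risky (\<lambda>s. g s / 2)"])
    show "comonotonic W P (risky (\<lambda>s. f s / 2)) (risky (\<lambda>s. g s / 2))"
    proof (rule comonotonic_risky[OF D(1,2)])
      fix s s' assume "s \<in> space P" "s' \<in> space P"
      then show "0 \<le> (f s' / 2 - f s / 2) * (g s' / 2 - g s / 2)"
        using com[of s s'] by (simp add: algebra_simps)
    qed
    show "J (risky (\<lambda>s. f s / 2)) = J (const (uinv j))" unfolding J_const util_uinv[OF jK(2)] by (rule j_def[symmetric])
  qed (use D D' risky_tV0 risky_V0 util_uinv[OF jK(2)] in \<open>auto simp: const_tV0 comonotonic_def util_risky\<close>)
  also have "\<dots> = J (risky (\<lambda>s. g s / 2)) + j"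
    by (rule J_translate[OF _ _ jK(2)]) (use D D' risky_tV0 in \<open>auto simp: util_risky\<close>)
  finally show ?thesis unfolding j_def by simp
qed

lemma J_risky_half:
  assumes "f \<in> acts_into P K"
  shows "J (risky (\<lambda>s. f s / 2)) = J (risky f) / 2"
  using J_risky_half_sum[OF assms assms] by simp

lemma J_risky_mid:
  assumes "f \<in> acts_into P K" "g \<in> acts_into P K"
    and "\<And>s s'. s \<in> space P \<Longrightarrow> s' \<in> space P \<Longrightarrow> 0 \<le> (f s' - f s) * (g s' - g s)"
  shows "J (risky (\<lambda>s. f s / 2 + g s / 2)) = (J (risky f) + J (risky g)) / 2"
  using J_risky_half_sum[OF assms] J_risky_half[OF assms(1)] J_risky_half[OF assms(2)]
  by (simp add: add_divide_distrib)

lemma J_risky_const: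
  assumes "f \<in> acts_into P K" "\<And>s. s \<in> space P \<Longrightarrow> f s = k"
  shows "J (risky f) = k"
proof -
  have "k \<in> K" using assms space_S unfolding acts_into_def by fastforce
  then show ?thesis
    using J_le[OF risky_tV0[OF assms(1)], of k] J_ge[OF risky_tV0[OF assms(1)], of k] assms(2)
    by (simp add: util_risky[OF assms(1)] antisym)
qed

lemma J_risky_two:
  assumes "A \<in> sets P" "a \<in> K" "b \<in> K" "b \<le> a"
  shows "J (risky (\<lambda>s. if s \<in> A then a else b)) = b + (a - b) * weight (prob A)"
proof -
  have "risky (\<lambda>s. if s \<in> A then a else b) = bet (uinv a) A (uinv b)"
    by (auto simp: risky_def lift_def bet_def fun_eq_iff)
  then show ?thesis
    using J_bet[OF assms(1) uinv_mono[OF assms(3,2,4)]] util_uinv assms by (simp add: algebra_simps)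
qed

text \<open>Induction on the number of values. Lowering the largest value \<open>y1\<close> to the
  next one \<open>y2\<close> changes both sides by \<open>(y1 - y2) * weight (prob A)\<close>, where
  \<open>A\<close> is the event on which \<open>y1\<close> is taken. Integrability is carried along
  because splitting the integrals requires it.\<close>

lemma choquet_eq_J:
  assumes "f \<in> acts_into P K"
  shows "set_integrable lborel {..0} (\<lambda>t. weight (1 - rv_cdf P f t) - 1) \<and>
    set_integrable lborel {0..} (\<lambda>t. weight (1 - rv_cdf P f t)) \<and>
    choquet P weight f = J (risky f)"
  using assms
proof (induction "card (f ` space P)" arbitrary: f rule: less_induct)
  case less
  note f = less.prems
  have fin: "finite (f ` space P)" "f ` space P \<noteq> {}" "f ` space P \<subseteq> K" and fm: "f \<in> borel_measurable P"
    using f space_S unfolding acts_into_def by (auto dest: simple_functionD borel_measurable_simple_function)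
  define y1 where "y1 = Max (f ` space P)"
  have y1: "y1 \<in> f ` space P" "\<And>s. s \<in> space P \<Longrightarrow> f s \<le> y1" unfolding y1_def using fin by auto
  show ?case
  proof (cases "f ` space P = {y1}")
    case True
    then have fy: "f s = y1" if "s \<in> space P" for s using that by blast
    have Jy: "J (risky f) = y1" using J_risky_const[OF f] fy by blast
    have cdf: "rv_cdf P f t = (if y1 \<le> t then 1 else 0)" for t
    proof -
      have "{s \<in> space P. f s \<le> t} = (if y1 \<le> t then space P else {})" using fy by auto
      then show ?thesis by (simp add: rv_cdf_def prob_space)
    qed
    have w: "weight (1 - rv_cdf P f t) = (if t < y1 then 1 else 0)" for t
      unfolding cdf using weight_0 weight_1 by simp
    have neg: "indicat_real {..0} t *\<^sub>R (weight (1 - rv_cdf P f t) - 1) = - indicator {y1..0} t"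
      and pos: "indicat_real {0..} t *\<^sub>R weight (1 - rv_cdf P f t) = indicator {0..<y1} t" for t
      unfolding w by (auto simp: indicator_def)
    show ?thesis
      unfolding choquet_def set_integrable_def set_lebesgue_integral_def neg pos Jy
      by (auto intro!: integrable_real_indicator)
  next
    case False
    define Y where "Y = f ` space P - {y1}"
    define y2 where "y2 = Max Y"
    have Y: "finite Y" "Y \<noteq> {}" unfolding Y_def using fin False y1(1) by auto
    have y2: "y2 \<in> Y" "\<And>y. y \<in> Y \<Longrightarrow> y \<le> y2" unfolding y2_def using Y by auto
    have y21: "y2 < y1" "y2 \<in> K" "y1 \<in> K" using y2(1) y1 fin(3) unfolding Y_def by force+
    have top: "f s = y1 \<or> f s \<le> y2" if "s \<in> space P" for s
      using y2(2)[of "f s"] that unfolding Y_def by auto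
    define A where "A = {s \<in> space P. f s = y1}"
    have A: "A \<in> sets P" unfolding A_def using fm by measurable
    define f' where "f' s = min (f s) y2" for s
    define g where "g s = (if s \<in> A then y1 else y2)" for s
    have c: "(\<lambda>s. y2) \<in> acts_into P K" using y21 unfolding acts_into_def by auto
    have f': "f' \<in> acts_into P K"
      unfolding f'_def using acts_into_comp2[OF f c, of min] by (auto simp: min_def)
    have g: "g \<in> acts_into P K" unfolding acts_into_def g_def
      using y21 A by (auto intro!: simple_function_If_set)
    have "f' ` space P \<subseteq> Y"
    proof
      fix y assume "y \<in> f' ` space P"
      then obtain s where s: "s \<in> space P" "y = f' s" by blast
      then show "y \<in> Y" using top[OF s(1)] y21 y2(1) unfolding f'_def Y_def by (auto simp: min_def)
    qed
    then have "card (f' ` space P) \<le> card Y" using Y by (intro card_mono)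
    also have "\<dots> < card (f ` space P)" unfolding Y_def using fin y1(1) by (simp add: card_gt_0_iff)
    finally have IH: "set_integrable lborel {..0} (\<lambda>t. weight (1 - rv_cdf P f' t) - 1)"
      "set_integrable lborel {0..} (\<lambda>t. weight (1 - rv_cdf P f' t))"
      "choquet P weight f' = J (risky f')"
      using less.hyps f' by blast+
    text \<open>Cutting off the top value: \<open>f + y2 = f' + g\<close>, where all four summands take values in \<open>K\<close>
      although \<open>y1 - y2\<close> need not be in \<open>K\<close>.\<close>
    have "J (risky (\<lambda>s. f s / 2 + y2 / 2)) = J (risky (\<lambda>s. f' s / 2 + g s / 2))"
    proof (rule J_cong)
      show "risky (\<lambda>s. f s / 2 + y2 / 2) \<in> tV0 W P" "risky (\<lambda>s. f' s / 2 + g s / 2) \<in> tV0 W P"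
        using acts_into_comp2[OF f c, of "\<lambda>a b. a / 2 + b / 2"]
          acts_into_comp2[OF f' g, of "\<lambda>a b. a / 2 + b / 2"] mid_K risky_tV0 by auto
      show "risky (\<lambda>s. f s / 2 + y2 / 2) (w, s) = risky (\<lambda>s. f' s / 2 + g s / 2) (w, s)" if "s \<in> space P" for w s
        using top[OF that] y21 that unfolding risky_def lift_def f'_def g_def A_def
        by (auto simp: min_def add.commute)
    qed
    moreover have "J (risky (\<lambda>s. f s / 2 + y2 / 2)) = (J (risky f) + y2) / 2"
      using J_risky_mid[OF f c] J_risky_const[OF c] by simp
    moreover have "J (risky (\<lambda>s. f' s / 2 + g s / 2)) = (J (risky f') + (y2 + (y1 - y2) * weight (prob A))) / 2"
    proof -
      have "0 \<le> (f' s' - f' s) * (g s' - g s)" if "s \<in> space P" "s' \<in> space P" for s s'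
        using top[OF that(1)] top[OF that(2)] y21 that unfolding f'_def g_def A_def
        by (auto simp: min_def mult_nonneg_nonneg mult_nonpos_nonpos)
      then show ?thesis
        using J_risky_mid[OF f' g] J_risky_two[OF A y21(3,2)] y21 unfolding g_def by simp
    qed
    ultimately have J: "J (risky f) = J (risky f') + (y1 - y2) * weight (prob A)" by simp
    have cdf: "weight (1 - rv_cdf P f t) = weight (1 - rv_cdf P f' t) + weight (prob A) * indicator {y2..<y1} t" for t
    proof (cases "t \<in> {y2..<y1}")
      case True
      have 1: "{s \<in> space P. f s \<le> t} = space P - A" "{s \<in> space P. f' s \<le> t} = space P"
        using top True unfolding A_def f'_def by force+
      show ?thesis using True prob_compl[OF A] weight_0 by (simp add: rv_cdf_def 1 prob_space)
    next
      case False
      have "{s \<in> space P. f s \<le> t} = {s \<in> space P. f' s \<le> t}"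
        using False y1(2) unfolding f'_def by (auto simp: min_def) force
      then show ?thesis using False by (simp add: rv_cdf_def)
    qed
    have S: "{..0::real} \<in> sets borel" "{0::real..} \<in> sets borel" by auto
    let ?i = "\<lambda>t. weight (prob A) * indicator {y2..<y1} t :: real"
    have neg: "set_integrable lborel {..0} (\<lambda>t. weight (1 - rv_cdf P f t) - 1)"
      "(LINT t:{..0}|lborel. weight (1 - rv_cdf P f t) - 1) =
        (LINT t:{..0}|lborel. weight (1 - rv_cdf P f' t) - 1) + weight (prob A) * measure lborel ({..0} \<inter> {y2..<y1})"
    proof -
      have eq: "(\<lambda>t. weight (1 - rv_cdf P f t) - 1) = (\<lambda>t. (weight (1 - rv_cdf P f' t) - 1) + ?i t)"
        using cdf by auto
      show "set_integrable lborel {..0} (\<lambda>t. weight (1 - rv_cdf P f t) - 1)"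
        unfolding eq by (rule set_integral_add(1)[OF IH(1) set_integral_step(1)[OF S(1)]])
      show "(LINT t:{..0}|lborel. weight (1 - rv_cdf P f t) - 1) =
        (LINT t:{..0}|lborel. weight (1 - rv_cdf P f' t) - 1) + weight (prob A) * measure lborel ({..0} \<inter> {y2..<y1})"
        unfolding eq set_integral_add(2)[OF IH(1) set_integral_step(1)[OF S(1)]] set_integral_step(2)[OF S(1)] ..
    qed
    have pos: "set_integrable lborel {0..} (\<lambda>t. weight (1 - rv_cdf P f t))"
      "(LINT t:{0..}|lborel. weight (1 - rv_cdf P f t)) =
        (LINT t:{0..}|lborel. weight (1 - rv_cdf P f' t)) + weight (prob A) * measure lborel ({0..} \<inter> {y2..<y1})"
    proof -
      have eq: "(\<lambda>t. weight (1 - rv_cdf P f t)) = (\<lambda>t. weight (1 - rv_cdf P f' t) + ?i t)"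
        using cdf by auto
      show "set_integrable lborel {0..} (\<lambda>t. weight (1 - rv_cdf P f t))"
        unfolding eq by (rule set_integral_add(1)[OF IH(2) set_integral_step(1)[OF S(2)]])
      show "(LINT t:{0..}|lborel. weight (1 - rv_cdf P f t)) =
        (LINT t:{0..}|lborel. weight (1 - rv_cdf P f' t)) + weight (prob A) * measure lborel ({0..} \<inter> {y2..<y1})"
        unfolding eq set_integral_add(2)[OF IH(2) set_integral_step(1)[OF S(2)]] set_integral_step(2)[OF S(2)] ..
    qed
    have "choquet P weight f = choquet P weight f' + weight (prob A) *
      (measure lborel ({..0} \<inter> {y2..<y1}) + measure lborel ({0..} \<inter> {y2..<y1}))"
      unfolding choquet_def neg(2) pos(2) by (simp add: algebra_simps)
    then have "choquet P weight f = J (risky f)"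
      unfolding J IH(3) measure_split_at_0[OF less_imp_le[OF y21(1)]] by (simp add: mult.commute)
    then show ?thesis using neg(1) pos(1) by blast
  qed
qed

section \<open>State-wise values of general acts\<close>

definition value_at :: "('w, 's) act \<Rightarrow> 'w \<Rightarrow> real" where
  "value_at v w = choquet P weight (\<lambda>s. util (v (w, s)))"

lemma util_section:
  assumes "v \<in> tV0 W P" "w \<in> space W"
  shows "(\<lambda>s. util (v (w, s))) \<in> acts_into P K"
proof -
  have "simple_function P (\<lambda>s. v (w, s))"
    by (rule simple_function_borel_measurable[OF section_measurable[OF assms] section_finite[OF assms]])
  then show ?thesis unfolding acts_into_def by (auto intro: simple_function_compose1)
qed

lemma value_at_eq:
  assumes "v \<in> tV0 W P" "w \<in> space W"
  shows "value_at v w = J (lift (\<lambda>s. v (w, s)))"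
  using choquet_eq_J[OF util_section[OF assms]] by (simp add: value_at_def risky_def uinv_util)

text \<open>\<open>A5\<close> in utility units: an act matters only through the values of its
  sections.\<close>

lemma J_section_mono:
  assumes v: "v \<in> tV0 W P" and u: "u \<in> tV0 W P" and le: "\<And>w. w \<in> space W \<Longrightarrow> value_at u w \<le> value_at v w"
  shows "J u \<le> J v"
proof -
  have "R v u"
  proof (rule section_dominance[OF v u])
    fix w assume w: "w \<in> space W"
    have "lift (\<lambda>s. v (w, s)) \<in> tV0 W P" "lift (\<lambda>s. u (w, s)) \<in> tV0 W P"
      using section_measurable section_finite u v w lift_V0 V0_tV0 by blast+
    then show "R (lift (\<lambda>s. v (w, s))) (lift (\<lambda>s. u (w, s)))"
      using le[OF w] w u v by (simp add: R_iff_J value_at_eq)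
  qed
  then show ?thesis using R_iff_J u v by blast
qed

lemma tV0_bounds:
  assumes v: "v \<in> tV0 W P"
  obtains lo hi where "\<And>w s. w \<in> space W \<Longrightarrow> s \<in> space P \<Longrightarrow> lo \<le> v (w, s) \<and> v (w, s) \<le> hi"
proof -
  have fin: "finite (v ` (space W \<times> space P))"
    using v unfolding tV0_def by (auto simp: space_pair_measure)
  show ?thesis by (rule that[of "Min (v ` (space W \<times> space P))" "Max (v ` (space W \<times> space P))"]) (use fin in auto)
qed

lemma value_at_bounds:
  assumes v: "v \<in> tV0 W P"
  obtains lo hi where "lo \<in> K" "hi \<in> K" "\<And>w. w \<in> space W \<Longrightarrow> lo \<le> value_at v w \<and> value_at v w \<le> hi"
proof -
  obtain lo hi where b: "\<And>w s. w \<in> space W \<Longrightarrow> s \<in> space P \<Longrightarrow> lo \<le> v (w, s) \<and> v (w, s) \<le> hi"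
    using tV0_bounds[OF v] by blast
  show ?thesis
  proof (rule that[of "util lo" "util hi"])
    fix w assume w: "w \<in> space W"
    have "lift (\<lambda>s. v (w, s)) \<in> tV0 W P"
      using section_measurable section_finite v w lift_V0 V0_tV0 by blast
    then show "util lo \<le> value_at v w \<and> value_at v w \<le> util hi"
      unfolding value_at_eq[OF v w] using b[OF w] util_strict_mono
      by (intro conjI J_ge J_le) (auto simp: lift_def strict_mono_less_eq)
  qed auto
qed

text \<open>Clipping the argument extends \<open>weight\<close> continuously beyond the interval on
  which it is controlled.\<close>

lemma weight_measurable: "(\<lambda>p. weight (max 0 (min 1 p))) \<in> borel_measurable borel"
proof (rule borel_measurable_continuous_onI)
  show "continuous_on UNIV (\<lambda>p. weight (max 0 (min 1 p)))"
    by (rule continuous_on_compose2[OF weight_continuous]) (auto intro!: continuous_intros)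
qed

text \<open>The distribution function of the section at \<open>w\<close> is jointly measurable in
  \<open>w\<close> and the threshold, being the measure of a section of one product set; the Choquet
  integral then integrates out the threshold.\<close>

lemma value_at_measurable:
  assumes v: "v \<in> tV0 W P"
  shows "value_at v \<in> borel_measurable W"
proof -
  have vm: "v \<in> borel_measurable (W \<Otimes>\<^sub>M P)" using v by (auto simp: tV0_def tV_def)
  have um: "util \<in> borel_measurable borel" by (rule borel_measurable_continuous_onI[OF util_continuous])
  define Q where "Q = {x \<in> space ((W \<Otimes>\<^sub>M lborel) \<Otimes>\<^sub>M P). util (v (fst (fst x), snd x)) \<le> snd (fst x)}"
  have "(\<lambda>x. v (fst (fst x), snd x)) \<in> borel_measurable ((W \<Otimes>\<^sub>M (lborel :: real measure)) \<Otimes>\<^sub>M P)"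
    by (rule measurable_compose[OF _ vm]) measurable
  then have "(\<lambda>x. util (v (fst (fst x), snd x))) \<in> borel_measurable ((W \<Otimes>\<^sub>M (lborel :: real measure)) \<Otimes>\<^sub>M P)"
    using um by (rule measurable_compose)
  then have Q: "Q \<in> sets ((W \<Otimes>\<^sub>M lborel) \<Otimes>\<^sub>M P)" unfolding Q_def by measurable
  have "(\<lambda>x. enn2real (emeasure P (Pair x -` Q))) \<in> borel_measurable (W \<Otimes>\<^sub>M lborel)"
    using measurable_emeasure_Pair[OF Q] by measurable
  moreover have "enn2real (emeasure P (Pair x -` Q)) = rv_cdf P (\<lambda>s. util (v (fst x, s))) (snd x)"
    if "x \<in> space (W \<Otimes>\<^sub>M lborel)" for x
  proof -
    have "Pair x -` Q = {s \<in> space P. util (v (fst x, s)) \<le> snd x}"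
      unfolding Q_def using that by (auto simp: space_pair_measure)
    then show ?thesis by (simp add: rv_cdf_def measure_def)
  qed
  ultimately have cdf: "(\<lambda>x. rv_cdf P (\<lambda>s. util (v (fst x, s))) (snd x)) \<in> borel_measurable (W \<Otimes>\<^sub>M lborel)"
    by (simp cong: measurable_cong)
  have "(\<lambda>x. weight (max 0 (min 1 (1 - rv_cdf P (\<lambda>s. util (v (fst x, s))) (snd x))))) \<in> borel_measurable (W \<Otimes>\<^sub>M lborel)"
    by (rule measurable_compose[OF borel_measurable_diff[OF borel_measurable_const cdf] weight_measurable])
  moreover have "max 0 (min 1 (1 - rv_cdf P x t)) = 1 - rv_cdf P x t" for x t
    unfolding rv_cdf_def by (simp add: prob_le_1)
  ultimately have m: "(\<lambda>x. weight (1 - rv_cdf P (\<lambda>s. util (v (fst x, s))) (snd x))) \<in> borel_measurable (W \<Otimes>\<^sub>M lborel)"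
    by simp
  have "(\<lambda>w. LINT t|lborel. indicator {..0} t *\<^sub>R (weight (1 - rv_cdf P (\<lambda>s. util (v (w, s))) t) - 1)) \<in> borel_measurable W"
    "(\<lambda>w. LINT t|lborel. indicator {0..} t *\<^sub>R weight (1 - rv_cdf P (\<lambda>s. util (v (w, s))) t)) \<in> borel_measurable W"
    using m by (auto intro!: lborel.borel_measurable_lebesgue_integral borel_measurable_times borel_measurable_diff
        simp: case_prod_beta)
  then show ?thesis unfolding value_at_def[abs_def] choquet_def set_lebesgue_integral_def
    by (rule borel_measurable_add)
qed

lemma value_at_bounded_measurable: "v \<in> tV0 W P \<Longrightarrow> value_at v \<in> bounded_measurable W"
proof -
  assume v: "v \<in> tV0 W P"
  obtain lo hi where "\<And>w. w \<in> space W \<Longrightarrow> lo \<le> value_at v w \<and> value_at v w \<le> hi"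
    using value_at_bounds[OF v] by metis
  then have "\<bar>value_at v w\<bar> \<le> max \<bar>lo\<bar> \<bar>hi\<bar>" if "w \<in> space W" for w using that by force
  then show ?thesis unfolding bounded_measurable_def bounded_iff using value_at_measurable[OF v] by auto
qed

section \<open>The functional on ambiguous acts\<close>

definition ambiguous :: "('w \<Rightarrow> real) \<Rightarrow> ('w, 's) act" where
  "ambiguous f = (\<lambda>(w, s). uinv (f w))"

lemma ambiguous_V0': "f \<in> acts_into W K \<Longrightarrow> ambiguous f \<in> V0' W P"
  and ambiguous_tV0: "f \<in> acts_into W K \<Longrightarrow> ambiguous f \<in> tV0 W P"
proof -
  assume f: "f \<in> acts_into W K"
  have s: "simple_function W (\<lambda>w. uinv (f w))"
    using f unfolding acts_into_def by (auto intro: simple_function_compose1)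
  have "(\<lambda>z. uinv (f (fst z))) \<in> borel_measurable (W \<Otimes>\<^sub>M P)"
    by (rule measurable_compose[OF measurable_fst borel_measurable_simple_function[OF s]])
  moreover have "ambiguous f = (\<lambda>z. uinv (f (fst z)))" unfolding ambiguous_def by auto
  moreover have "ambiguous f ` (space W \<times> space P) \<subseteq> (\<lambda>w. uinv (f w)) ` space W" unfolding ambiguous_def by auto
  then have "finite (ambiguous f ` (space W \<times> space P))" by (rule finite_subset) (rule simple_functionD(1)[OF s])
  ultimately show t: "ambiguous f \<in> tV0 W P" using tV0I by metis
  then show "ambiguous f \<in> V0' W P" unfolding V0'_def ambiguous_def by auto
qed

lemma util_ambiguous: "f \<in> acts_into W K \<Longrightarrow> w \<in> space W \<Longrightarrow> util (ambiguous f (w, s)) = f w"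
  unfolding ambiguous_def acts_into_def using util_uinv by auto

lemma value_at_ambiguous:
  assumes "f \<in> acts_into W K" "w \<in> space W"
  shows "value_at (ambiguous f) w = f w"
proof -
  have "lift (\<lambda>s. ambiguous f (w, s)) = (const (uinv (f w)) :: ('w, 's) act)" by (auto simp: lift_def ambiguous_def)
  then have "value_at (ambiguous f) w = util (uinv (f w))"
    using value_at_eq[OF ambiguous_tV0[OF assms(1)] assms(2)] J_const by simp
  then show ?thesis using assms util_uinv unfolding acts_into_def by auto
qed

definition ambiguous_value :: "('w \<Rightarrow> real) \<Rightarrow> real" where
  "ambiguous_value f = J (ambiguous f)"

text \<open>Quasi-concavity is \<open>A6\<close> with weight 1/2, and translation invariance is the
  consequence of \<open>A7\<close> for constant summands.\<close>

sublocale niveloid W K ambiguous_value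
proof
  show "space W \<noteq> {}" by (rule states)
  show "open K" "is_interval K" "0 \<in> K" by (rule open_range_util is_interval_K zero_K)+
next
  fix f g assume f: "f \<in> acts_into W K" and g: "g \<in> acts_into W K"
  show "ambiguous_value f \<le> ambiguous_value g" if "\<And>w. w \<in> space W \<Longrightarrow> f w \<le> g w"
    unfolding ambiguous_value_def using that f g
    by (intro J_mono ambiguous_tV0) (auto simp: util_ambiguous)
  assume eq: "ambiguous_value f = ambiguous_value g"
  have h: "(\<lambda>w. f w / 2 + g w / 2) \<in> acts_into W K"
    using acts_into_comp2[OF f g, of "\<lambda>a b. a / 2 + b / 2"] mid_K by simp
  have ind: "indiff R (ambiguous f) (ambiguous g)"
    using eq R_iff_J ambiguous_tV0[OF f] ambiguous_tV0[OF g] unfolding indiff_def ambiguous_value_def by simp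
  have mix: "is_mix W P util (1/2) (ambiguous f) (ambiguous g) (ambiguous (\<lambda>w. f w / 2 + g w / 2))"
    unfolding is_mix_def using ambiguous_tV0[OF h] f g h by (auto simp: space_pair_measure util_ambiguous)
  have "R (ambiguous (\<lambda>w. f w / 2 + g w / 2)) (ambiguous f)"
  proof -
    have half: "(1/2::real) \<in> {0<..<1}" by simp
    have "A6 W P R" using rational unfolding satisfies_axioms_def by blast
    from this[unfolded A6_def, rule_format, OF biseparable ambiguous_V0'[OF f] ambiguous_V0'[OF g] half ind mix]
    show ?thesis .
  qed
  then show "ambiguous_value f \<le> ambiguous_value (\<lambda>w. f w / 2 + g w / 2)"
    using R_iff_J ambiguous_tV0 f h unfolding ambiguous_value_def by blast
next
  fix k :: real assume k: "k \<in> K"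
  have "ambiguous (\<lambda>_. k) = const (uinv k)" by (auto simp: ambiguous_def)
  then show "ambiguous_value (\<lambda>_. k) = k" unfolding ambiguous_value_def by (simp add: J_const util_uinv[OF k])
  fix f assume f: "f \<in> acts_into W K" "(\<lambda>w. f w + k) \<in> acts_into W K"
  show "ambiguous_value (\<lambda>w. f w + k) = ambiguous_value f + k"
    unfolding ambiguous_value_def using f
    by (intro J_translate[OF _ _ k] ambiguous_tV0) (auto simp: util_ambiguous)
qed

text \<open>A simple function with values in \<open>K\<close> that bounds \<open>value_at v\<close>
  is itself the state-wise value of an ambiguous act, which \<open>J_section_mono\<close> compares
  with \<open>v\<close>; \<open>ext_eqI\<close> does the rest.\<close>

lemma J_eq_ext:
  assumes v: "v \<in> tV0 W P"
  shows "J v = ext (value_at v)"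
proof -
  obtain lo hi where b: "lo \<in> K" "hi \<in> K" "\<And>w. w \<in> space W \<Longrightarrow> lo \<le> value_at v w \<and> value_at v w \<le> hi"
    using value_at_bounds[OF v] by metis
  have "ext (value_at v) = J v"
  proof (rule ext_eqI[OF value_at_bounded_measurable[OF v] b])
    fix f assume f: "f \<in> acts_into W K"
    show "ambiguous_value f \<le> J v" if "\<And>w. w \<in> space W \<Longrightarrow> f w \<le> value_at v w"
      unfolding ambiguous_value_def using that f by (intro J_section_mono v ambiguous_tV0) (auto simp: value_at_ambiguous)
    show "J v \<le> ambiguous_value f" if "\<And>w. w \<in> space W \<Longrightarrow> value_at v w \<le> f w"
      unfolding ambiguous_value_def using that f by (intro J_section_mono v ambiguous_tV0) (auto simp: value_at_ambiguous)
  qed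
  then show ?thesis by simp
qed

theorem representation: "represented_by W P R util weight penalty"
  unfolding represented_by_def
proof (intro conjI exI[of _ "\<lambda>v. ereal (J v)"] ballI)
  show "is_utility util" "is_distortion weight" "is_penalty W penalty"
    by (rule is_utility_util is_distortion_weight is_penalty_penalty)+
next
  fix v assume v: "v \<in> tV0 W P"
  have obj: "objective W P util weight penalty v Q = ereal (fa_integral W Q (value_at v)) + penalty Q" for Q
    unfolding objective_def value_at_def ..
  show "\<exists>Q\<in>\<Delta> W. ereal (J v) = objective W P util weight penalty v Q"
    unfolding obj J_eq_ext[OF v] using ext_attained[OF value_at_bounded_measurable[OF v]] by metis
  show "ereal (J v) \<le> objective W P util weight penalty v Q" if "Q \<in> \<Delta> W" for Q
    unfolding obj J_eq_ext[OF v] by (rule ext_le_penalty[OF that value_at_bounded_measurable[OF v]])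
  show "R v u \<longleftrightarrow> ereal (J u) \<le> ereal (J v)" if "u \<in> tV0 W P" for u
    using R_iff_J[OF v that] by simp
qed

end

section \<open>Comparison\<close>

text \<open>Acts are compared by the laws of outcomes, while the Choquet integral uses the laws of
  utilities. As only finitely many outcomes occur, a threshold \<open>t\<close> for utilities
  amounts to the threshold \<open>Max A\<close> for outcomes, even when \<open>t\<close> is outside
  the range of \<open>f\<close>.\<close>

lemma (in prob_space) section_cdf_comp:
  fixes f :: "real \<Rightarrow> real"
  assumes f: "is_utility f" and x: "finite (x ` space M)" and y: "finite (y ` space M)"
    and eq: "rv_cdf M x = rv_cdf M y"
  shows "rv_cdf M (\<lambda>s. f (x s)) = rv_cdf M (\<lambda>s. f (y s))"
proof
  fix t
  define A where "A = {a \<in> x ` space M \<union> y ` space M. f a \<le> t}"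
  have fin: "finite A" unfolding A_def using x y by auto
  have mono: "f a \<le> f b \<longleftrightarrow> a \<le> b" for a b using f unfolding is_utility_def by (simp add: strict_mono_less_eq)
  show "rv_cdf M (\<lambda>s. f (x s)) t = rv_cdf M (\<lambda>s. f (y s)) t"
  proof (cases "A = {}")
    case True
    then have "{s \<in> space M. f (x s) \<le> t} = {s \<in> space M. f (y s) \<le> t}" unfolding A_def by auto
    then show ?thesis unfolding rv_cdf_def by (rule arg_cong)
  next
    case False
    have max: "f (Max A) \<le> t" using Max_in[OF fin False] unfolding A_def by simp
    have *: "f a \<le> t \<longleftrightarrow> a \<le> Max A" if "a \<in> x ` space M \<union> y ` space M" for a
      using that max fin mono[of a "Max A"] Max_ge[OF fin, of a] unfolding A_def by fastforce
    have sets: "{s \<in> space M. f (x s) \<le> t} = {s \<in> space M. x s \<le> Max A}"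
      "{s \<in> space M. f (y s) \<le> t} = {s \<in> space M. y s \<le> Max A}" using * by auto
    show ?thesis using fun_cong[OF eq, of "Max A"] unfolding rv_cdf_def sets .
  qed
qed

lemma objective_V0:
  assumes "prob_space P" "space W \<noteq> {}" "is_utility \<phi>" "v \<in> V0 W P"
  obtains k where "\<And>c Q. Q \<in> \<Delta> W \<Longrightarrow> objective W P \<phi> \<psi> c v Q = ereal k + c Q"
proof -
  interpret prob_space P by fact
  obtain w0 where w0: "w0 \<in> space W" using assms(2) by blast
  have fin: "finite ((\<lambda>s. v (w, s)) ` space P)" if "w \<in> space W" for w
    using assms(4) that unfolding V0_def tV0_def
    by (auto simp: space_pair_measure elim!: finite_subset[rotated])
  define k where "k = choquet P \<psi> (\<lambda>s. \<phi> (v (w0, s)))"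
  have eq: "choquet P \<psi> (\<lambda>s. \<phi> (v (w, s))) = k" if w: "w \<in> space W" for w
  proof -
    have "F P v w = F P v w0" using assms(4) w w0 unfolding V0_def by blast
    then show ?thesis unfolding k_def choquet_def F_def
      using section_cdf_comp[OF assms(3) fin[OF w] fin[OF w0]] by simp
  qed
  have "fa_integral W Q (\<lambda>w. choquet P \<psi> (\<lambda>s. \<phi> (v (w, s)))) = k" if Q: "Q \<in> \<Delta> W" for Q
  proof -
    have "fa_integral W Q (\<lambda>w. choquet P \<psi> (\<lambda>s. \<phi> (v (w, s)))) = fa_integral W Q (\<lambda>_. k)"
      unfolding fa_integral_def using eq by (intro SUP_cong) auto
    then show ?thesis using fa_integral_const[OF Q assms(2)] by simp
  qed
  then show ?thesis using that[of k] unfolding objective_def by auto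
qed

text \<open>The number \<open>k\<close> is fixed before the penalty \<open>c\<close>, so two
  relations with the same utility and distortion give a risky act the same value.\<close>

lemma grounded_min_V0:
  assumes "prob_space P" "space W \<noteq> {}" "is_utility \<phi>" "v \<in> V0 W P"
  obtains k where "\<And>c U. grounded W c \<Longrightarrow> \<exists>Q\<in>\<Delta> W. U = objective W P \<phi> \<psi> c v Q \<Longrightarrow>
    \<forall>Q\<in>\<Delta> W. U \<le> objective W P \<phi> \<psi> c v Q \<Longrightarrow> U = ereal k"
proof -
  obtain k where k: "\<And>c Q. Q \<in> \<Delta> W \<Longrightarrow> objective W P \<phi> \<psi> c v Q = ereal k + c Q"
    using objective_V0[OF assms] by blast
  show ?thesis
  proof (rule that[of k])
    fix c U assume c: "grounded W c" and U: "\<exists>Q\<in>\<Delta> W. U = objective W P \<phi> \<psi> c v Q"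
      "\<forall>Q\<in>\<Delta> W. U \<le> objective W P \<phi> \<psi> c v Q"
    obtain Q0 where Q0: "Q0 \<in> \<Delta> W" "c Q0 = 0" using c unfolding grounded_def by blast
    obtain Q where Q: "Q \<in> \<Delta> W" "U = ereal k + c Q" using U(1) k by auto
    have "U \<le> ereal k" using U(2) Q0 k by fastforce
    moreover have "0 \<le> c Q" using c Q(1) unfolding grounded_def by blast
    then have "ereal k \<le> U" unfolding Q(2) using add_left_mono[of 0 "c Q" "ereal k"] by simp
    ultimately show "U = ereal k" by simp
  qed
qed

lemma choquet_cong:
  assumes "prob_space P" "\<forall>p\<in>{0..1}. \<psi>' p = \<psi> p"
  shows "choquet P \<psi>' x = choquet P \<psi> x"
proof -
  interpret prob_space P by fact
  have "1 - rv_cdf P x t \<in> {0..1}" for t unfolding rv_cdf_def by (simp add: prob_le_1)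
  then have "\<psi>' (1 - rv_cdf P x t) = \<psi> (1 - rv_cdf P x t)" for t using assms(2) by blast
  then show ?thesis unfolding choquet_def by simp
qed

text \<open>The chain is \<open>U' u = U u \<le> U v \<le> U' v\<close>: equality because
  \<open>u\<close> is risky, the last step because a minimiser for the larger penalty is a
  competitor for the smaller one.\<close>

lemma more_averseI:
  assumes P: "prob_space P" and W: "space W \<noteq> {}"
    and R': "represented_by W P R' \<phi> \<psi>' c'" and R: "represented_by W P R \<phi> \<psi> c"
    and \<psi>: "\<forall>p\<in>{0..1}. \<psi>' p = \<psi> p" and c: "\<forall>Q\<in>\<Delta> W. c Q \<le> c' Q"
  shows "more_ambiguity_averse W P R R'"
  unfolding more_ambiguity_averse_def
proof (intro ballI impI)
  fix v u assume v: "v \<in> tV0 W P" and u: "u \<in> V0 W P" and Rvu: "R v u"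
  obtain U where U: "\<forall>v\<in>tV0 W P. (\<exists>Q\<in>\<Delta> W. U v = objective W P \<phi> \<psi> c v Q) \<and> (\<forall>Q\<in>\<Delta> W. U v \<le> objective W P \<phi> \<psi> c v Q)"
    "\<forall>v\<in>tV0 W P. \<forall>u\<in>tV0 W P. R v u \<longleftrightarrow> U v \<ge> U u"
    using R unfolding represented_by_def by blast
  have obj: "objective W P \<phi> \<psi>' c' v Q = objective W P \<phi> \<psi> c' v Q" for v Q
    unfolding objective_def choquet_cong[OF P \<psi>] ..
  obtain U' where U': "\<forall>v\<in>tV0 W P. (\<exists>Q\<in>\<Delta> W. U' v = objective W P \<phi> \<psi> c' v Q) \<and> (\<forall>Q\<in>\<Delta> W. U' v \<le> objective W P \<phi> \<psi> c' v Q)"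
    "\<forall>v\<in>tV0 W P. \<forall>u\<in>tV0 W P. R' v u \<longleftrightarrow> U' v \<ge> U' u"
    using R' unfolding represented_by_def obj by blast
  have ut: "u \<in> tV0 W P" using u unfolding V0_def by simp
  have \<phi>: "is_utility \<phi>" and gr: "grounded W c" "grounded W c'"
    using R R' unfolding represented_by_def is_penalty_def by blast+
  obtain k where k: "\<And>c U. grounded W c \<Longrightarrow> \<exists>Q\<in>\<Delta> W. U = objective W P \<phi> \<psi> c u Q \<Longrightarrow>
    \<forall>Q\<in>\<Delta> W. U \<le> objective W P \<phi> \<psi> c u Q \<Longrightarrow> U = ereal k"
    using grounded_min_V0[OF P W \<phi> u] by blast
  have uu: "U u = ereal k" by (rule k[OF gr(1)]) (use U(1) ut in blast)+
  have uu': "U' u = ereal k" by (rule k[OF gr(2)]) (use U'(1) ut in blast)+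
  obtain Q where Q: "Q \<in> \<Delta> W" "U' v = objective W P \<phi> \<psi> c' v Q" using U'(1) v by blast
  have "U v \<le> objective W P \<phi> \<psi> c v Q" using U(1) v Q by blast
  also have "\<dots> \<le> U' v" unfolding Q(2) objective_def using c Q(1) by (intro add_left_mono) blast
  finally have "U v \<le> U' v" .
  moreover have "U u \<le> U v" using U(2) v ut Rvu by blast
  ultimately have "U' u \<le> U' v" unfolding uu uu' by (rule order_trans[rotated])
  then show "R' v u" using U'(2) v ut by blast
qed

text \<open>Constants are risky too, so a risky act and its certainty equivalent may each take
  either place in the comparison, and the one-sided hypothesis transfers the indifference.\<close>

lemma more_averse_same_ce:
  assumes "preference P W R" "preference P W R'" and maa: "more_ambiguity_averse W P R R'" and v: "v \<in> V0 W P"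
  shows "ce R v = ce R' v"
proof -
  interpret A: preference P W R by fact
  interpret B: preference P W R' by fact
  have "R v (const (ce R v))" "R (const (ce R v)) v" using A.indiff_ce[OF A.V0_tV0[OF v]] unfolding indiff_def by auto
  then have "R' v (const (ce R v))" "R' (const (ce R v)) v"
    using maa v A.V0_tV0[OF v] A.const_V0 A.const_tV0 unfolding more_ambiguity_averse_def by blast+
  then have "indiff R' v (const (ce R v))" unfolding indiff_def by blast
  then show ?thesis using B.indiff_iff_ce[OF A.V0_tV0[OF v] A.const_tV0] B.ce_const by simp
qed

text \<open>Agreement on bets makes the families \<open>bet_ce\<close> equal, hence also utility,
  weights, \<open>K\<close> and the embedding of ambiguous acts. Comparing an ambiguous act with its
  certainty equivalent under \<open>R\<close> shows that \<open>R'\<close> values it at least as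
  highly, and the suprema defining the penalties inherit this term by term.\<close>

lemma more_averse_representations:
  assumes A: "preference P W R" and B: "preference P W R'" and maa: "more_ambiguity_averse W P R R'"
  obtains \<phi> \<psi> c c' where "represented_by W P R' \<phi> \<psi> c'" "represented_by W P R \<phi> \<psi> c" "\<forall>Q\<in>\<Delta> W. c Q \<le> c' Q"
proof -
  interpret A: preference P W R by fact
  interpret B: preference P W R' by fact
  have "A.bet_ce p x y = B.bet_ce p x y" for p x y
    unfolding A.bet_ce_def B.bet_ce_def
    by (rule more_averse_same_ce[OF A B maa A.bet_V0[OF A.event_sets]])
  then have eq: "A.bet_ce = B.bet_ce" by blast
  have util: "A.util = B.util" and weight: "A.weight = B.weight" unfolding eq by (rule HOL.refl)+
  have amb: "A.ambiguous f = B.ambiguous f" for f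
    unfolding A.ambiguous_def B.ambiguous_def A.uinv_def B.uinv_def util ..
  have pen: "A.penalty Q \<le> B.penalty Q" for Q
    unfolding A.penalty_def B.penalty_def unfolding util
  proof (rule SUP_mono)
    fix f assume f: "f \<in> acts_into W (range B.util)"
    let ?v = "B.ambiguous f"
    have v: "?v \<in> tV0 W P" by (rule B.ambiguous_tV0[OF f])
    have "R ?v (const (ce R ?v))" using A.indiff_ce[OF v] unfolding indiff_def by simp
    then have "R' ?v (const (ce R ?v))" using maa v A.const_V0 unfolding more_ambiguity_averse_def by blast
    then have "ce R ?v \<le> ce R' ?v" using B.R_iff_ce[OF v B.const_tV0] B.ce_const by simp
    then have "A.ambiguous_value f \<le> B.ambiguous_value f"
      unfolding A.ambiguous_value_def B.ambiguous_value_def A.J_def B.J_def amb util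
      using B.util_strict_mono by (simp add: strict_mono_less_eq)
    then show "\<exists>g\<in>acts_into W (range B.util).
        ereal (A.ambiguous_value f - fa_simple_integral W Q f) \<le> ereal (B.ambiguous_value g - fa_simple_integral W Q g)"
      using f by (intro bexI[of _ f]) auto
  qed
  have "represented_by W P R B.util B.weight A.penalty"
    using A.representation by (simp only: util weight)
  then show ?thesis using that[OF B.representation] pen by blast
qed

theorem proposition4p2:
  fixes W :: "'w measure" and P :: "'s measure"
    and R R' :: "('w, 's) pref"
  assumes "space W \<noteq> {}"
    and "prob_space P" and "nonatomic P" and "supports_uniform P"
    and "satisfies_axioms W P R" and "satisfies_axioms W P R'"
  shows "more_ambiguity_averse W P R R' \<longleftrightarrow>
    (\<exists>\<phi>' \<psi>' c' \<phi> \<psi> c.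
       represented_by W P R' \<phi>' \<psi>' c' \<and> represented_by W P R \<phi> \<psi> c \<and>
       \<phi>' = \<phi> \<and> (\<forall>p\<in>{0..1}. \<psi>' p = \<psi> p) \<and> (\<forall>Q\<in>\<Delta> W. c' Q \<ge> c Q))"
proof
  have pref: "preference P W R" "preference P W R'"
    unfolding preference_def preference_axioms_def using assms by blast+
  assume "more_ambiguity_averse W P R R'"
  from more_averse_representations[OF pref this]
  show "\<exists>\<phi>' \<psi>' c' \<phi> \<psi> c.
       represented_by W P R' \<phi>' \<psi>' c' \<and> represented_by W P R \<phi> \<psi> c \<and>
       \<phi>' = \<phi> \<and> (\<forall>p\<in>{0..1}. \<psi>' p = \<psi> p) \<and> (\<forall>Q\<in>\<Delta> W. c' Q \<ge> c Q)"
    by metis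
qed (use more_averseI[OF assms(2,1)] in blast)

end
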